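(* Let $k$ be a field, let $N\ge 2$ be an integer, let $E$ be a finite-dimensional $k$-vector space, let $R\subset E^{\otimes N}$ be a linear subspace, and let $\mathcal{A}=A(E,R)$ be the corresponding homogeneous algebra of degree $N$. Let $\alpha$ be an automorphism of the graded algebra $\mathcal{A}$, and let $\mathcal{A}^\alpha$ be the semi-cross product of $\mathcal{A}$ by $\alpha$. If $\mathcal{A}$ is Koszul of finite global dimension $D$, then $\mathcal{A}$ is Gorenstein if and only if $\mathcal{A}^\alpha$ is Gorenstein.
   Context: All tensor products are over $k$. For a finite-dimensional vector space $E$ and a subspace $R\subset E^{\otimes N}$, the homogeneous algebra of degree $N$ (or $N$-homogeneous algebra) $A(E,R)$ is $T(E)/I(R)$, where $T(E)$ is the tensor algebra and $I(R)$ is the two-sided ideal generated by $R$; it is graded with $E$ in degree $1$. An automorphism $\alpha$ of the graded algebra $\mathcal{A}=A(E,R)$ is given by a linear automorphism of $E$, still denoted $\alpha$, whose canonical extension to an algebra automorphism of $T(E)$ (also denoted $\alpha$) satisfies $\alpha(R)=R$. The semi-cross product $\mathcal{A}^\alpha$ is the graded vector space underlying $\mathcal{A}$ equipped with the product $x\cdot y=x\,\alpha^{|x|}(y)$ for homogeneous $x,y$, where $|x|$ is the degree of $x$ and the product on the right-hand side is that of $\mathcal{A}$. It is an associative graded algebra with the same unit as $\mathcal{A}$. It is again a homogeneous algebra of degree $N$, namely $\mathcal{A}^\alpha=A(E,\theta_N^{-1}(R))$, where $\theta_N:E^{\otimes N}\to E^{\otimes N}$ is $\theta_N(x_0\otimes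 x_1\otimes\cdots\otimes x_{N-1})=x_0\otimes\alpha(x_1)\otimes\cdots\otimes\alpha^{N-1}(x_{N-1})$. Koszul property. For an $N$-homogeneous algebra $\mathcal{A}=A(E,R)$, let $\mathcal{A}^!=A(E^*,R^\perp)$, where $R^\perp\subset (E^* )^{\otimes N}=(E^{\otimes N})^*$ is the annihilator of $R$, and let $\mathcal{A}^{!*}_i$ be the dual vector space of $\mathcal{A}^!_i$. It is naturally the subspace of $E^{\otimes i}$ given by $\mathcal{A}^{!*}_i=E^{\otimes i}$ for $i<N$ and $\mathcal{A}^{!*}_i=\bigcap_{r+s=i-N}E^{\otimes r}\otimes R\otimes E^{\otimes s}$ for $i\ge N$. Let $d:\mathcal{A}\otimes\mathcal{A}^{!*}_{i+1}\to\mathcal{A}\otimes\mathcal{A}^{!*}_i$ be the left $\mathcal{A}$-linear map induced by $a\otimes(e_0\otimes e_1\otimes\cdots\otimes e_i)\mapsto ae_0\otimes(e_1\otimes\cdots\otimes e_i)$; one has $d^N=0$. The Koszul complex $\mathcal{C}$ of $\mathcal{A}$ is the chain complex of left $\mathcal{A}$-modules with $\mathcal{C}_{2p}=\mathcal{A}\otimes\mathcal{A}^{!*}_{pN}$ and $\mathcal{C}_{2p+1}=\mathcal{A}\otimes\mathcal{A}^{!*}_{pN+1}$ for $p\ge 0$, with differentials $d:\mathcal{C}_{2p+1}\to\mathcal{C}_{2p}$ and $d^{N-1}:\mathcal{C}_{2p+2}\to\mathcal{C}_{2p+1}$. The algebra $\mathcal{A}$ is called Koszul (of Koszul type) if $\mathcal{C}$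 is acyclic in strictly positive degrees. When $\mathcal{A}$ is Koszul, its global dimension is the largest integer $D$ such that $\mathcal{C}_D\neq 0$ (infinite if there is no such integer). Gorenstein property. Let $\mathcal{A}$ be a Koszul $N$-homogeneous algebra of finite global dimension $D$. Let $\mathcal{C}'$ be the cochain complex of right $\mathcal{A}$-modules obtained by applying the contravariant functor $\mathrm{Hom}_{\mathcal{A}}(\bullet,\mathcal{A})$ to the chain complex of left $\mathcal{A}$-modules $\mathcal{C}$. The algebra $\mathcal{A}$ is called Gorenstein (of Gorenstein type) if $H^n(\mathcal{C}')=0$ for all $n<D$ and $H^D(\mathcal{C}')\cong k$ (one-dimensional over $k$). For $\mathcal{A}^\alpha$ the same definition is used, with its own Koszul complex and its own global dimension ($\mathcal{A}^\alpha$ is Koszul of finite global dimension whenever $\mathcal{A}$ is). *)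

theory Defs
  imports HOL.Vector_Spaces "HOL-Library.Function_Algebras" "HOL-Algebra.QuotRing" "HOL-Algebra.Module"
begin

section \<open>Tensors\<close>

text \<open>
  The finite-dimensional vector space \<open>E\<close> is the type \<open>'e\<close> with scalar multiplication \<open>scale\<close>
  and an arbitrary basis \<open>B\<close> (locale \<^locale>\<open>finite_dimensional_vector_space\<close>).
  An element of \<open>T(E)\<close> is given by its coordinates in the basis of words over \<open>B\<close>: the function
  \<open>t :: 'e list \<Rightarrow> 'k\<close> stands for the sum of all \<open>t [x\<^sub>1, \<dots>, x\<^sub>n] \<cdot> x\<^sub>1 \<otimes> \<dots> \<otimes> x\<^sub>n\<close>.
\<close>

definition words :: "'e set \<Rightarrow> nat \<Rightarrow> 'e list set" where
  "words B n = {w. set w \<subseteq> B \<and> length w = n}"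

definition tensor_scale :: "'k::field \<Rightarrow> ('e list \<Rightarrow> 'k) \<Rightarrow> ('e list \<Rightarrow> 'k)" where
  "tensor_scale c t = (\<lambda>w. c * t w)"

definition tensor_mult :: "('e list \<Rightarrow> 'k::field) \<Rightarrow> ('e list \<Rightarrow> 'k) \<Rightarrow> ('e list \<Rightarrow> 'k)" where
  "tensor_mult s t = (\<lambda>w. \<Sum>i\<le>length w. s (take i w) * t (drop i w))"

text \<open>\<open>E\<^bsup>\<otimes>n\<^esup>\<close> as a subspace of \<open>T(E)\<close>\<close>

definition tensor_power :: "'e set \<Rightarrow> nat \<Rightarrow> ('e list \<Rightarrow> 'k::field) set" where
  "tensor_power B n = {t. \<forall>w. t w \<noteq> 0 \<longrightarrow> w \<in> words B n}"

text \<open>\<open>e\<^sub>0 \<otimes> \<dots> \<otimes> e\<^sub>n\<^sub>-\<^sub>1\<close> for arbitrary vectors \<open>e\<^sub>i\<close> of \<open>E\<close>\<close>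

definition pure_tensor ::
  "('k::field \<Rightarrow> 'e::ab_group_add \<Rightarrow> 'e) \<Rightarrow> 'e set \<Rightarrow> 'e list \<Rightarrow> ('e list \<Rightarrow> 'k)" where
  "pure_tensor scale B es = (\<lambda>w. if length w = length es
     then \<Prod>i<length es. module.representation scale B (es ! i) (w ! i) else 0)"

text \<open>The canonical extension to \<open>T(E)\<close> of a linear endomorphism \<open>\<alpha>\<close> of \<open>E\<close>\<close>

definition tensor_map ::
  "('k::field \<Rightarrow> 'e::ab_group_add \<Rightarrow> 'e) \<Rightarrow> 'e set \<Rightarrow> ('e \<Rightarrow> 'e)
     \<Rightarrow> ('e list \<Rightarrow> 'k) \<Rightarrow> ('e list \<Rightarrow> 'k)" where
  "tensor_map scale B \<alpha> t =
     (\<lambda>w. \<Sum>v | t v \<noteq> 0. t v * pure_tensor scale B (map \<alpha> v) w)"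


section \<open>Graded algebras\<close>

text \<open>
  Graded \<open>k\<close>-algebras, with the map \<open>gen\<close> that places \<open>E\<close> in degree 1.
  The field of scalars \<open>'k\<close> is a type, so \<open>smult\<close> is total in its first argument.
\<close>

record ('k, 'e, 'a) graded_algebra = "('k, 'a) module" +
  comp :: "nat \<Rightarrow> 'a set"
  gen :: "'e \<Rightarrow> 'a"

definition tensor_algebra ::
  "('k::field \<Rightarrow> 'e::ab_group_add \<Rightarrow> 'e) \<Rightarrow> 'e set \<Rightarrow> ('k, 'e, 'e list \<Rightarrow> 'k) graded_algebra" where
  "tensor_algebra scale B =
     \<lparr>carrier = {t. finite {w. t w \<noteq> 0} \<and> (\<forall>w. t w \<noteq> 0 \<longrightarrow> set w \<subseteq> B)},
      monoid.mult = tensor_mult, one = (\<lambda>w. if w = [] then 1 else 0),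
      ring.zero = 0, add = (+), smult = tensor_scale,
      comp = tensor_power B, gen = (\<lambda>e. pure_tensor scale B [e])\<rparr>"

definition quotient_algebra ::
  "('k, 'e, 'a) graded_algebra \<Rightarrow> 'a set \<Rightarrow> ('k, 'e, 'a set) graded_algebra" where
  "quotient_algebra A I =
     \<lparr>carrier = carrier (A Quot I), monoid.mult = monoid.mult (A Quot I), one = one (A Quot I),
      ring.zero = ring.zero (A Quot I), add = add (A Quot I),
      smult = (\<lambda>c X. \<Union>x\<in>X. I +>\<^bsub>A\<^esub> (c \<odot>\<^bsub>A\<^esub> x)),
      comp = (\<lambda>n. (\<lambda>x. I +>\<^bsub>A\<^esub> x) ` comp A n), gen = (\<lambda>e. I +>\<^bsub>A\<^esub> gen A e)\<rparr>"

text \<open>\<open>A(E,R) = T(E)/I(R)\<close>; ideals in HOL-Algebra are two-sided.\<close>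

definition homogeneous_algebra ::
  "('k::field \<Rightarrow> 'e::ab_group_add \<Rightarrow> 'e) \<Rightarrow> 'e set \<Rightarrow> ('e list \<Rightarrow> 'k) set
     \<Rightarrow> ('k, 'e, ('e list \<Rightarrow> 'k) set) graded_algebra" where
  "homogeneous_algebra scale B R =
     quotient_algebra (tensor_algebra scale B) (genideal (tensor_algebra scale B) R)"

text \<open>The family of homogeneous components of an element\<close>

definition hparts :: "('k, 'e, 'a) graded_algebra \<Rightarrow> 'a \<Rightarrow> nat \<Rightarrow> 'a" where
  "hparts A x = (THE p. (\<forall>n. p n \<in> comp A n) \<and> finite {n. p n \<noteq> \<zero>\<^bsub>A\<^esub>} \<and>
     x = (\<Oplus>\<^bsub>A\<^esub>n \<in> {n. p n \<noteq> \<zero>\<^bsub>A\<^esub>}. p n))"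

text \<open>
  The semi-cross product by a graded automorphism \<open>a\<close> of the algebra \<open>A\<close>: the product
  \<open>x a\<^bsup>|x|\<^esup>(y)\<close> for homogeneous \<open>x\<close>, extended additively in \<open>x\<close>.
\<close>

definition semi_cross ::
  "('k, 'e, 'a) graded_algebra \<Rightarrow> ('a \<Rightarrow> 'a) \<Rightarrow> ('k, 'e, 'a) graded_algebra" where
  "semi_cross A a = A\<lparr>monoid.mult := (\<lambda>x y.
     \<Oplus>\<^bsub>A\<^esub>n \<in> {n. hparts A x n \<noteq> \<zero>\<^bsub>A\<^esub>}. hparts A x n \<otimes>\<^bsub>A\<^esub> (a ^^ n) y)\<rparr>"

text \<open>
  A linear automorphism of \<open>E\<close> whose extension to \<open>T(E)\<close> preserves \<open>R\<close>, and the
  automorphism of \<open>A(E,R)\<close> it induces: the class \<open>t + I(R)\<close>, as a set, is sent to its image.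
\<close>

definition homogeneous_automorphism ::
  "('k::field \<Rightarrow> 'e::ab_group_add \<Rightarrow> 'e) \<Rightarrow> 'e set \<Rightarrow> ('e list \<Rightarrow> 'k) set \<Rightarrow> ('e \<Rightarrow> 'e) \<Rightarrow> bool" where
  "homogeneous_automorphism scale B R \<alpha> \<longleftrightarrow>
     Vector_Spaces.linear scale scale \<alpha> \<and> bij \<alpha> \<and> tensor_map scale B \<alpha> ` R = R"

definition induced_map ::
  "('k::field \<Rightarrow> 'e::ab_group_add \<Rightarrow> 'e) \<Rightarrow> 'e set \<Rightarrow> ('e \<Rightarrow> 'e)
     \<Rightarrow> ('e list \<Rightarrow> 'k) set \<Rightarrow> ('e list \<Rightarrow> 'k) set" where
  "induced_map scale B \<alpha> = (\<lambda>X. tensor_map scale B \<alpha> ` X)"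


section \<open>The Koszul complex\<close>

text \<open>
  The space of relations of an \<open>N\<close>-homogeneous algebra is recovered from the algebra as the
  degree \<open>N\<close> part of the kernel of the canonical homomorphism \<open>T(E) \<rightarrow> A\<close>
  (see \<open>relations_homogeneous_algebra\<close> below for \<open>A(E,R)\<close>).
\<close>

definition canonical_hom :: "('k::field, 'e, 'a) graded_algebra \<Rightarrow> ('e list \<Rightarrow> 'k) \<Rightarrow> 'a" where
  "canonical_hom A t = (\<Oplus>\<^bsub>A\<^esub>v \<in> {v. t v \<noteq> 0}.
     t v \<odot>\<^bsub>A\<^esub> foldr (\<lambda>x y. gen A x \<otimes>\<^bsub>A\<^esub> y) v \<one>\<^bsub>A\<^esub>)"

definition relations ::
  "'e set \<Rightarrow> nat \<Rightarrow> ('k::field, 'e, 'a) graded_algebra \<Rightarrow> ('e list \<Rightarrow> 'k) set" where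
  "relations B N A = {t \<in> tensor_power B N. canonical_hom A t = \<zero>\<^bsub>A\<^esub>}"

text \<open>The dual of the degree \<open>i\<close> component of the dual algebra, as a subspace of \<open>E\<^bsup>\<otimes>i\<^esup>\<close>\<close>

definition koszul_dual ::
  "'e set \<Rightarrow> nat \<Rightarrow> ('k::field, 'e, 'a) graded_algebra \<Rightarrow> nat \<Rightarrow> ('e list \<Rightarrow> 'k) set" where
  "koszul_dual B N A i =
     (if i < N then tensor_power B i
      else \<Inter>(r, s) \<in> {(r, s). r + s = i - N}.
        module.span tensor_scale {tensor_mult (tensor_mult u \<rho>) v | u \<rho> v.
          u \<in> tensor_power B r \<and> \<rho> \<in> relations B N A \<and> v \<in> tensor_power B s})"

text \<open>
  An element of \<open>A \<otimes> E\<^bsup>\<otimes>i\<^esup>\<close> is given by its family of coefficients in \<open>A\<close> indexed by the words of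
  length \<open>i\<close>; \<open>free_tensor B i A W\<close> is the subspace \<open>A \<otimes> W\<close>, for \<open>W \<subseteq> E\<^bsup>\<otimes>i\<^esup>\<close>.
\<close>

definition free_tensor ::
  "'e set \<Rightarrow> nat \<Rightarrow> ('k::field, 'e, 'a) graded_algebra \<Rightarrow> ('e list \<Rightarrow> 'k) set \<Rightarrow> ('e list \<Rightarrow> 'a) set" where
  "free_tensor B i A W = {F. \<exists>(m::nat) a t. (\<forall>j<m. a j \<in> carrier A \<and> t j \<in> W) \<and>
     F = (\<lambda>w\<in>words B i. \<Oplus>\<^bsub>A\<^esub>j\<in>{..<m}. t j w \<odot>\<^bsub>A\<^esub> a j)}"

text \<open>The map \<open>d : A \<otimes> E\<^bsup>\<otimes>(i+1)\<^esup> \<rightarrow> A \<otimes> E\<^bsup>\<otimes>i\<^esup>\<close> and its iterates \<open>d\<^sup>m : A \<otimes> E\<^bsup>\<otimes>(i+m)\<^esup> \<rightarrow> A \<otimes> E\<^bsup>\<otimes>i\<^esup>\<close>\<close>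

definition koszul_d ::
  "'e set \<Rightarrow> ('k::field, 'e, 'a) graded_algebra \<Rightarrow> nat \<Rightarrow> ('e list \<Rightarrow> 'a) \<Rightarrow> ('e list \<Rightarrow> 'a)" where
  "koszul_d B A i F = (\<lambda>w\<in>words B i. \<Oplus>\<^bsub>A\<^esub>x\<in>B. F (x # w) \<otimes>\<^bsub>A\<^esub> gen A x)"

primrec koszul_d_power ::
  "'e set \<Rightarrow> ('k::field, 'e, 'a) graded_algebra \<Rightarrow> nat \<Rightarrow> nat \<Rightarrow> ('e list \<Rightarrow> 'a) \<Rightarrow> ('e list \<Rightarrow> 'a)" where
  "koszul_d_power B A 0 i F = F"
| "koszul_d_power B A (Suc m) i F = koszul_d B A i (koszul_d_power B A m (Suc i) F)"

definition koszul_degree :: "nat \<Rightarrow> nat \<Rightarrow> nat" where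
  "koszul_degree N n = (n div 2) * N + n mod 2"

definition koszul_chains ::
  "'e set \<Rightarrow> nat \<Rightarrow> ('k::field, 'e, 'a) graded_algebra \<Rightarrow> nat \<Rightarrow> ('e list \<Rightarrow> 'a) set" where
  "koszul_chains B N A n =
     free_tensor B (koszul_degree N n) A (koszul_dual B N A (koszul_degree N n))"

definition chain_zero ::
  "'e set \<Rightarrow> nat \<Rightarrow> ('k::field, 'e, 'a) graded_algebra \<Rightarrow> nat \<Rightarrow> ('e list \<Rightarrow> 'a)" where
  "chain_zero B N A n = (\<lambda>w\<in>words B (koszul_degree N n). \<zero>\<^bsub>A\<^esub>)"

definition chain_add ::
  "'e set \<Rightarrow> nat \<Rightarrow> ('k::field, 'e, 'a) graded_algebra \<Rightarrow> nat
     \<Rightarrow> ('e list \<Rightarrow> 'a) \<Rightarrow> ('e list \<Rightarrow> 'a) \<Rightarrow> ('e list \<Rightarrow> 'a)" where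
  "chain_add B N A n F G = (\<lambda>w\<in>words B (koszul_degree N n). F w \<oplus>\<^bsub>A\<^esub> G w)"

definition chain_lmult ::
  "'e set \<Rightarrow> nat \<Rightarrow> ('k::field, 'e, 'a) graded_algebra \<Rightarrow> nat
     \<Rightarrow> 'a \<Rightarrow> ('e list \<Rightarrow> 'a) \<Rightarrow> ('e list \<Rightarrow> 'a)" where
  "chain_lmult B N A n a F = (\<lambda>w\<in>words B (koszul_degree N n). a \<otimes>\<^bsub>A\<^esub> F w)"

text \<open>The differential from degree \<open>n + 1\<close> to degree \<open>n\<close>\<close>

definition koszul_diff ::
  "'e set \<Rightarrow> nat \<Rightarrow> ('k::field, 'e, 'a) graded_algebra \<Rightarrow> nat \<Rightarrow> ('e list \<Rightarrow> 'a) \<Rightarrow> ('e list \<Rightarrow> 'a)" where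
  "koszul_diff B N A n =
     koszul_d_power B A (if even n then 1 else N - 1) (koszul_degree N n)"

definition koszul_algebra :: "'e set \<Rightarrow> nat \<Rightarrow> ('k::field, 'e, 'a) graded_algebra \<Rightarrow> bool" where
  "koszul_algebra B N A \<longleftrightarrow> (\<forall>n.
     {F \<in> koszul_chains B N A (Suc n). koszul_diff B N A n F = chain_zero B N A n} =
     koszul_diff B N A (Suc n) ` koszul_chains B N A (Suc (Suc n)))"

definition has_global_dimension ::
  "'e set \<Rightarrow> nat \<Rightarrow> ('k::field, 'e, 'a) graded_algebra \<Rightarrow> nat \<Rightarrow> bool" where
  "has_global_dimension B N A D \<longleftrightarrow>
     koszul_chains B N A D \<noteq> {chain_zero B N A D} \<and>
     (\<forall>n>D. koszul_chains B N A n = {chain_zero B N A n})"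


section \<open>The Gorenstein property\<close>

text \<open>Left \<open>A\<close>-linear maps to \<open>A\<close>, and the cochain complex obtained by transposing the differentials\<close>

definition koszul_cochains ::
  "'e set \<Rightarrow> nat \<Rightarrow> ('k::field, 'e, 'a) graded_algebra \<Rightarrow> nat \<Rightarrow> (('e list \<Rightarrow> 'a) \<Rightarrow> 'a) set" where
  "koszul_cochains B N A n = {f \<in> koszul_chains B N A n \<rightarrow>\<^sub>E carrier A.
     (\<forall>F\<in>koszul_chains B N A n. \<forall>G\<in>koszul_chains B N A n.
        f (chain_add B N A n F G) = f F \<oplus>\<^bsub>A\<^esub> f G) \<and>
     (\<forall>a\<in>carrier A. \<forall>F\<in>koszul_chains B N A n.
        f (chain_lmult B N A n a F) = a \<otimes>\<^bsub>A\<^esub> f F)}"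

definition koszul_codiff ::
  "'e set \<Rightarrow> nat \<Rightarrow> ('k::field, 'e, 'a) graded_algebra \<Rightarrow> nat
     \<Rightarrow> (('e list \<Rightarrow> 'a) \<Rightarrow> 'a) \<Rightarrow> (('e list \<Rightarrow> 'a) \<Rightarrow> 'a)" where
  "koszul_codiff B N A n f = (\<lambda>F\<in>koszul_chains B N A (Suc n). f (koszul_diff B N A n F))"

definition cochain_zero ::
  "'e set \<Rightarrow> nat \<Rightarrow> ('k::field, 'e, 'a) graded_algebra \<Rightarrow> nat \<Rightarrow> (('e list \<Rightarrow> 'a) \<Rightarrow> 'a)" where
  "cochain_zero B N A n = (\<lambda>F\<in>koszul_chains B N A n. \<zero>\<^bsub>A\<^esub>)"

definition koszul_cocycles ::
  "'e set \<Rightarrow> nat \<Rightarrow> ('k::field, 'e, 'a) graded_algebra \<Rightarrow> nat \<Rightarrow> (('e list \<Rightarrow> 'a) \<Rightarrow> 'a) set" where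
  "koszul_cocycles B N A n =
     {f \<in> koszul_cochains B N A n. koszul_codiff B N A n f = cochain_zero B N A (Suc n)}"

definition koszul_coboundaries ::
  "'e set \<Rightarrow> nat \<Rightarrow> ('k::field, 'e, 'a) graded_algebra \<Rightarrow> nat \<Rightarrow> (('e list \<Rightarrow> 'a) \<Rightarrow> 'a) set" where
  "koszul_coboundaries B N A n = (case n of 0 \<Rightarrow> {cochain_zero B N A 0}
     | Suc m \<Rightarrow> koszul_codiff B N A m ` koszul_cochains B N A m)"

definition cohomology_vanishes ::
  "'e set \<Rightarrow> nat \<Rightarrow> ('k::field, 'e, 'a) graded_algebra \<Rightarrow> nat \<Rightarrow> bool" where
  "cohomology_vanishes B N A n \<longleftrightarrow> koszul_cocycles B N A n = koszul_coboundaries B N A n"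

text \<open>
  An isomorphism of vector spaces from cocycles modulo coboundaries to \<open>k\<close>, given as a
  surjective linear form on the cocycles whose kernel is the space of coboundaries.
\<close>

definition cohomology_one_dimensional ::
  "'e set \<Rightarrow> nat \<Rightarrow> ('k::field, 'e, 'a) graded_algebra \<Rightarrow> nat \<Rightarrow> bool" where
  "cohomology_one_dimensional B N A n \<longleftrightarrow>
     (\<exists>\<phi> :: (('e list \<Rightarrow> 'a) \<Rightarrow> 'a) \<Rightarrow> 'k.
        (\<forall>f\<in>koszul_cocycles B N A n. \<forall>g\<in>koszul_cocycles B N A n.
           \<phi> (\<lambda>F\<in>koszul_chains B N A n. f F \<oplus>\<^bsub>A\<^esub> g F) = \<phi> f + \<phi> g) \<and>
        (\<forall>c. \<forall>f\<in>koszul_cocycles B N A n.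
           \<phi> (\<lambda>F\<in>koszul_chains B N A n. c \<odot>\<^bsub>A\<^esub> f F) = c * \<phi> f) \<and>
        \<phi> ` koszul_cocycles B N A n = UNIV \<and>
        {f \<in> koszul_cocycles B N A n. \<phi> f = 0} = koszul_coboundaries B N A n)"

text \<open>Gorenstein algebras are by definition Koszul of finite global dimension.\<close>

definition gorenstein_algebra :: "'e set \<Rightarrow> nat \<Rightarrow> ('k::field, 'e, 'a) graded_algebra \<Rightarrow> bool" where
  "gorenstein_algebra B N A \<longleftrightarrow> koszul_algebra B N A \<and>
     (\<exists>D. has_global_dimension B N A D \<and>
        (\<forall>n<D. cohomology_vanishes B N A n) \<and> cohomology_one_dimensional B N A D)"

end

theory Submission
  imports Defs
begin

text \<open>
  Write \<open>A' = A\<^sup>\<alpha>\<close> and \<open>\<theta>\<^sub>i(e\<^sub>0 \<otimes> \<dots> \<otimes> e\<^sub>i\<^sub>-\<^sub>1) = e\<^sub>0 \<otimes> \<alpha>(e\<^sub>1) \<otimes> \<dots> \<otimes> \<alpha>\<^bsup>i-1\<^esup>(e\<^sub>i\<^sub>-\<^sub>1)\<close>.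
  The dual spaces satisfy \<open>W'\<^sub>i = \<theta>\<^sub>i\<^sup>-\<^sup>1(W\<^sub>i)\<close>, and \<open>a \<otimes> w \<mapsto> a \<otimes> \<alpha>\<^bsup>|a|\<^esup>(\<theta>\<^sub>i(w))\<close> is a \<open>k\<close>-linear
  isomorphism from the Koszul complex of \<open>A'\<close> to that of \<open>A\<close>; so \<open>A\<close> and \<open>A'\<close> are simultaneously
  Koszul, with the same global dimension. This map is only semilinear over \<open>A\<close>. On cochains one uses
  instead \<open>f'(a \<otimes> w) = \<alpha>\<^sup>n(f(\<alpha>\<^sup>-\<^sup>n(a) \<otimes> \<alpha>\<^sup>-\<^sup>i(\<theta>\<^sub>i(w))))\<close> with \<open>n = |a| + i\<close> the total degree: this turns
  \<open>A\<close>-linear forms into \<open>A'\<close>-linear forms, and commutes with the codifferentials because the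
  differentials preserve the total degree.

  The relation between \<open>A\<close> and \<open>A'\<close> is symmetric (\<open>A = A'\<^bsup>\<alpha>\<^sup>-\<^sup>1\<^esup>\<close>), so every implication is proved in one
  direction only.
\<close>

section \<open>Tensors\<close>

text \<open>Why the isomorphism of complexes cannot simply be composed with linear forms: a power of
  \<alpha> on the tensor factors that varies with |a| destroys left linearity in a. Applying
  \<alpha>^(-n) on the part of total degree n removes this obstacle. The exponent on the j-th tensor
  factor becomes j - i, which no longer depends on |a|; the remaining dependence sits on the
  coefficient, where the outer \<alpha>^n undoes it up to exactly the power of \<alpha> that the
  product of A' asks for. A linear form need not be homogeneous, so n is read off the argument, and
  the argument is split into its finitely many homogeneous parts. The dual spaces are respected
  because a relation placed at offset r is moved by \<theta>_N followed by a power of \<alpha> or of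
  its inverse. To exploit the symmetry, A and A' are treated as two products on one graded vector
  space, with inverse pairs of maps on the algebra and on E that can be exchanged.\<close>

lemma words_0 [simp]: "words B 0 = {[]}"
  by (auto simp: words_def)

lemma words_Suc: "words B (Suc n) = (\<Union>y\<in>B. (#) y ` words B n)"
  by (auto simp: words_def length_Suc_conv image_iff)

lemma Cons_in_words_Suc [simp]: "y # w \<in> words B (Suc n) \<longleftrightarrow> y \<in> B \<and> w \<in> words B n"
  by (auto simp: words_def)

lemma finite_words: "finite B \<Longrightarrow> finite (words B n)"
  by (induction n) (auto simp: words_Suc)

lemma words_length: "w \<in> words B n \<Longrightarrow> length w = n"
  by (simp add: words_def)

lemma sum_words_Suc:
  fixes f :: "'e list \<Rightarrow> 'c::comm_monoid_add"
  assumes "finite B"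
  shows "sum f (words B (Suc n)) = (\<Sum>y\<in>B. \<Sum>w\<in>words B n. f (y # w))"
proof -
  have "sum f (words B (Suc n)) = (\<Sum>y\<in>B. sum f ((#) y ` words B n))"
    unfolding words_Suc by (rule sum.UNION_disjoint) (auto simp: assms finite_words)
  also have "\<dots> = (\<Sum>y\<in>B. \<Sum>w\<in>words B n. f (y # w))"
    by (rule sum.cong[OF refl], subst sum.reindex) (auto simp: inj_on_def)
  finally show ?thesis .
qed

text \<open>Separating the cut before the first letter from the others turns the sum over all cuts
  into a recursion on the word.\<close>

lemma tensor_mult_Cons:
  "tensor_mult s t (x # w) = s [] * t (x # w) + tensor_mult (\<lambda>u. s (x # u)) t w"
  by (simp add: tensor_mult_def sum.atMost_Suc_shift del: sum.atMost_Suc)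

lemma tensor_mult_Nil: "tensor_mult s t [] = s [] * t []"
  by (simp add: tensor_mult_def)

lemma tensor_mult_add_left: "tensor_mult (s + s') t = tensor_mult s t + tensor_mult s' t"
  by (rule ext) (simp add: tensor_mult_def sum.distrib algebra_simps)

lemma tensor_mult_add_right: "tensor_mult s (t + t') = tensor_mult s t + tensor_mult s t'"
  by (rule ext) (simp add: tensor_mult_def sum.distrib algebra_simps)

lemma tensor_mult_scale_left: "tensor_mult (tensor_scale c s) t = tensor_scale c (tensor_mult s t)"
  by (rule ext) (simp add: tensor_mult_def tensor_scale_def sum_distrib_left algebra_simps)

lemma tensor_mult_scale_right: "tensor_mult s (tensor_scale c t) = tensor_scale c (tensor_mult s t)"
  by (rule ext) (simp add: tensor_mult_def tensor_scale_def sum_distrib_left algebra_simps)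

lemma tensor_mult_assoc: "tensor_mult (tensor_mult r s) t = tensor_mult r (tensor_mult s t)"
proof
  fix w show "tensor_mult (tensor_mult r s) t w = tensor_mult r (tensor_mult s t) w"
  proof (induction w arbitrary: r)
    case Nil
    then show ?case by (simp add: tensor_mult_Nil)
  next
    case (Cons x w)
    \<comment> \<open>A first letter x of a word in a product comes either from s, weighted by
      \<open>r []\<close>, or from r.\<close>
    have "(\<lambda>u. tensor_mult r s (x # u)) =
      tensor_scale (r []) (\<lambda>u. s (x # u)) + tensor_mult (\<lambda>u. r (x # u)) s"
      by (rule ext) (simp add: tensor_mult_Cons tensor_scale_def)
    moreover have "tensor_mult (tensor_scale (r []) (\<lambda>u. s (x # u))) t w =
      r [] * tensor_mult (\<lambda>u. s (x # u)) t w"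
      by (simp add: tensor_mult_scale_left) (simp add: tensor_scale_def)
    ultimately show ?case
      using Cons[of "\<lambda>u. r (x # u)"]
      by (simp add: tensor_mult_Cons tensor_mult_Nil tensor_mult_add_left
          distrib_left mult.assoc add.assoc)
  qed
qed

lemma tensor_mult_nonzeroE:
  assumes "tensor_mult s t w \<noteq> 0"
  obtains u v where "w = u @ v" "s u \<noteq> 0" "t v \<noteq> 0"
proof -
  obtain i where "s (take i w) * t (drop i w) \<noteq> 0"
    using assms unfolding tensor_mult_def by (meson sum.neutral)
  then show ?thesis by (intro that[of "take i w" "drop i w"]) auto
qed

lemma tensor_mult_homogeneous:
  assumes "\<And>u. s u \<noteq> 0 \<Longrightarrow> length u = p"
  shows "tensor_mult s t w = (if p \<le> length w then s (take p w) * t (drop p w) else 0)"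
proof -
  have "tensor_mult s t w = (\<Sum>i\<le>length w. if i = p then s (take p w) * t (drop p w) else 0)"
    unfolding tensor_mult_def
  proof (rule sum.cong)
    fix i assume "i \<in> {..length w}"
    then show "s (take i w) * t (drop i w) = (if i = p then s (take p w) * t (drop p w) else 0)"
      using assms[of "take i w"] by (cases "s (take i w) = 0") auto
  qed simp
  then show ?thesis by simp
qed

lemma tensor_module: "Modules.module (tensor_scale :: 'k::field \<Rightarrow> ('e list \<Rightarrow> 'k) \<Rightarrow> _)"
  by unfold_locales (simp_all add: tensor_scale_def fun_eq_iff distrib_left distrib_right mult.assoc)

interpretation tensor: Modules.module "tensor_scale :: 'k::field \<Rightarrow> ('e list \<Rightarrow> 'k) \<Rightarrow> _"
  by (rule tensor_module)

lemma finite_support_add: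
  fixes s t :: "'w \<Rightarrow> 'k::field"
  assumes "finite {w. s w \<noteq> 0}" "finite {w. t w \<noteq> 0}"
  shows "finite {w. (s + t) w \<noteq> 0}"
  by (rule finite_subset[of _ "{w. s w \<noteq> 0} \<union> {w. t w \<noteq> 0}"]) (use assms in auto)

text \<open>\<open>g\<^sub>0 \<otimes> g\<^sub>1 \<otimes> \<dots>\<close> on pure tensors, given by their list of factors\<close>

primrec twist_word :: "(nat \<Rightarrow> 'e \<Rightarrow> 'e) \<Rightarrow> 'e list \<Rightarrow> 'e list" where
  "twist_word g [] = []"
| "twist_word g (x # v) = g 0 x # twist_word (\<lambda>j. g (Suc j)) v"

lemma length_twist_word [simp]: "length (twist_word g v) = length v"
  by (induction v arbitrary: g) auto

lemma twist_word_const: "twist_word (\<lambda>_. f) = map f"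
proof
  show "twist_word (\<lambda>_. f) v = map f v" for v
    by (induction v) auto
qed

lemma twist_word_twist_word: "twist_word g (twist_word h v) = twist_word (\<lambda>j. g j \<circ> h j) v"
  by (induction v arbitrary: g h) auto

lemma twist_word_append:
  "twist_word g (u @ v) = twist_word g u @ twist_word (\<lambda>j. g (length u + j)) v"
  by (induction u arbitrary: g) auto

lemma twist_word_cong: "(\<And>j. j < length v \<Longrightarrow> g j = h j) \<Longrightarrow> twist_word g v = twist_word h v"
proof (induction v arbitrary: g h)
  case (Cons x v)
  then have "twist_word (\<lambda>j. g (Suc j)) v = twist_word (\<lambda>j. h (Suc j)) v"
    by (intro Cons.IH) auto
  then show ?case using Cons.prems[of 0] by simp
qed simp

lemma twist_word_id: "(\<And>j x. j < length v \<Longrightarrow> g j x = x) \<Longrightarrow> twist_word g v = v"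
proof (induction v arbitrary: g)
  case (Cons x v)
  then have "twist_word (\<lambda>j. g (Suc j)) v = v"
    by (intro Cons.IH) auto
  then show ?case using Cons.prems[of 0 x] by simp
qed simp

locale tensor_basis = finite_dimensional_vector_space scale B
  for scale :: "'k::field \<Rightarrow> 'e::ab_group_add \<Rightarrow> 'e" and B :: "'e set"
begin

abbreviation pure :: "'e list \<Rightarrow> 'e list \<Rightarrow> 'k" where
  "pure \<equiv> pure_tensor scale B"

abbreviation E :: "nat \<Rightarrow> ('e list \<Rightarrow> 'k) set" where
  "E \<equiv> tensor_power B"

abbreviation coord :: "'e \<Rightarrow> 'e \<Rightarrow> 'k" where
  "coord \<equiv> representation B"

abbreviation lin :: "('e \<Rightarrow> 'e) \<Rightarrow> bool" where
  "lin \<equiv> Vector_Spaces.linear scale scale"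

lemma pure_Nil: "pure [] w = (if w = [] then 1 else 0)"
  by (simp add: pure_tensor_def)

lemma pure_Cons_Nil [simp]: "pure (e # es) [] = 0"
  by (simp add: pure_tensor_def)

lemma pure_Cons_Cons: "pure (e # es) (y # w) = coord e y * pure es w"
  by (simp add: pure_tensor_def prod.lessThan_Suc_shift del: prod.lessThan_Suc)

lemma pure_nonzero: "pure es w \<noteq> 0 \<Longrightarrow> w \<in> words B (length es)"
proof (induction es arbitrary: w)
  case Nil
  then show ?case by (auto simp: pure_Nil split: if_splits)
next
  case (Cons e es)
  then show ?case
    by (cases w) (auto simp: pure_Cons_Cons dest: representation_ne_zero)
qed

lemma representation_basis_vec: "b \<in> B \<Longrightarrow> coord b y = (if y = b then 1 else 0)"
  by (simp add: representation_basis independent_Basis)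

lemma sum_representation: "(\<Sum>y\<in>B. scale (coord e y) y) = e"
  by (rule sum_representation_eq) (auto simp: independent_Basis span_Basis finite_Basis)

lemma pure_word: "set v \<subseteq> B \<Longrightarrow> pure v w = (if w = v then 1 else 0)"
proof (induction v arbitrary: w)
  case Nil
  then show ?case by (auto simp: pure_Nil)
next
  case (Cons e es)
  then show ?case
    by (cases w) (auto simp: pure_Cons_Cons representation_basis_vec)
qed

lemma pure_append: "pure (u @ v) = tensor_mult (pure u) (pure v)"
proof
  fix w show "pure (u @ v) w = tensor_mult (pure u) (pure v) w"
  proof (induction u arbitrary: w)
    case Nil
    show ?case
      by (subst tensor_mult_homogeneous[where p = 0]) (auto simp: pure_Nil split: if_splits)
  next
    case (Cons e u)
    show ?case
    proof (cases w)
      case Nil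
      then show ?thesis by (simp add: tensor_mult_Nil)
    next
      case (Cons y w')
      have "(\<lambda>u'. pure (e # u) (y # u')) = tensor_scale (coord e y) (pure u)"
        by (rule ext) (simp add: pure_Cons_Cons tensor_scale_def)
      then show ?thesis
        using Cons.IH by (simp add: Cons tensor_mult_Cons pure_Cons_Cons tensor_mult_scale_left)
          (simp add: tensor_scale_def)
    qed
  qed
qed

subsection \<open>Finitely supported tensors\<close>

text \<open>Common generalisation of the tensor powers (S the words of length n over B) and of the
  carrier of T(E) (S all words over B), so that induction principles are proved once.\<close>

definition tensors_on :: "'e list set \<Rightarrow> ('e list \<Rightarrow> 'k) set" where
  "tensors_on S = {t. finite {w. t w \<noteq> 0} \<and> {w. t w \<noteq> 0} \<subseteq> S}"

lemma tensor_power_eq: "E n = tensors_on (words B n)"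
proof -
  have "finite {w. t w \<noteq> 0}" if "\<forall>w. t w \<noteq> 0 \<longrightarrow> w \<in> words B n" for t :: "'e list \<Rightarrow> 'k"
    by (rule finite_subset[OF _ finite_words[OF finite_Basis]]) (use that in auto)
  then show ?thesis by (auto simp: tensor_power_def tensors_on_def)
qed

lemma carrier_tensor_algebra: "carrier (tensor_algebra scale B) = tensors_on {w. set w \<subseteq> B}"
  by (auto simp: tensor_algebra_def tensors_on_def)

lemma tensors_on_mono: "S \<subseteq> S' \<Longrightarrow> tensors_on S \<subseteq> tensors_on S'"
  by (auto simp: tensors_on_def)

lemma tensors_onI: "finite {w. t w \<noteq> 0} \<Longrightarrow> (\<And>w. t w \<noteq> 0 \<Longrightarrow> w \<in> S) \<Longrightarrow> t \<in> tensors_on S"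
  by (auto simp: tensors_on_def)

lemma tensors_onD: "t \<in> tensors_on S \<Longrightarrow> t w \<noteq> 0 \<Longrightarrow> w \<in> S"
  by (auto simp: tensors_on_def)

lemma tensors_on_finite: "t \<in> tensors_on S \<Longrightarrow> finite {w. t w \<noteq> 0}"
  by (simp add: tensors_on_def)

lemma tensors_on_subspace: "tensor.subspace (tensors_on S)"
proof (rule tensor.subspaceI)
  fix s t assume st: "s \<in> tensors_on S" "t \<in> tensors_on S"
  show "s + t \<in> tensors_on S"
  proof (rule tensors_onI)
    fix w assume "(s + t) w \<noteq> 0"
    then have "s w \<noteq> 0 \<or> t w \<noteq> 0" by auto
    then show "w \<in> S" using st tensors_onD by blast
  qed (intro finite_support_add tensors_on_finite[OF st(1)] tensors_on_finite[OF st(2)])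
next
  fix c t assume "t \<in> tensors_on S"
  then show "tensor_scale c t \<in> tensors_on S"
    by (auto simp: tensors_on_def tensor_scale_def elim!: finite_subset[rotated])
qed (auto simp: tensors_on_def)

lemma pure_tensor_power: "length v = n \<Longrightarrow> pure v \<in> E n"
  by (auto simp: tensor_power_def dest: pure_nonzero)

text \<open>The zero tensor is obtained as a basis tensor with coefficient 0, which is why S must
  contain a word. A general tensor is rebuilt by adding one word of its support at a time.\<close>

lemma tensors_on_induct [consumes 1, case_names add basis]:
  assumes "t \<in> tensors_on S"
    and add: "\<And>s t. s \<in> tensors_on S \<Longrightarrow> t \<in> tensors_on S \<Longrightarrow> P s \<Longrightarrow> P t \<Longrightarrow> P (s + t)"
    and basis: "\<And>c v. v \<in> S \<Longrightarrow> P (\<lambda>w. if w = v then c else 0)"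
    and "S \<noteq> {}"
  shows "P t"
proof -
  have zero: "P 0"
  proof -
    obtain v where "v \<in> S" using \<open>S \<noteq> {}\<close> by auto
    from basis[OF this, of 0] show ?thesis by (simp add: zero_fun_def)
  qed
  define A where "A = {w. t w \<noteq> 0}"
  have "finite A" "A \<subseteq> S" "{w. t w \<noteq> 0} \<subseteq> A"
    using assms(1) by (auto simp: A_def tensors_on_def)
  then show ?thesis
  proof (induction A arbitrary: t)
    case empty
    then have "t = 0" by (auto simp: fun_eq_iff)
    with zero show "P t" by simp
  next
    case (insert v A)
    define s where "s = t(v := 0)"
    have sub: "{w. s w \<noteq> 0} \<subseteq> A" using insert by (auto simp: s_def)
    have "P s" by (rule insert.IH) (use insert sub in auto)
    moreover have "s \<in> tensors_on S"
      using sub insert finite_subset[OF sub] by (auto simp: tensors_on_def)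
    moreover have "(\<lambda>w. if w = v then t v else 0) \<in> tensors_on S"
      using insert by (auto simp: tensors_on_def)
    ultimately have "P (s + (\<lambda>w. if w = v then t v else 0))"
      using insert by (intro add basis) auto
    also have "s + (\<lambda>w. if w = v then t v else 0) = t"
      by (auto simp: s_def fun_eq_iff)
    finally show ?case .
  qed
qed

lemma tensors_on_induct_pure [consumes 1, case_names add pure]:
  assumes "t \<in> tensors_on S"
    and "\<And>s t. s \<in> tensors_on S \<Longrightarrow> t \<in> tensors_on S \<Longrightarrow> P s \<Longrightarrow> P t \<Longrightarrow> P (s + t)"
    and pure: "\<And>c v. v \<in> S \<Longrightarrow> P (tensor_scale c (pure v))"
    and "S \<noteq> {}" "S \<subseteq> {w. set w \<subseteq> B}"
  shows "P t"
  using assms(1)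
proof (induction rule: tensors_on_induct)
  case (basis c v)
  then have "(\<lambda>w. if w = v then c else 0) = tensor_scale c (pure v)"
    using assms(5) pure_word[of v] by (auto simp: tensor_scale_def fun_eq_iff)
  then show ?case using pure[OF \<open>v \<in> S\<close>, of c] by (simp only:)
next
  case (add s t)
  then show ?case by (rule assms(2))
qed (rule \<open>S \<noteq> {}\<close>)

lemma words_subset: "words B n \<subseteq> {w. set w \<subseteq> B}"
  by (auto simp: words_def)

lemma tensor_power_subset: "E n \<subseteq> tensors_on {w. set w \<subseteq> B}"
  unfolding tensor_power_eq by (intro tensors_on_mono words_subset)

lemma tensor_power_induct [consumes 1, case_names add pure]:
  assumes "t \<in> E n"
    and add: "\<And>s t. s \<in> E n \<Longrightarrow> t \<in> E n \<Longrightarrow> P s \<Longrightarrow> P t \<Longrightarrow> P (s + t)"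
    and pure: "\<And>c v. length v = n \<Longrightarrow> P (tensor_scale c (pure v))"
  shows "P t"
proof (cases "words B n = {}")
  case True
  \<comment> \<open>There are no words when E is zero and n > 0; then t vanishes and is written as 0
    times the tensor of n zero vectors.\<close>
  then have "t = tensor_scale 0 (pure (replicate n 0))"
    using assms(1) by (auto simp: tensor_power_def tensor_scale_def)
  then show ?thesis using pure[of "replicate n 0" 0] by simp
next
  case False
  show ?thesis
    using assms(1) unfolding tensor_power_eq
  proof (induction rule: tensors_on_induct_pure)
    case (add s t)
    then show ?case by (intro assms(2)) (auto simp: tensor_power_eq)
  next
    case (pure c v)
    then show ?case by (intro assms(3)) (auto simp: words_length)
  qed (use False words_subset[of n] in auto)
qed

lemma tensor_mult_tensor_power:
  "s \<in> E p \<Longrightarrow> t \<in> E q \<Longrightarrow> tensor_mult s t \<in> E (p + q)"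
  unfolding tensor_power_def words_def
  by (safe elim!: tensor_mult_nonzeroE; fastforce)

lemma tensor_mult_closed:
  assumes "s \<in> tensors_on {w. set w \<subseteq> B}" "t \<in> tensors_on {w. set w \<subseteq> B}"
  shows "tensor_mult s t \<in> tensors_on {w. set w \<subseteq> B}"
proof -
  have "{w. tensor_mult s t w \<noteq> 0} \<subseteq> (\<lambda>(u, v). u @ v) ` ({w. s w \<noteq> 0} \<times> {w. t w \<noteq> 0})"
    by (auto elim!: tensor_mult_nonzeroE)
  then have "finite {w. tensor_mult s t w \<noteq> 0}"
    by (rule finite_subset) (use assms in \<open>auto simp: tensors_on_def\<close>)
  then show ?thesis
  proof (rule tensors_onI)
    fix w assume "tensor_mult s t w \<noteq> 0"
    then obtain u v where "w = u @ v" "s u \<noteq> 0" "t v \<noteq> 0"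
      by (rule tensor_mult_nonzeroE)
    then show "w \<in> {w. set w \<subseteq> B}"
      using tensors_onD[OF assms(1), of u] tensors_onD[OF assms(2), of v] by auto
  qed
qed

subsection \<open>Twisted extensions of linear maps to tensors\<close>

text \<open>Each tensor position has its own map, so the family
  \<open>\<lambda>j. \<alpha> ^^ j\<close> gives \<theta> and a constant family gives the extension
  of one linear map to T(E). The sum runs over the support of t, hence the finiteness hypotheses in
  the additivity statements.\<close>

definition multi_map :: "(nat \<Rightarrow> 'e \<Rightarrow> 'e) \<Rightarrow> ('e list \<Rightarrow> 'k) \<Rightarrow> 'e list \<Rightarrow> 'k" where
  "multi_map g t = (\<lambda>w. \<Sum>v | t v \<noteq> 0. t v * pure (twist_word g v) w)"

abbreviation tmap :: "('e \<Rightarrow> 'e) \<Rightarrow> ('e list \<Rightarrow> 'k) \<Rightarrow> 'e list \<Rightarrow> 'k" where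
  "tmap f \<equiv> multi_map (\<lambda>_. f)"

lemma tensor_map_eq: "tensor_map scale B f = multi_map (\<lambda>_. f)"
  by (auto simp: tensor_map_def multi_map_def twist_word_const fun_eq_iff)

lemma multi_map_eq:
  assumes "finite S" "{v. t v \<noteq> 0} \<subseteq> S"
  shows "multi_map g t w = (\<Sum>v\<in>S. t v * pure (twist_word g v) w)"
  unfolding multi_map_def by (rule sum.mono_neutral_left) (use assms in auto)

lemma multi_map_add:
  assumes "finite {w. s w \<noteq> 0}" "finite {w. t w \<noteq> 0}"
  shows "multi_map g (s + t) = multi_map g s + multi_map g t"
proof
  fix w
  let ?S = "{w. s w \<noteq> 0} \<union> {w. t w \<noteq> 0}"
  have "finite ?S" using assms by auto
  note * = multi_map_eq[OF this]
  show "multi_map g (s + t) w = (multi_map g s + multi_map g t) w"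
    using *[of "s + t" g w] *[of s g w] *[of t g w] by (fastforce simp: distrib_right sum.distrib)
qed

lemma multi_map_scale: "multi_map g (tensor_scale c t) = tensor_scale c (multi_map g t)"
proof (cases "c = 0")
  case False
  then show ?thesis
    by (auto simp: multi_map_def tensor_scale_def fun_eq_iff sum_distrib_left mult.assoc)
qed (auto simp: multi_map_def tensor_scale_def fun_eq_iff)

lemma multi_map_zero [simp]: "multi_map g 0 = 0"
  by (rule ext) (simp add: multi_map_def)

text \<open>\<open>multi_map\<close> is defined through basis words; this identity makes it
  basis-free. The first factor e is expanded in B, its image under \<open>g 0\<close> is read off by
  linearity, and the tail is handled by the family shifted by one.\<close>

lemma multi_map_pure_aux:
  assumes "\<And>j. lin (g j)"
  shows "(\<Sum>v\<in>words B (length es). pure es v * pure (twist_word g v) w) = pure (twist_word g es) w"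
  using assms
proof (induction es arbitrary: g w)
  case Nil
  then show ?case by (simp add: pure_Nil)
next
  case (Cons e es)
  show ?case
  proof (cases w)
    case Nil
    then show ?thesis by (auto simp: words_Suc intro!: sum.neutral)
  next
    case w: (Cons x w')
    interpret g0: Vector_Spaces.linear scale scale "g 0" by (rule Cons.prems)
    have "coord (g 0 e) x = coord (g 0 (\<Sum>y\<in>B. scale (coord e y) y)) x"
      by (simp add: sum_representation)
    also have "\<dots> = (\<Sum>y\<in>B. coord e y * coord (g 0 y) x)"
      by (simp add: g0.sum g0.scale representation_sum independent_Basis span_Basis representation_scale)
    finally have rep: "coord (g 0 e) x = (\<Sum>y\<in>B. coord e y * coord (g 0 y) x)" .
    have IH: "(\<Sum>v\<in>words B (length es). pure es v * pure (twist_word (\<lambda>j. g (Suc j)) v) w')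
      = pure (twist_word (\<lambda>j. g (Suc j)) es) w'"
      by (rule Cons.IH) (use Cons.prems in auto)
    have "(\<Sum>v\<in>words B (length (e # es)). pure (e # es) v * pure (twist_word g v) w)
      = (\<Sum>y\<in>B. \<Sum>v\<in>words B (length es). (coord e y * coord (g 0 y) x) *
          (pure es v * pure (twist_word (\<lambda>j. g (Suc j)) v) w'))"
      by (simp add: sum_words_Suc finite_Basis pure_Cons_Cons w algebra_simps)
    also have "\<dots> = coord (g 0 e) x * pure (twist_word (\<lambda>j. g (Suc j)) es) w'"
      unfolding rep sum_distrib_right IH[symmetric] sum_distrib_left by (rule sum.swap)
    finally show ?thesis by (simp add: w pure_Cons_Cons)
  qed
qed

lemma multi_map_pure:
  assumes "\<And>j. lin (g j)"
  shows "multi_map g (pure es) = pure (twist_word g es)"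
proof
  fix w
  have "multi_map g (pure es) w = (\<Sum>v\<in>words B (length es). pure es v * pure (twist_word g v) w)"
    by (rule multi_map_eq) (auto simp: finite_words finite_Basis dest: pure_nonzero)
  then show "multi_map g (pure es) w = pure (twist_word g es) w"
    by (simp add: multi_map_pure_aux[OF assms])
qed

lemma tensor_power_finite: "(t :: 'e list \<Rightarrow> 'k) \<in> E n \<Longrightarrow> finite {w. t w \<noteq> 0}"
  by (simp add: tensor_power_eq tensors_on_def)

lemma tensor_power_subspace: "tensor.subspace (E n :: ('e list \<Rightarrow> 'k) set)"
  unfolding tensor_power_eq by (rule tensors_on_subspace)

lemma multi_map_nonzeroE:
  assumes "multi_map g t w \<noteq> 0"
  obtains v where "t v \<noteq> 0" "pure (twist_word g v) w \<noteq> 0"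
proof -
  obtain v where "v \<in> {v. t v \<noteq> 0}" "t v * pure (twist_word g v) w \<noteq> 0"
    using assms unfolding multi_map_def by (meson sum.neutral)
  then show ?thesis by (intro that[of v]) auto
qed

lemma multi_map_tensor_power:
  assumes "t \<in> E n"
  shows "multi_map g t \<in> E n"
  unfolding tensor_power_def
proof (intro CollectI allI impI)
  fix w assume "multi_map g t w \<noteq> 0"
  then obtain v where "t v \<noteq> 0" "pure (twist_word g v) w \<noteq> 0"
    by (rule multi_map_nonzeroE)
  then show "w \<in> words B n"
    using assms pure_nonzero[of "twist_word g v" w] by (auto simp: tensor_power_def words_def)
qed

lemma multi_map_cong:
  assumes "t \<in> E n" "\<And>j. j < n \<Longrightarrow> g j = h j"
  shows "multi_map g t = multi_map h t"
proof
  fix w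
  have "twist_word g v = twist_word h v" if "t v \<noteq> 0" for v
    using that assms by (intro twist_word_cong) (auto simp: tensor_power_def words_def)
  then show "multi_map g t w = multi_map h t w"
    unfolding multi_map_def by (intro sum.cong) auto
qed

lemma multi_map_comp:
  assumes "t \<in> E n" "\<And>j. lin (g j)" "\<And>j. lin (h j)"
  shows "multi_map g (multi_map h t) = multi_map (\<lambda>j. g j \<circ> h j) t"
  using assms(1)
proof (induction rule: tensor_power_induct)
  case (add s t)
  have "multi_map g (multi_map h s) = multi_map (\<lambda>j. g j \<circ> h j) s"
    "multi_map g (multi_map h t) = multi_map (\<lambda>j. g j \<circ> h j) t"
    by (fact add)+
  with add(1,2) show "multi_map g (multi_map h (s + t)) = multi_map (\<lambda>j. g j \<circ> h j) (s + t)"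
    using multi_map_tensor_power[of s n h] multi_map_tensor_power[of t n h]
    by (simp add: multi_map_add tensor_power_finite)
next
  case (pure c v)
  have "lin (g j \<circ> h j)" for j
    using Vector_Spaces.linear_compose assms(2,3) by blast
  then show "multi_map g (multi_map h (tensor_scale c (pure v))) =
    multi_map (\<lambda>j. g j \<circ> h j) (tensor_scale c (pure v))"
    by (simp add: multi_map_scale multi_map_pure assms(2,3) twist_word_twist_word)
qed

lemma multi_map_id:
  assumes "t \<in> E n" "\<And>j x. j < n \<Longrightarrow> g j x = x"
  shows "multi_map g t = t"
proof -
  have "multi_map g t = multi_map (\<lambda>_ x. x) t"
    using assms(1) by (rule multi_map_cong) (use assms(2) in auto)
  also have "\<dots> = t"
    using assms(1)
  proof (induction rule: tensor_power_induct)
    case (add s t)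
    have "multi_map (\<lambda>_ x. x) s = s" "multi_map (\<lambda>_ x. x) t = t" by (fact add)+
    with add(1,2) show "multi_map (\<lambda>_ x. x) (s + t) = s + t" by (simp add: multi_map_add tensor_power_finite)
  next
    case (pure c v)
    have "lin (\<lambda>x. x)" by (rule linear_ident)
    then show ?case by (simp add: multi_map_scale multi_map_pure twist_word_id)
  qed
  finally show ?thesis .
qed

lemma multi_map_closed:
  assumes "t \<in> tensors_on {w. set w \<subseteq> B}"
  shows "multi_map g t \<in> tensors_on {w. set w \<subseteq> B}"
  using assms
proof (induction rule: tensors_on_induct)
  case (add s t)
  then show "multi_map g (s + t) \<in> tensors_on {w. set w \<subseteq> B}"
    using tensor.subspace_add[OF tensors_on_subspace] by (simp add: multi_map_add tensors_on_finite)
next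
  case (basis c v)
  have "(\<lambda>w. if w = v then c else 0) \<in> E (length v)"
    using basis by (auto simp: tensor_power_def words_def)
  from multi_map_tensor_power[OF this] show ?case
    using tensor_power_subset by blast
qed (auto intro: exI[of _ "[]"])

text \<open>The right factor occupies the positions p, p + 1, ..., so it meets the family from index
  p on; homogeneity of the left factor makes this offset the same for all its words.\<close>

lemma multi_map_mult:
  assumes "\<And>j. lin (g j)" "u \<in> E p" "v \<in> E q"
  shows "multi_map g (tensor_mult u v) =
    tensor_mult (multi_map g u) (multi_map (\<lambda>j. g (p + j)) v)"
  using assms(2)
proof (induction rule: tensor_power_induct)
  case (add s t)
  then show "multi_map g (tensor_mult (s + t) v) =
    tensor_mult (multi_map g (s + t)) (multi_map (\<lambda>j. g (p + j)) v)"
    using tensor_mult_tensor_power[OF add(1) assms(3)] tensor_mult_tensor_power[OF add(2) assms(3)]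
    by (simp add: tensor_mult_add_left multi_map_add tensor_power_finite)
next
  case (pure c es)
  have "multi_map g (tensor_mult (pure es) v) =
    tensor_mult (multi_map g (pure es)) (multi_map (\<lambda>j. g (p + j)) v)"
    using assms(3)
  proof (induction rule: tensor_power_induct)
    case (add s t)
    then show "multi_map g (tensor_mult (pure es) (s + t)) =
      tensor_mult (multi_map g (pure es)) (multi_map (\<lambda>j. g (p + j)) (s + t))"
      using tensor_mult_tensor_power[OF pure_tensor_power[OF refl] add(1), of es]
        tensor_mult_tensor_power[OF pure_tensor_power[OF refl] add(2), of es]
      by (simp add: tensor_mult_add_right multi_map_add tensor_power_finite)
  next
    case (pure c fs)
    with \<open>length es = p\<close> assms(1) show ?case
      by (simp add: tensor_mult_scale_right multi_map_scale multi_map_pure pure_append[symmetric]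
          twist_word_append)
  qed
  then show ?case by (simp add: tensor_mult_scale_left multi_map_scale)
qed

text \<open>A constant family is unchanged by the offset, so the homogeneous case extends to all of
  T(E): both factors are split into basis tensors, each of which is homogeneous.\<close>

lemma tensor_map_mult:
  assumes "lin f" "s \<in> tensors_on {w. set w \<subseteq> B}" "t \<in> tensors_on {w. set w \<subseteq> B}"
  shows "multi_map (\<lambda>_. f) (tensor_mult s t) =
    tensor_mult (multi_map (\<lambda>_. f) s) (multi_map (\<lambda>_. f) t)"
  using assms(2)
proof (induction rule: tensors_on_induct)
  case (add s s')
  then show "multi_map (\<lambda>_. f) (tensor_mult (s + s') t) =
    tensor_mult (multi_map (\<lambda>_. f) (s + s')) (multi_map (\<lambda>_. f) t)"
    using tensor_mult_closed[OF add(1) assms(3)] tensor_mult_closed[OF add(2) assms(3)]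
    by (simp add: tensor_mult_add_left multi_map_add tensors_on_finite)
next
  case (basis c v)
  let ?u = "\<lambda>w. if w = v then c else 0"
  have u: "?u \<in> E (length v)"
    using basis by (auto simp: tensor_power_def words_def)
  show ?case
    using assms(3)
  proof (induction rule: tensors_on_induct)
    case (add s t)
    have "?u \<in> tensors_on {w. set w \<subseteq> B}" using u tensor_power_subset by blast
    then show "multi_map (\<lambda>_. f) (tensor_mult ?u (s + t)) =
      tensor_mult (multi_map (\<lambda>_. f) ?u) (multi_map (\<lambda>_. f) (s + t))"
      using add tensor_mult_closed[of ?u s] tensor_mult_closed[of ?u t]
      by (simp add: tensor_mult_add_right multi_map_add tensors_on_finite)
  next
    case (basis c' v')
    have "(\<lambda>w. if w = v' then c' else 0) \<in> E (length v')"
      using basis by (auto simp: tensor_power_def words_def)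
    from multi_map_mult[OF _ u this, of "\<lambda>_. f"] show ?case using assms(1) by simp
  qed (auto intro: exI[of _ "[]"])
qed (auto intro: exI[of _ "[]"])

end

section \<open>Graded abelian groups\<close>

text \<open>Stated for arbitrary record schemes so that algebras and groups of chains, whose records
  have no meaningful product, can both serve as source and target.\<close>

definition additive_map :: "('a, 'm) ring_scheme \<Rightarrow> ('b, 'n) ring_scheme \<Rightarrow> ('a \<Rightarrow> 'b) \<Rightarrow> bool" where
  "additive_map H K f \<longleftrightarrow> (\<forall>x\<in>carrier H. f x \<in> carrier K) \<and>
     (\<forall>x\<in>carrier H. \<forall>y\<in>carrier H. f (x \<oplus>\<^bsub>H\<^esub> y) = f x \<oplus>\<^bsub>K\<^esub> f y)"

lemma additiveI:
  assumes "\<And>x. x \<in> carrier H \<Longrightarrow> f x \<in> carrier K"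
    and "\<And>x y. x \<in> carrier H \<Longrightarrow> y \<in> carrier H \<Longrightarrow> f (x \<oplus>\<^bsub>H\<^esub> y) = f x \<oplus>\<^bsub>K\<^esub> f y"
  shows "additive_map H K f"
  using assms by (simp add: additive_map_def)

lemma additive_closed: "additive_map H K f \<Longrightarrow> x \<in> carrier H \<Longrightarrow> f x \<in> carrier K"
  by (simp add: additive_map_def)

lemma additive_add:
  "additive_map H K f \<Longrightarrow> x \<in> carrier H \<Longrightarrow> y \<in> carrier H \<Longrightarrow> f (x \<oplus>\<^bsub>H\<^esub> y) = f x \<oplus>\<^bsub>K\<^esub> f y"
  by (simp add: additive_map_def)

lemma additive_comp:
  "additive_map H K f \<Longrightarrow> additive_map K L g \<Longrightarrow> additive_map H L (\<lambda>x. g (f x))"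
  by (simp add: additive_map_def)

lemma additive_id: "additive_map H H (\<lambda>x. x)"
  by (simp add: additive_map_def)

lemma additive_zero:
  assumes "abelian_group H" "abelian_group K" "additive_map H K f"
  shows "f \<zero>\<^bsub>H\<^esub> = \<zero>\<^bsub>K\<^esub>"
proof -
  interpret H: abelian_group H by fact
  interpret K: abelian_group K by fact
  have "f \<zero>\<^bsub>H\<^esub> \<oplus>\<^bsub>K\<^esub> f \<zero>\<^bsub>H\<^esub> = f \<zero>\<^bsub>H\<^esub>"
    using additive_add[OF assms(3), of "\<zero>\<^bsub>H\<^esub>" "\<zero>\<^bsub>H\<^esub>"] by simp
  then show ?thesis
    using additive_closed[OF assms(3), of "\<zero>\<^bsub>H\<^esub>"] by (simp add: K.add.l_cancel_one)
qed

lemma additive_finsum: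
  assumes "abelian_group H" "abelian_group K" "additive_map H K f"
    and "finite S" "\<And>i. i \<in> S \<Longrightarrow> g i \<in> carrier H"
  shows "f (\<Oplus>\<^bsub>H\<^esub>i\<in>S. g i) = (\<Oplus>\<^bsub>K\<^esub>i\<in>S. f (g i))"
proof -
  interpret H: abelian_group H by fact
  interpret K: abelian_group K by fact
  show ?thesis
    using assms(4,5)
  proof (induction S)
    case empty
    then show ?case by (simp add: additive_zero[OF assms(1-3)])
  next
    case (insert i S)
    then have "g \<in> S \<rightarrow> carrier H" "(\<lambda>i. f (g i)) \<in> S \<rightarrow> carrier K"
      using additive_closed[OF assms(3)] by auto
    then show ?case
      using insert additive_closed[OF assms(3)] additive_add[OF assms(3)]
      by (simp add: H.finsum_insert K.finsum_insert H.finsum_closed)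
  qed
qed

lemma (in abelian_monoid) finsum_unique_term:
  assumes "finite S" "p \<in> S" "x \<in> carrier G" "\<And>i. i \<in> S \<Longrightarrow> f i = (if i = p then x else \<zero>)"
  shows "finsum G f S = x"
proof -
  have "finsum G f S = (\<Oplus>i\<in>S. if p = i then x else \<zero>)"
    by (rule finsum_cong') (use assms in auto)
  then show ?thesis
    using add.finprod_singleton[of p S "\<lambda>_. x"] assms by simp
qed

lemma (in abelian_monoid) finsum_swap:
  assumes "finite S" "finite T" "\<And>i j. i \<in> S \<Longrightarrow> j \<in> T \<Longrightarrow> f i j \<in> carrier G"
  shows "(\<Oplus>i\<in>S. \<Oplus>j\<in>T. f i j) = (\<Oplus>j\<in>T. \<Oplus>i\<in>S. f i j)"
  using assms(1,3)
proof (induction S)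
  case empty
  then show ?case by (simp add: finsum_zero)
next
  case (insert i S)
  have c: "(\<lambda>j. f i j) \<in> T \<rightarrow> carrier G" "(\<lambda>i. \<Oplus>j\<in>T. f i j) \<in> S \<rightarrow> carrier G"
    "(\<lambda>j. \<Oplus>i\<in>S. f i j) \<in> T \<rightarrow> carrier G"
    using insert.prems by (auto intro!: finsum_closed)
  have "(\<Oplus>i\<in>insert i S. \<Oplus>j\<in>T. f i j) = (\<Oplus>j\<in>T. f i j) \<oplus> (\<Oplus>j\<in>T. \<Oplus>i\<in>S. f i j)"
    using insert c by (subst finsum_insert) (auto intro!: finsum_closed)
  also have "\<dots> = (\<Oplus>j\<in>T. f i j \<oplus> (\<Oplus>i\<in>S. f i j))"
    using c by (subst finsum_addf) auto
  also have "\<dots> = (\<Oplus>j\<in>T. \<Oplus>i\<in>insert i S. f i j)"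
    using insert c by (intro finsum_cong') (auto intro!: finsum_closed)
  finally show ?case .
qed

lemma (in abelian_monoid) finsum_lessThan_Suc:
  assumes "\<And>i. i < Suc n \<Longrightarrow> f i \<in> carrier G"
  shows "finsum G f {..<Suc n} = finsum G f {..<n} \<oplus> f n"
proof -
  have "finsum G f {..<Suc n} = f n \<oplus> finsum G f {..<n}"
    unfolding lessThan_Suc by (rule finsum_insert) (use assms in auto)
  also have "\<dots> = finsum G f {..<n} \<oplus> f n"
    using assms by (intro a_comm finsum_closed) auto
  finally show ?thesis .
qed

text \<open>Makes total an operator that is given by a different additive map in each degree. The
  product of the semi-cross algebra, the twists of chains and the twist of cochains all have this
  shape.\<close>

definition graded_sum ::
  "('a, 'm) ring_scheme \<Rightarrow> (nat \<Rightarrow> 'a \<Rightarrow> 'a) \<Rightarrow> ('b, 'n) ring_scheme \<Rightarrow> (nat \<Rightarrow> 'a \<Rightarrow> 'b) \<Rightarrow> 'a \<Rightarrow> 'b" where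
  "graded_sum H \<pi> K \<omega> x = (\<Oplus>\<^bsub>K\<^esub>n \<in> {n. \<pi> n x \<noteq> \<zero>\<^bsub>H\<^esub>}. \<omega> n (\<pi> n x))"

definition hom_part :: "('a, 'm) ring_scheme \<Rightarrow> (nat \<Rightarrow> 'a \<Rightarrow> 'a) \<Rightarrow> nat \<Rightarrow> 'a set" where
  "hom_part H \<pi> p = {x \<in> carrier H. \<pi> p x = x}"

text \<open>The grading is carried by its projections instead of a family of subgroups, since
  degree-dependent operators are assembled from projections. One bound M expresses both that an
  element has finitely many components and that it is their sum.\<close>

locale graded_group = abelian_group H for H :: "('a, 'm) ring_scheme" (structure) +
  fixes \<pi> :: "nat \<Rightarrow> 'a \<Rightarrow> 'a"
  assumes proj_additive: "additive_map H H (\<pi> n)"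
    and proj_proj: "x \<in> carrier H \<Longrightarrow> \<pi> m (\<pi> n x) = (if m = n then \<pi> n x else \<zero>)"
    and proj_bound: "x \<in> carrier H \<Longrightarrow> \<exists>M. (\<forall>n\<ge>M. \<pi> n x = \<zero>) \<and> x = (\<Oplus>n\<in>{..<M}. \<pi> n x)"
begin

abbreviation homog :: "nat \<Rightarrow> 'a set" where
  "homog \<equiv> hom_part H \<pi>"

lemma abelian: "abelian_group H"
  by unfold_locales

lemma proj_closed [simp]: "x \<in> carrier H \<Longrightarrow> \<pi> n x \<in> carrier H"
  using additive_closed[OF proj_additive] .

lemma proj_add: "x \<in> carrier H \<Longrightarrow> y \<in> carrier H \<Longrightarrow> \<pi> n (x \<oplus> y) = \<pi> n x \<oplus> \<pi> n y"
  using additive_add[OF proj_additive] .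

lemma proj_zero [simp]: "\<pi> n \<zero> = \<zero>"
  by (rule additive_zero[OF abelian abelian proj_additive])

lemma hom_part_closed: "x \<in> homog p \<Longrightarrow> x \<in> carrier H"
  by (simp add: hom_part_def)

lemma proj_hom_part: "x \<in> carrier H \<Longrightarrow> \<pi> p x \<in> homog p"
  by (simp add: hom_part_def proj_proj)

lemma hom_part_proj: "x \<in> homog p \<Longrightarrow> \<pi> n x = (if n = p then x else \<zero>)"
  using proj_proj[of x n p] by (auto simp: hom_part_def)

lemma hom_part_zero [simp]: "\<zero> \<in> homog p"
  by (simp add: hom_part_def)

lemma hom_part_add: "x \<in> homog p \<Longrightarrow> y \<in> homog p \<Longrightarrow> x \<oplus> y \<in> homog p"
  by (simp add: hom_part_def proj_add)

lemma hom_part_finsum: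
  "finite S \<Longrightarrow> (\<And>i. i \<in> S \<Longrightarrow> f i \<in> homog p) \<Longrightarrow> finsum H f S \<in> homog p"
proof (induction S rule: finite_induct)
  case (insert i S)
  then show ?case
    using hom_part_closed by (subst finsum_insert) (auto intro!: hom_part_add)
qed simp

lemma proj_sum:
  assumes "x \<in> carrier H" "\<And>n. n \<ge> M \<Longrightarrow> \<pi> n x = \<zero>"
  shows "x = (\<Oplus>n\<in>{..<M}. \<pi> n x)"
proof -
  obtain M' where M': "\<forall>n\<ge>M'. \<pi> n x = \<zero>" "x = (\<Oplus>n\<in>{..<M'}. \<pi> n x)"
    using proj_bound[OF assms(1)] by auto
  have "(\<Oplus>n\<in>{..<M'}. \<pi> n x) = (\<Oplus>n\<in>{..<max M M'}. \<pi> n x)"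
    using M'(1) assms(1) by (intro add.finprod_mono_neutral_cong_left) auto
  also have "\<dots> = (\<Oplus>n\<in>{..<M}. \<pi> n x)"
    using assms by (intro add.finprod_mono_neutral_cong_right) auto
  finally show ?thesis using M' by simp
qed

lemma hom_part_induct [consumes 1, case_names hom add]:
  assumes "x \<in> carrier H"
    and "\<And>p x. x \<in> homog p \<Longrightarrow> P x"
    and "\<And>x y. x \<in> carrier H \<Longrightarrow> y \<in> carrier H \<Longrightarrow> P x \<Longrightarrow> P y \<Longrightarrow> P (x \<oplus> y)"
  shows "P x"
proof -
  obtain M where M: "x = (\<Oplus>n\<in>{..<M}. \<pi> n x)"
    using proj_bound[OF assms(1)] by auto
  have "P (\<Oplus>n\<in>{..<m}. \<pi> n x)" for m
  proof (induction m)
    case 0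
    show ?case using assms(2)[OF hom_part_zero] by simp
  next
    case (Suc m)
    have "P ((\<Oplus>n\<in>{..<m}. \<pi> n x) \<oplus> \<pi> m x)"
      by (rule assms(3)) (use Suc assms(1,2) proj_hom_part in auto)
    then show ?case using assms(1) by (simp add: finsum_lessThan_Suc)
  qed
  with M show ?thesis by metis
qed

context
  fixes K :: "('c, 'n) ring_scheme" and \<omega> :: "nat \<Rightarrow> 'a \<Rightarrow> 'c"
  assumes K: "abelian_group K" and add: "\<And>n. additive_map H K (\<omega> n)"
begin

interpretation K: abelian_group K by (rule K)

lemma graded_sum_eq:
  assumes "x \<in> carrier H" "\<And>n. n \<ge> M \<Longrightarrow> \<pi> n x = \<zero>"
  shows "graded_sum H \<pi> K \<omega> x = (\<Oplus>\<^bsub>K\<^esub>n\<in>{..<M}. \<omega> n (\<pi> n x))"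
  unfolding graded_sum_def
  using assms additive_closed[OF add] additive_zero[OF abelian K add]
  by (intro K.add.finprod_mono_neutral_cong_left) (auto simp: not_less[symmetric])

text \<open>The defining sums of x, y and their sum run over different supports; a common degree
  bound puts them on one index set.\<close>

lemma graded_sum_additive: "additive_map H K (graded_sum H \<pi> K \<omega>)"
proof (rule additiveI)
  fix x assume "x \<in> carrier H"
  then show "graded_sum H \<pi> K \<omega> x \<in> carrier K"
    using additive_closed[OF add] by (auto simp: graded_sum_def intro!: K.finsum_closed)
next
  fix x y assume xy: "x \<in> carrier H" "y \<in> carrier H"
  obtain M1 M2 where M: "\<forall>n\<ge>M1. \<pi> n x = \<zero>" "\<forall>n\<ge>M2. \<pi> n y = \<zero>"
    using proj_bound xy by meson
  let ?M = "max M1 M2"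
  have "graded_sum H \<pi> K \<omega> (x \<oplus> y) = (\<Oplus>\<^bsub>K\<^esub>n\<in>{..<?M}. \<omega> n (\<pi> n (x \<oplus> y)))"
    by (rule graded_sum_eq) (use xy M in \<open>auto simp: proj_add\<close>)
  also have "\<dots> = (\<Oplus>\<^bsub>K\<^esub>n\<in>{..<?M}. \<omega> n (\<pi> n x) \<oplus>\<^bsub>K\<^esub> \<omega> n (\<pi> n y))"
    using xy additive_closed[OF add]
    by (intro K.finsum_cong') (auto simp: proj_add additive_add[OF add])
  also have "\<dots> = (\<Oplus>\<^bsub>K\<^esub>n\<in>{..<?M}. \<omega> n (\<pi> n x)) \<oplus>\<^bsub>K\<^esub> (\<Oplus>\<^bsub>K\<^esub>n\<in>{..<?M}. \<omega> n (\<pi> n y))"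
    using xy additive_closed[OF add] by (intro K.finsum_addf) auto
  also have "\<dots> = graded_sum H \<pi> K \<omega> x \<oplus>\<^bsub>K\<^esub> graded_sum H \<pi> K \<omega> y"
    using xy M by (subst (1 2) graded_sum_eq[where M = ?M]) auto
  finally show "graded_sum H \<pi> K \<omega> (x \<oplus> y) = graded_sum H \<pi> K \<omega> x \<oplus>\<^bsub>K\<^esub> graded_sum H \<pi> K \<omega> y" .
qed

lemma graded_sum_hom_part:
  assumes "x \<in> homog p"
  shows "graded_sum H \<pi> K \<omega> x = \<omega> p x"
proof -
  have x: "x \<in> carrier H" using assms by (rule hom_part_closed)
  have "graded_sum H \<pi> K \<omega> x = (\<Oplus>\<^bsub>K\<^esub>n\<in>{..<Suc p}. \<omega> n (\<pi> n x))"
    by (rule graded_sum_eq) (use x hom_part_proj[OF assms] in auto)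
  also have "\<dots> = \<omega> p x"
    using x hom_part_proj[OF assms] additive_closed[OF add] additive_zero[OF abelian K add]
    by (intro K.finsum_unique_term[where p = p]) auto
  finally show ?thesis .
qed

end

end

section \<open>Elementary tensors and twisted operators on chains\<close>

text \<open>No product appears here: elementary tensors, their grading and the twisting operators
  live on the graded vector space alone, which A shares with its twist.\<close>

locale graded_vector_space = tensor_basis scale B + graded_group A \<pi>
  for scale :: "'k::field \<Rightarrow> 'e::ab_group_add \<Rightarrow> 'e" and B :: "'e set"
    and A :: "('k, 'e, 'a) graded_algebra" (structure) and \<pi> :: "nat \<Rightarrow> 'a \<Rightarrow> 'a" +
  assumes smult_closed [simp]: "x \<in> carrier A \<Longrightarrow> c \<odot> x \<in> carrier A"
    and smult_add_right: "x \<in> carrier A \<Longrightarrow> y \<in> carrier A \<Longrightarrow> c \<odot> (x \<oplus> y) = c \<odot> x \<oplus> c \<odot> y"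
    and smult_add_left: "x \<in> carrier A \<Longrightarrow> (c + d) \<odot> x = c \<odot> x \<oplus> d \<odot> x"
    and smult_smult: "x \<in> carrier A \<Longrightarrow> c \<odot> (d \<odot> x) = (c * d) \<odot> x"
    and smult_one [simp]: "x \<in> carrier A \<Longrightarrow> 1 \<odot> x = x"
    and proj_smult: "x \<in> carrier A \<Longrightarrow> \<pi> n (c \<odot> x) = c \<odot> \<pi> n x"
begin

lemma smult_additive: "additive_map A A (\<lambda>x. c \<odot> x)"
  by (rule additiveI) (auto simp: smult_add_right)

lemma smult_zero_right [simp]: "c \<odot> \<zero> = \<zero>"
  by (rule additive_zero[OF abelian abelian smult_additive])

lemma smult_zero_left [simp]: "x \<in> carrier A \<Longrightarrow> 0 \<odot> x = \<zero>"
  using smult_add_left[of x 0 0] smult_closed[of x 0] by (simp add: add.l_cancel_one')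

lemma smult_hom_part: "x \<in> homog p \<Longrightarrow> c \<odot> x \<in> homog p"
  by (simp add: hom_part_def proj_smult)

lemma smult_finsum:
  "finite S \<Longrightarrow> (\<And>i. i \<in> S \<Longrightarrow> f i \<in> carrier A) \<Longrightarrow> c \<odot> finsum A f S = (\<Oplus>i\<in>S. c \<odot> f i)"
  by (rule additive_finsum[OF abelian abelian smult_additive])

lemma sum_smult:
  assumes "finite S" "x \<in> carrier A"
  shows "(\<Sum>i\<in>S. f i) \<odot> x = (\<Oplus>i\<in>S. f i \<odot> x)"
  using assms(1)
proof induction
  case (insert i S)
  then show ?case using assms(2) by (simp add: smult_add_left finsum_insert Pi_def)
qed (use assms in simp)

definition k_linear :: "('a \<Rightarrow> 'a) \<Rightarrow> bool" where
  "k_linear f \<longleftrightarrow> additive_map A A f \<and> (\<forall>c. \<forall>x\<in>carrier A. f (c \<odot> x) = c \<odot> f x) \<and>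
     (\<forall>n. \<forall>x\<in>carrier A. \<pi> n (f x) = f (\<pi> n x))"

lemma k_linear_additive: "k_linear f \<Longrightarrow> additive_map A A f"
  by (simp add: k_linear_def)

lemma k_linear_closed: "k_linear f \<Longrightarrow> x \<in> carrier A \<Longrightarrow> f x \<in> carrier A"
  using additive_closed[OF k_linear_additive] .

lemma k_linear_smult: "k_linear f \<Longrightarrow> x \<in> carrier A \<Longrightarrow> f (c \<odot> x) = c \<odot> f x"
  by (simp add: k_linear_def)

lemma k_linear_hom_part: "k_linear f \<Longrightarrow> x \<in> homog p \<Longrightarrow> f x \<in> homog p"
  by (auto simp: k_linear_def hom_part_def intro: additive_closed)

lemma k_linear_id: "k_linear (\<lambda>x. x)"
  by (simp add: k_linear_def additive_id)

lemma k_linear_comp: "k_linear f \<Longrightarrow> k_linear g \<Longrightarrow> k_linear (\<lambda>x. f (g x))"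
  by (auto simp: k_linear_def additive_map_def)

lemma k_linear_funpow: "k_linear f \<Longrightarrow> k_linear (f ^^ n)"
proof (induction n)
  case (Suc n)
  then show ?case using k_linear_comp[of f "f ^^ n"] by (simp add: comp_def)
qed (simp add: k_linear_id id_def)

text \<open>The elementary tensor x \<otimes> t, written by its coefficients on the words of length
  i.\<close>

definition elem :: "nat \<Rightarrow> 'a \<Rightarrow> ('e list \<Rightarrow> 'k) \<Rightarrow> 'e list \<Rightarrow> 'a" where
  "elem i x t = (\<lambda>w\<in>words B i. t w \<odot> x)"

definition chain_plus :: "nat \<Rightarrow> ('e list \<Rightarrow> 'a) \<Rightarrow> ('e list \<Rightarrow> 'a) \<Rightarrow> 'e list \<Rightarrow> 'a" where
  "chain_plus i F G = (\<lambda>w\<in>words B i. F w \<oplus> G w)"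

definition chain_null :: "nat \<Rightarrow> 'e list \<Rightarrow> 'a" where
  "chain_null i = (\<lambda>w\<in>words B i. \<zero>)"

lemma chain_plus_apply [simp]:
  "w \<in> words B i \<Longrightarrow> chain_plus i F G w = F w \<oplus> G w"
  "w \<notin> words B i \<Longrightarrow> chain_plus i F G w = undefined"
  by (simp_all add: chain_plus_def)

lemma chain_null_apply [simp]:
  "w \<in> words B i \<Longrightarrow> chain_null i w = \<zero>"
  "w \<notin> words B i \<Longrightarrow> chain_null i w = undefined"
  by (simp_all add: chain_null_def)

lemma elem_apply [simp]:
  "w \<in> words B i \<Longrightarrow> elem i x t w = t w \<odot> x"
  "w \<notin> words B i \<Longrightarrow> elem i x t w = undefined"
  by (simp_all add: elem_def)

abbreviation tens :: "nat \<Rightarrow> ('e list \<Rightarrow> 'k) set \<Rightarrow> ('e list \<Rightarrow> 'a) set" where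
  "tens i W \<equiv> free_tensor B i A W"

text \<open>\<open>A \<otimes> W\<close>; the multiplicative fields of the record are junk, only its additive group is used.\<close>

definition chain_group :: "nat \<Rightarrow> ('e list \<Rightarrow> 'k) set \<Rightarrow> ('e list \<Rightarrow> 'a) ring" where
  "chain_group i W = \<lparr>carrier = tens i W, mult = (\<lambda>_ _. undefined), one = undefined,
     zero = chain_null i, add = chain_plus i\<rparr>"

lemma carrier_chain_group [simp]: "carrier (chain_group i W) = tens i W"
  and zero_chain_group: "\<zero>\<^bsub>chain_group i W\<^esub> = chain_null i"
  and add_chain_group: "F \<oplus>\<^bsub>chain_group i W\<^esub> G = chain_plus i F G"
  by (simp_all add: chain_group_def)

lemma words_ext:
  "(\<And>w. w \<in> words B i \<Longrightarrow> F w = G w) \<Longrightarrow> (\<And>w. w \<notin> words B i \<Longrightarrow> F w = G w) \<Longrightarrow> F = G"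
  by blast

lemma elem_free_tensor: "x \<in> carrier A \<Longrightarrow> t \<in> W \<Longrightarrow> elem i x t \<in> tens i W"
  unfolding free_tensor_def elem_def mem_Collect_eq
  by (rule exI[of _ "Suc 0"], rule exI[of _ "\<lambda>_. x"], rule exI[of _ "\<lambda>_. t"])
    (auto simp: finsum_lessThan_Suc fun_eq_iff)

lemma zero_free_tensor: "(chain_null i) \<in> tens i W"
  unfolding free_tensor_def mem_Collect_eq by (rule exI[of _ 0]) (auto simp: chain_null_def)

lemma free_tensor_add_elem:
  assumes "F \<in> tens i W" "x \<in> carrier A" "t \<in> W"
  shows "chain_plus i F (elem i x t) \<in> tens i W"
proof -
  obtain m :: nat and a s where F: "\<forall>j<m. a j \<in> carrier A \<and> s j \<in> W"
    "F = (\<lambda>w\<in>words B i. \<Oplus>j\<in>{..<m}. s j w \<odot> a j)"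
    using assms(1) by (auto simp: free_tensor_def)
  let ?a = "a(m := x)" and ?s = "s(m := t)"
  have "(\<Oplus>j\<in>{..<Suc m}. ?s j w \<odot> ?a j) = (\<Oplus>j\<in>{..<m}. s j w \<odot> a j) \<oplus> t w \<odot> x" for w
  proof -
    have "(\<Oplus>j\<in>{..<m}. ?s j w \<odot> ?a j) = (\<Oplus>j\<in>{..<m}. s j w \<odot> a j)"
      using F by (intro finsum_cong') auto
    then show ?thesis
      using F assms by (subst finsum_lessThan_Suc) auto
  qed
  then have "chain_plus i F (elem i x t) = (\<lambda>w\<in>words B i. \<Oplus>j\<in>{..<Suc m}. ?s j w \<odot> ?a j)"
    by (auto simp: F elem_def)
  then show ?thesis
    using F assms unfolding free_tensor_def mem_Collect_eq
    by (intro exI[of _ "Suc m"] exI[of _ ?a] exI[of _ ?s]) auto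
qed

lemma free_tensor_induct [consumes 1, case_names zero add_elem]:
  assumes "F \<in> tens i W"
    and "P (chain_null i)"
    and step: "\<And>F x t. F \<in> tens i W \<Longrightarrow> P F \<Longrightarrow> x \<in> carrier A \<Longrightarrow> t \<in> W \<Longrightarrow>
      P (chain_plus i F (elem i x t))"
  shows "P F"
proof -
  obtain m :: nat and a s where F: "\<forall>j<m. a j \<in> carrier A \<and> s j \<in> W"
    "F = (\<lambda>w\<in>words B i. \<Oplus>j\<in>{..<m}. s j w \<odot> a j)"
    using assms(1) by (auto simp: free_tensor_def)
  define G where "G n = (\<lambda>w\<in>words B i. \<Oplus>j\<in>{..<n}. s j w \<odot> a j)" for n
  have "P (G n) \<and> G n \<in> tens i W" if "n \<le> m" for n
    using that
  proof (induction n)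
    case 0
    have "G 0 = chain_null i" by (simp add: G_def chain_null_def)
    with assms(2) zero_free_tensor show "P (G 0) \<and> G 0 \<in> tens i W"
      by metis
  next
    case (Suc n)
    have "G (Suc n) = chain_plus i (G n) (elem i (a n) (s n))"
      using F(1) Suc.prems by (intro words_ext[of i]) (auto simp: G_def elem_def finsum_lessThan_Suc)
    then show ?case
      using step[of "G n" "a n" "s n"] free_tensor_add_elem[of "G n" i W "a n" "s n"] F(1) Suc
      by auto
  qed
  then show ?thesis using F(2) by (auto simp: G_def)
qed

lemma free_tensor_apply: "F \<in> tens i W \<Longrightarrow> w \<in> words B i \<Longrightarrow> F w \<in> carrier A"
  by (auto simp: free_tensor_def intro!: finsum_closed)

lemma free_tensor_undefined: "F \<in> tens i W \<Longrightarrow> w \<notin> words B i \<Longrightarrow> F w = undefined"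
  by (auto simp: free_tensor_def)

lemma free_tensor_eqI:
  assumes "F \<in> tens i W" "G \<in> tens i W'"
    and "\<And>w. w \<in> words B i \<Longrightarrow> F w = G w"
  shows "F = G"
proof
  show "F w = G w" for w
    using assms free_tensor_undefined[OF assms(1)] free_tensor_undefined[OF assms(2)]
    by (cases "w \<in> words B i") auto
qed

lemma chain_plus_assoc:
  assumes "F \<in> tens i W" "G \<in> tens i W" "H \<in> tens i W"
  shows "chain_plus i (chain_plus i F G) H = chain_plus i F (chain_plus i G H)"
  by (intro words_ext[of i]) (use free_tensor_apply assms in \<open>auto simp: a_assoc\<close>)

lemma chain_plus_zero: "F \<in> tens i W \<Longrightarrow> chain_plus i F (chain_null i) = F"
  by (intro words_ext[of i]) (use free_tensor_apply[of F i W] free_tensor_undefined[of F i W] in auto)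

lemma free_tensor_add:
  assumes "F \<in> tens i W" "G \<in> tens i W"
  shows "chain_plus i F G \<in> tens i W"
  using assms(2)
proof (induction rule: free_tensor_induct)
  case zero
  then show ?case using chain_plus_zero[OF assms(1)] assms(1) by simp
next
  case (add_elem G x t)
  have "chain_plus i (chain_plus i F G) (elem i x t) \<in> tens i W"
    by (rule free_tensor_add_elem) (use add_elem in auto)
  then show ?case
    using chain_plus_assoc[OF assms(1) add_elem(1) elem_free_tensor] add_elem by simp
qed

text \<open>An inverse must again lie in A \<otimes> W, where W is an arbitrary set, so it is built
  along the generation of F: each summand x \<otimes> t is answered by (\<ominus> x) \<otimes>
  t.\<close>

lemma chain_group_abelian: "abelian_group (chain_group i W)"
proof (rule abelian_groupI)
  fix F assume "F \<in> carrier (chain_group i W)"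
  then have F: "F \<in> tens i W" by simp
  then have "\<exists>G\<in>tens i W. chain_plus i G F = chain_null i"
  proof (induction rule: free_tensor_induct)
    case zero
    show ?case
      by (rule bexI[OF _ zero_free_tensor]) (intro words_ext[of i]; simp)
  next
    case (add_elem F x t)
    then obtain G where G: "G \<in> tens i W" "chain_plus i G F = chain_null i"
      by auto
    have "chain_plus i (chain_plus i G (elem i (\<ominus> x) t)) (chain_plus i F (elem i x t)) w = \<zero>"
      if w: "w \<in> words B i" for w
    proof -
      have "G w \<oplus> F w = \<zero>" using fun_cong[OF G(2), of w] w by simp
      moreover have "t w \<odot> (\<ominus> x) \<oplus> t w \<odot> x = \<zero>"
        using add_elem by (simp add: smult_add_right[symmetric] l_neg)
      moreover have "G w \<oplus> t w \<odot> (\<ominus> x) \<oplus> (F w \<oplus> t w \<odot> x) =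
        (G w \<oplus> F w) \<oplus> (t w \<odot> (\<ominus> x) \<oplus> t w \<odot> x)"
        using add_elem G free_tensor_apply w by (simp add: a_ac)
      ultimately show ?thesis using w by (simp add: elem_def)
    qed
    then have "chain_plus i (chain_plus i G (elem i (\<ominus> x) t)) (chain_plus i F (elem i x t)) =
      (chain_null i)"
      by (intro words_ext[of i]) auto
    moreover have "chain_plus i G (elem i (\<ominus> x) t) \<in> tens i W"
      by (rule free_tensor_add_elem) (use G add_elem in auto)
    ultimately show ?case by blast
  qed
  then show "\<exists>G\<in>carrier (chain_group i W). G \<oplus>\<^bsub>chain_group i W\<^esub> F = \<zero>\<^bsub>chain_group i W\<^esub>"
    by (simp add: add_chain_group zero_chain_group)
next
  fix F assume "F \<in> carrier (chain_group i W)"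
  then show "\<zero>\<^bsub>chain_group i W\<^esub> \<oplus>\<^bsub>chain_group i W\<^esub> F = F"
    using free_tensor_apply[of F i W] free_tensor_undefined[of F i W]
    by (intro words_ext[of i]) (auto simp: add_chain_group zero_chain_group restrict_def)
next
  fix F G assume "F \<in> carrier (chain_group i W)" "G \<in> carrier (chain_group i W)"
  then show "F \<oplus>\<^bsub>chain_group i W\<^esub> G = G \<oplus>\<^bsub>chain_group i W\<^esub> F"
    using free_tensor_apply[of F i W] free_tensor_apply[of G i W]
    by (intro words_ext[of i]) (auto simp: add_chain_group a_comm)
qed (auto simp: add_chain_group zero_chain_group zero_free_tensor free_tensor_add chain_plus_assoc)

text \<open>Only the degree of the coefficient in A is counted. With i tensor factors, the total
  degree is this degree plus i.\<close>

definition chain_proj :: "nat \<Rightarrow> nat \<Rightarrow> ('e list \<Rightarrow> 'a) \<Rightarrow> 'e list \<Rightarrow> 'a" where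
  "chain_proj i n F = (\<lambda>w\<in>words B i. \<pi> n (F w))"

lemma chain_proj_elem: "x \<in> carrier A \<Longrightarrow> chain_proj i n (elem i x t) = elem i (\<pi> n x) t"
  by (intro words_ext[of i]) (auto simp: chain_proj_def proj_smult)

lemma chain_proj_add:
  assumes "F \<in> tens i W" "G \<in> tens i W"
  shows "chain_proj i n (chain_plus i F G) = chain_plus i (chain_proj i n F) (chain_proj i n G)"
  using free_tensor_apply[OF assms(1)] free_tensor_apply[OF assms(2)]
  by (intro words_ext[of i]) (auto simp: chain_proj_def proj_add)

lemma chain_proj_closed: "F \<in> tens i W \<Longrightarrow> chain_proj i n F \<in> tens i W"
proof (induction rule: free_tensor_induct)
  case zero
  have "chain_proj i n (chain_null i) = chain_null i"
    by (auto simp: chain_proj_def)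
  then show ?case using zero_free_tensor by simp
next
  case (add_elem F x t)
  then show ?case
    using chain_proj_add[OF add_elem(1) elem_free_tensor[OF add_elem(2,3)]]
    by (simp add: chain_proj_elem free_tensor_add_elem)
qed

lemma eval_additive: "w \<in> words B i \<Longrightarrow> additive_map (chain_group i W) A (\<lambda>F. F w)"
  by (rule additiveI) (auto simp: add_chain_group free_tensor_apply)

lemma chain_graded: "graded_group (chain_group i W) (chain_proj i)"
proof (intro graded_group.intro chain_group_abelian graded_group_axioms.intro)
  show "additive_map (chain_group i W) (chain_group i W) (chain_proj i n)" for n
    by (rule additiveI) (auto simp: chain_proj_closed chain_proj_add add_chain_group)
next
  fix F m n assume "F \<in> carrier (chain_group i W)"
  then show "chain_proj i m (chain_proj i n F) =
    (if m = n then chain_proj i n F else \<zero>\<^bsub>chain_group i W\<^esub>)"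
    using free_tensor_apply[of F i W] by (intro words_ext[of i]) (auto simp: chain_proj_def zero_chain_group proj_proj)
next
  fix F assume "F \<in> carrier (chain_group i W)"
  then have F: "F \<in> tens i W" by simp
  have "\<exists>M. \<forall>w\<in>words B i. \<forall>n\<ge>M. \<pi> n (F w) = \<zero>"
  proof -
    have "\<forall>w\<in>words B i. \<exists>M. \<forall>n\<ge>M. \<pi> n (F w) = \<zero>"
      using proj_bound free_tensor_apply[OF F] by meson
    then obtain f where f: "\<forall>w\<in>words B i. \<forall>n\<ge>f w. \<pi> n (F w) = \<zero>" by metis
    \<comment> \<open>Finitely many words index the coefficients, so their degree bounds have a
      maximum; inserting 0 keeps it defined when there are no words.\<close>
    have "\<forall>w\<in>words B i. \<forall>n\<ge>Max (insert 0 (f ` words B i)). \<pi> n (F w) = \<zero>"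
      using f finite_words[OF finite_Basis, of i] by simp
    then show ?thesis by blast
  qed
  then obtain M where M: "\<And>w n. w \<in> words B i \<Longrightarrow> n \<ge> M \<Longrightarrow> \<pi> n (F w) = \<zero>" by auto
  interpret C: abelian_group "chain_group i W" by (rule chain_group_abelian)
  have "F = (\<Oplus>\<^bsub>chain_group i W\<^esub>n\<in>{..<M}. chain_proj i n F)"
  proof (rule free_tensor_eqI)
    show "(\<Oplus>\<^bsub>chain_group i W\<^esub>n\<in>{..<M}. chain_proj i n F) \<in> tens i W"
      using C.finsum_closed[of "\<lambda>n. chain_proj i n F" "{..<M}"] chain_proj_closed[OF F] by auto
    fix w assume w: "w \<in> words B i"
    have "(\<Oplus>\<^bsub>chain_group i W\<^esub>n\<in>{..<M}. chain_proj i n F) w = (\<Oplus>n\<in>{..<M}. chain_proj i n F w)"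
      by (rule additive_finsum[OF chain_group_abelian abelian eval_additive[OF w]])
        (use chain_proj_closed[OF F] in auto)
    also have "\<dots> = (\<Oplus>n\<in>{..<M}. \<pi> n (F w))"
      using w by (simp add: chain_proj_def)
    also have "\<dots> = F w"
      by (rule proj_sum[symmetric]) (use F free_tensor_apply w M in auto)
    finally show "F w = (\<Oplus>\<^bsub>chain_group i W\<^esub>n\<in>{..<M}. chain_proj i n F) w" by simp
  qed (rule F)
  then show "\<exists>M. (\<forall>n\<ge>M. chain_proj i n F = \<zero>\<^bsub>chain_group i W\<^esub>) \<and>
      F = (\<Oplus>\<^bsub>chain_group i W\<^esub>n\<in>{..<M}. chain_proj i n F)"
  proof (intro exI[of _ M] conjI allI impI)
    show "chain_proj i n F = \<zero>\<^bsub>chain_group i W\<^esub>" if "M \<le> n" for n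
      unfolding chain_proj_def zero_chain_group chain_null_def by (rule restrict_ext) (use M that in auto)
  qed
qed

lemma elem_hom_part:
  "x \<in> homog p \<Longrightarrow> t \<in> W \<Longrightarrow> elem i x t \<in> hom_part (chain_group i W) (chain_proj i) p"
  using chain_proj_elem[of x i p t] by (auto simp: hom_part_def elem_free_tensor)

lemma elem_add_left:
  "x \<in> carrier A \<Longrightarrow> y \<in> carrier A \<Longrightarrow> elem i (x \<oplus> y) t = chain_plus i (elem i x t) (elem i y t)"
  by (intro words_ext[of i]) (auto simp: smult_add_right)

lemma elem_add_right:
  "x \<in> carrier A \<Longrightarrow> elem i x (s + t) = chain_plus i (elem i x s) (elem i x t)"
  by (intro words_ext[of i]) (auto simp: smult_add_left)

lemma elem_scale: "x \<in> carrier A \<Longrightarrow> elem i x (tensor_scale c t) = elem i (c \<odot> x) t"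
  by (intro words_ext[of i]) (auto simp: smult_smult tensor_scale_def mult.commute)

lemma elem_zero [simp]: "elem i \<zero> t = chain_null i"
  by (auto simp: elem_def)

lemma elem_additive: "t \<in> W \<Longrightarrow> additive_map A (chain_group i W) (\<lambda>x. elem i x t)"
  by (rule additiveI) (auto simp: elem_free_tensor elem_add_left add_chain_group)

lemma chain_hom_induct [consumes 1, case_names zero elem add]:
  assumes "F \<in> tens i W"
    and "P (chain_null i)"
    and "\<And>p x t. x \<in> homog p \<Longrightarrow> t \<in> W \<Longrightarrow> P (elem i x t)"
    and "\<And>F G. F \<in> tens i W \<Longrightarrow> G \<in> tens i W \<Longrightarrow> P F \<Longrightarrow> P G \<Longrightarrow>
      P (chain_plus i F G)"
  shows "P F"
  using assms(1)
proof (induction rule: free_tensor_induct)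
  case (add_elem F x t)
  have "P (elem i x t)"
    using \<open>x \<in> carrier A\<close>
  proof (induction rule: hom_part_induct)
    case (add x y)
    then show ?case
      using assms(4)[OF elem_free_tensor elem_free_tensor, of x t y t] add_elem(3)
      by (simp add: elem_add_left)
  qed (use assms(3) add_elem in auto)
  then show ?case
    by (intro assms(4)[OF add_elem(1) elem_free_tensor] add_elem)
qed (rule assms(2))

text \<open>A homogeneous coefficient times a pure tensor is the form on which the twists and the
  differential have closed formulas. Scalars of the tensor part are moved into the
  coefficient.\<close>

lemma chain_pure_induct [consumes 1, case_names pure add]:
  assumes F: "F \<in> tens i (E i)"
    and pure: "\<And>p x es. x \<in> homog p \<Longrightarrow> length es = i \<Longrightarrow> P (elem i x (pure es))"
    and add: "\<And>F G. F \<in> tens i (E i) \<Longrightarrow> G \<in> tens i (E i) \<Longrightarrow>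
      P F \<Longrightarrow> P G \<Longrightarrow> P (chain_plus i F G)"
  shows "P F"
  using F
proof (induction rule: chain_hom_induct)
  case zero
  show ?case using pure[OF hom_part_zero, of "replicate i 0"] by simp
next
  case (elem p x t)
  from elem(2) show "P (elem i x t)"
  proof (induction rule: tensor_power_induct)
    case (add s t)
    have "P (chain_plus i (elem i x s) (elem i x t))"
      by (rule assms(3)) (use add elem hom_part_closed elem_free_tensor in auto)
    then show "P (elem i x (s + t))"
      using elem_add_right[OF hom_part_closed[OF elem(1)], of i s t] by simp
  next
    case (pure c v)
    then have "P (elem i (c \<odot> x) (pure v))"
      using assms(2) smult_hom_part[OF elem(1)] by blast
    then show "P (elem i x (tensor_scale c (pure v)))"
      using elem_scale[OF hom_part_closed[OF elem(1)]] by simp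
  qed
qed (rule add)

text \<open>The operator \<open>c \<otimes> (g\<^sub>0 \<otimes> \<dots> \<otimes> g\<^sub>i\<^sub>-\<^sub>1)\<close> on \<open>A \<otimes> E\<^bsup>\<otimes>i\<^esup>\<close>\<close>

definition chain_map :: "nat \<Rightarrow> ('a \<Rightarrow> 'a) \<Rightarrow> (nat \<Rightarrow> 'e \<Rightarrow> 'e) \<Rightarrow> ('e list \<Rightarrow> 'a) \<Rightarrow> 'e list \<Rightarrow> 'a" where
  "chain_map i c g F = (\<lambda>w\<in>words B i. \<Oplus>v\<in>words B i. pure (twist_word g v) w \<odot> c (F v))"

lemma chain_map_elem:
  assumes "k_linear c" "x \<in> carrier A" "t \<in> E i"
  shows "chain_map i c g (elem i x t) = elem i (c x) (multi_map g t)"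
proof
  fix w show "chain_map i c g (elem i x t) w = elem i (c x) (multi_map g t) w"
  proof (cases "w \<in> words B i")
    case True
    have cx: "c x \<in> carrier A" using assms k_linear_closed by blast
    have "chain_map i c g (elem i x t) w = (\<Oplus>v\<in>words B i. pure (twist_word g v) w \<odot> c (t v \<odot> x))"
      using True cx assms by (auto simp: chain_map_def elem_def k_linear_smult intro!: finsum_cong')
    also have "\<dots> = (\<Oplus>v\<in>words B i. (t v * pure (twist_word g v) w) \<odot> c x)"
      using assms cx by (intro finsum_cong') (auto simp: k_linear_smult smult_smult mult.commute)
    also have "\<dots> = (\<Sum>v\<in>words B i. t v * pure (twist_word g v) w) \<odot> c x"
      by (rule sum_smult[symmetric]) (use cx finite_words finite_Basis in auto)
    also have "(\<Sum>v\<in>words B i. t v * pure (twist_word g v) w) = multi_map g t w"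
      by (rule multi_map_eq[symmetric])
        (use assms(3) finite_words finite_Basis in \<open>auto simp: tensor_power_def\<close>)
    finally show ?thesis using True by simp
  qed (simp add: chain_map_def)
qed

lemma chain_map_add:
  assumes "k_linear c" "F \<in> tens i W" "G \<in> tens i W"
  shows "chain_map i c g (chain_plus i F G) = chain_plus i (chain_map i c g F) (chain_map i c g G)"
proof
  fix w show "chain_map i c g (chain_plus i F G) w =
    chain_plus i (chain_map i c g F) (chain_map i c g G) w"
  proof (cases "w \<in> words B i")
    case True
    have FG: "F v \<in> carrier A" "G v \<in> carrier A" "c (F v) \<in> carrier A" "c (G v) \<in> carrier A"
      if "v \<in> words B i" for v
      using that assms k_linear_closed free_tensor_apply by blast+
    have "chain_map i c g (chain_plus i F G) w =
      (\<Oplus>v\<in>words B i. pure (twist_word g v) w \<odot> c (chain_plus i F G v))"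
      using True by (simp add: chain_map_def)
    also have "\<dots> =
      (\<Oplus>v\<in>words B i. pure (twist_word g v) w \<odot> c (F v) \<oplus> pure (twist_word g v) w \<odot> c (G v))"
    proof (rule finsum_cong')
      fix v assume v: "v \<in> words B i"
      show "pure (twist_word g v) w \<odot> c (chain_plus i F G v) =
        pure (twist_word g v) w \<odot> c (F v) \<oplus> pure (twist_word g v) w \<odot> c (G v)"
        using FG[OF v] v by (simp add: additive_add[OF k_linear_additive[OF assms(1)]] smult_add_right)
    qed (use FG in auto)
    also have "\<dots> = chain_map i c g F w \<oplus> chain_map i c g G w"
      using FG True by (subst finsum_addf) (auto simp: chain_map_def)
    finally show ?thesis using True by simp
  qed (simp add: chain_map_def)
qed

lemma chain_map_additive:
  assumes "k_linear c" "W \<subseteq> E i" "\<And>t. t \<in> W \<Longrightarrow> multi_map g t \<in> W'"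
  shows "additive_map (chain_group i W) (chain_group i W') (chain_map i c g)"
proof (rule additiveI)
  fix F assume "F \<in> carrier (chain_group i W)"
  then have "F \<in> tens i W" by simp
  then show "chain_map i c g F \<in> carrier (chain_group i W')"
  proof (induction rule: free_tensor_induct)
    case zero
    have "c \<zero> = \<zero>"
      by (rule additive_zero[OF abelian abelian k_linear_additive[OF assms(1)]])
    then have "chain_map i c g (chain_null i) = chain_null i"
      by (intro words_ext[of i]) (auto simp: chain_map_def intro!: add.finprod_one_eqI)
    then show ?case using zero_free_tensor by simp
  next
    case (add_elem F x t)
    have "chain_map i c g (chain_plus i F (elem i x t)) =
      chain_plus i (chain_map i c g F) (elem i (c x) (multi_map g t))"
      using chain_map_add[OF assms(1) add_elem(1) elem_free_tensor] chain_map_elem[OF assms(1)]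
        add_elem assms(2) by auto
    also have "\<dots> \<in> tens i W'"
      by (rule free_tensor_add_elem) (use add_elem assms k_linear_closed in auto)
    finally show ?case by simp
  qed
qed (simp add: add_chain_group chain_map_add[OF assms(1)])

lemma free_tensor_mono: "W \<subseteq> W' \<Longrightarrow> tens i W \<subseteq> tens i W'"
  unfolding free_tensor_def by blast

lemma chain_pure_eq:
  assumes "additive_map (chain_group i (E i)) (chain_group j W) f"
    and "additive_map (chain_group i (E i)) (chain_group j W') g"
    and "\<And>p x es. x \<in> homog p \<Longrightarrow> length es = i \<Longrightarrow> f (elem i x (pure es)) = g (elem i x (pure es))"
    and "F \<in> tens i (E i)"
  shows "f F = g F"
  using assms(4)
proof (induction rule: chain_pure_induct)
  case (add F G)
  then show ?case
    using additive_add[OF assms(1), of F G] additive_add[OF assms(2), of F G]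
    by (simp add: add_chain_group)
qed (use assms(3) in auto)

text \<open>The degree p of the coefficient selects both the map on the coefficient and the maps on
  the tensor factors. The operator is formed on all of A \<otimes> E^i; how it moves the subspaces A
  \<otimes> W is stated separately.\<close>

definition graded_chain_map ::
  "nat \<Rightarrow> (nat \<Rightarrow> 'a \<Rightarrow> 'a) \<Rightarrow> (nat \<Rightarrow> nat \<Rightarrow> 'e \<Rightarrow> 'e) \<Rightarrow> ('e list \<Rightarrow> 'a) \<Rightarrow> 'e list \<Rightarrow> 'a" where
  "graded_chain_map i c g = graded_sum (chain_group i (E i)) (chain_proj i)
     (chain_group i (E i)) (\<lambda>p. chain_map i (c p) (g p))"

lemma chain_map_additive_full:
  "k_linear c \<Longrightarrow> additive_map (chain_group i (E i)) (chain_group i (E i)) (chain_map i c g)"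
  by (intro chain_map_additive multi_map_tensor_power) auto

lemma graded_chain_map_additive_full:
  assumes "\<And>p. k_linear (c p)"
  shows "additive_map (chain_group i (E i)) (chain_group i (E i)) (graded_chain_map i c g)"
  unfolding graded_chain_map_def
  by (rule graded_group.graded_sum_additive[OF chain_graded chain_group_abelian])
    (rule chain_map_additive_full[OF assms])

lemma graded_chain_map_elem:
  assumes "\<And>p. k_linear (c p)" "x \<in> homog p" "t \<in> E i"
  shows "graded_chain_map i c g (elem i x t) = elem i (c p x) (multi_map (g p) t)"
proof -
  have "graded_chain_map i c g (elem i x t) = chain_map i (c p) (g p) (elem i x t)"
    unfolding graded_chain_map_def
    by (rule graded_group.graded_sum_hom_part[OF chain_graded chain_group_abelian])
      (use chain_map_additive_full[OF assms(1)] elem_hom_part[OF assms(2,3)] in auto)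
  then show ?thesis
    using chain_map_elem[OF assms(1) hom_part_closed[OF assms(2)] assms(3)] by simp
qed

lemma graded_chain_map_pure:
  assumes "\<And>p. k_linear (c p)" "\<And>p j. lin (g p j)" "x \<in> homog p" "length es = i"
  shows "graded_chain_map i c g (elem i x (pure es)) = elem i (c p x) (pure (twist_word (g p) es))"
  by (simp add: graded_chain_map_elem[OF assms(1,3)] pure_tensor_power assms(4) multi_map_pure assms(2))

lemma graded_chain_map_closed:
  assumes "\<And>p. k_linear (c p)" "W \<subseteq> E i" "\<And>p t. t \<in> W \<Longrightarrow> multi_map (g p) t \<in> W'"
    and "F \<in> tens i W"
  shows "graded_chain_map i c g F \<in> tens i W'"
  using assms(4)
proof (induction rule: chain_hom_induct)
  case zero
  show ?case
    using additive_zero[OF chain_group_abelian chain_group_abelian graded_chain_map_additive_full[of c i g]]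
      assms(1) zero_free_tensor by (simp add: zero_chain_group)
next
  case (elem p x t)
  have "t \<in> E i" using elem(2) assms(2) by blast
  then have "graded_chain_map i c g (elem i x t) = elem i (c p x) (multi_map (g p) t)"
    by (rule graded_chain_map_elem[OF assms(1) elem(1)])
  also have "\<dots> \<in> tens i W'"
    by (intro elem_free_tensor k_linear_closed[OF assms(1)] hom_part_closed[OF elem(1)] assms(3) elem(2))
  finally show "graded_chain_map i c g (elem i x t) \<in> tens i W'" .
next
  case (add F G)
  have "F \<in> tens i (E i)" "G \<in> tens i (E i)"
    using add free_tensor_mono[OF assms(2)] by auto
  then have "graded_chain_map i c g (chain_plus i F G) =
    chain_plus i (graded_chain_map i c g F) (graded_chain_map i c g G)"
    using additive_add[OF graded_chain_map_additive_full[of c i g]] assms(1) by (simp add: add_chain_group)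
  then show ?case using free_tensor_add add by simp
qed

lemma graded_chain_map_additive:
  assumes "\<And>p. k_linear (c p)" "W \<subseteq> E i" "\<And>p t. t \<in> W \<Longrightarrow> multi_map (g p) t \<in> W'"
  shows "additive_map (chain_group i W) (chain_group i W') (graded_chain_map i c g)"
proof (rule additiveI)
  fix F G assume "F \<in> carrier (chain_group i W)" "G \<in> carrier (chain_group i W)"
  then have "F \<in> tens i (E i)" "G \<in> tens i (E i)"
    using free_tensor_mono[OF assms(2)] by auto
  then show "graded_chain_map i c g (F \<oplus>\<^bsub>chain_group i W\<^esub> G) =
    graded_chain_map i c g F \<oplus>\<^bsub>chain_group i W'\<^esub> graded_chain_map i c g G"
    using additive_add[OF graded_chain_map_additive_full[of c i g]] assms(1) by (simp add: add_chain_group)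
qed (use graded_chain_map_closed[OF assms] in auto)

text \<open>The dual spaces W need not be spanned by pure tensors, so forms on A \<otimes> W are
  compared on x \<otimes> t with t in W, in contrast to operators on the full A \<otimes> E^i, for
  which pure tensors suffice.\<close>

lemma additive_eqI:
  assumes "additive_map (chain_group i W) A f" "additive_map (chain_group i W) A g"
    and "\<And>p x t. x \<in> homog p \<Longrightarrow> t \<in> W \<Longrightarrow> f (elem i x t) = g (elem i x t)"
    and "F \<in> tens i W"
  shows "f F = g F"
  using assms(4)
proof (induction rule: chain_hom_induct)
  case zero
  show ?case
    using additive_zero[OF chain_group_abelian abelian assms(1)]
      additive_zero[OF chain_group_abelian abelian assms(2)] by (simp add: zero_chain_group)
next
  case (add F G)
  then show ?case
    using additive_add[OF assms(1), of F G] additive_add[OF assms(2), of F G]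
    by (simp add: add_chain_group)
qed (use assms(3) in auto)

lemma finsum_words_Suc:
  assumes "\<And>w. w \<in> words B (Suc n) \<Longrightarrow> f w \<in> carrier A"
  shows "finsum A f (words B (Suc n)) = (\<Oplus>y\<in>B. \<Oplus>w\<in>words B n. f (y # w))"
proof -
  have "finsum A f (words B (Suc n)) = (\<Oplus>y\<in>B. finsum A f ((#) y ` words B n))"
    unfolding words_Suc
    by (rule add.finprod_UN_disjoint) (use assms in \<open>auto simp: finite_Basis finite_words pairwise_def disjnt_def\<close>)
  also have "\<dots> = (\<Oplus>y\<in>B. \<Oplus>w\<in>words B n. f (y # w))"
  proof (rule finsum_cong')
    fix y assume "y \<in> B"
    then show "finsum A f ((#) y ` words B n) = (\<Oplus>w\<in>words B n. f (y # w))"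
      using assms by (intro finsum_reindex) (auto simp: inj_on_def)
  qed (use assms in \<open>auto intro!: finsum_closed\<close>)
  finally show ?thesis .
qed

end

section \<open>Graded algebras and their Koszul differentials\<close>

text \<open>The axioms collect what the Koszul differential sees of an algebra: a bilinear product
  that adds degrees, a unit in degree 0, and E mapped linearly into degree 1. Each of them survives
  the passage to the twisted product.\<close>

locale graded_kalgebra = graded_vector_space scale B A \<pi>
  for scale :: "'k::field \<Rightarrow> 'e::ab_group_add \<Rightarrow> 'e" and B :: "'e set"
    and A :: "('k, 'e, 'a) graded_algebra" (structure) and \<pi> :: "nat \<Rightarrow> 'a \<Rightarrow> 'a" +
  assumes mult_closed [simp]: "x \<in> carrier A \<Longrightarrow> y \<in> carrier A \<Longrightarrow> x \<otimes> y \<in> carrier A"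
    and mult_add_left: "x \<in> carrier A \<Longrightarrow> y \<in> carrier A \<Longrightarrow> z \<in> carrier A \<Longrightarrow>
      (x \<oplus> y) \<otimes> z = x \<otimes> z \<oplus> y \<otimes> z"
    and mult_add_right: "x \<in> carrier A \<Longrightarrow> y \<in> carrier A \<Longrightarrow> z \<in> carrier A \<Longrightarrow>
      x \<otimes> (y \<oplus> z) = x \<otimes> y \<oplus> x \<otimes> z"
    and smult_mult_left: "x \<in> carrier A \<Longrightarrow> y \<in> carrier A \<Longrightarrow> (c \<odot> x) \<otimes> y = c \<odot> (x \<otimes> y)"
    and smult_mult_right: "x \<in> carrier A \<Longrightarrow> y \<in> carrier A \<Longrightarrow> x \<otimes> (c \<odot> y) = c \<odot> (x \<otimes> y)"
    and hom_part_mult: "x \<in> homog p \<Longrightarrow> y \<in> homog q \<Longrightarrow> x \<otimes> y \<in> homog (p + q)"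
    and gen_hom_part: "gen A e \<in> homog 1"
    and gen_add: "gen A (e + e') = gen A e \<oplus> gen A e'"
    and gen_scale: "gen A (scale c e) = c \<odot> gen A e"
    and one_hom_part: "\<one> \<in> homog 0"
begin

lemma gen_closed [simp]: "gen A e \<in> carrier A"
  using gen_hom_part hom_part_closed by blast

lemma one_closed [simp]: "\<one> \<in> carrier A"
  using one_hom_part hom_part_closed by blast

lemma mult_left_additive: "x \<in> carrier A \<Longrightarrow> additive_map A A (\<lambda>y. x \<otimes> y)"
  by (rule additiveI) (auto simp: mult_add_right)

lemma mult_right_additive: "y \<in> carrier A \<Longrightarrow> additive_map A A (\<lambda>x. x \<otimes> y)"
  by (rule additiveI) (auto simp: mult_add_left)

lemma gen_zero: "gen A 0 = \<zero>"
  using gen_scale[of 0 0] by simp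

lemma gen_sum: "finite S \<Longrightarrow> gen A (sum f S) = (\<Oplus>i\<in>S. gen A (f i))"
  by (induction S rule: finite_induct) (simp_all add: gen_zero gen_add finsum_insert Pi_def)

lemma gen_expand: "gen A e = (\<Oplus>y\<in>B. coord e y \<odot> gen A y)"
proof -
  have "gen A e = gen A (\<Sum>y\<in>B. scale (coord e y) y)"
    by (simp add: sum_representation)
  then show ?thesis by (simp add: gen_sum finite_Basis gen_scale)
qed

definition gen_word :: "'e list \<Rightarrow> 'a" where
  "gen_word v = foldr (\<lambda>x y. gen A x \<otimes> y) v \<one>"

lemma gen_word_simps [simp]: "gen_word [] = \<one>" "gen_word (e # v) = gen A e \<otimes> gen_word v"
  by (simp_all add: gen_word_def)

lemma gen_word_closed [simp]: "gen_word v \<in> carrier A"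
  by (induction v) auto

text \<open>Right-nested products of generators are multilinear in their factors. Expanding the
  first factor in B and the remaining ones by induction gives a double sum, which is the sum over
  the longer words.\<close>

lemma gen_word_expand: "gen_word es = (\<Oplus>w\<in>words B (length es). pure es w \<odot> gen_word w)"
proof (induction es)
  case Nil
  show ?case by (simp add: pure_Nil)
next
  case (Cons e es)
  have "gen_word (e # es) = (\<Oplus>y\<in>B. coord e y \<odot> gen A y) \<otimes> gen_word es"
    by (simp add: gen_expand[symmetric])
  also have "\<dots> = (\<Oplus>y\<in>B. (coord e y \<odot> gen A y) \<otimes> gen_word es)"
    by (rule additive_finsum[OF abelian abelian mult_right_additive]) (auto simp: finite_Basis)
  also have "\<dots> = (\<Oplus>y\<in>B. \<Oplus>w\<in>words B (length es). pure (e # es) (y # w) \<odot> gen_word (y # w))"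
  proof (rule finsum_cong')
    fix y assume "y \<in> B"
    have "(coord e y \<odot> gen A y) \<otimes> gen_word es =
      (\<Oplus>w\<in>words B (length es). (coord e y \<odot> gen A y) \<otimes> (pure es w \<odot> gen_word w))"
      by (subst Cons, rule additive_finsum[OF abelian abelian mult_left_additive])
        (auto simp: finite_words finite_Basis)
    also have "\<dots> = (\<Oplus>w\<in>words B (length es). pure (e # es) (y # w) \<odot> gen_word (y # w))"
      by (intro finsum_cong')
        (auto simp: smult_mult_left smult_mult_right smult_smult pure_Cons_Cons mult.commute)
    finally show "(coord e y \<odot> gen A y) \<otimes> gen_word es =
      (\<Oplus>w\<in>words B (length es). pure (e # es) (y # w) \<odot> gen_word (y # w))" .
  qed (auto intro!: finsum_closed)
  also have "\<dots> = (\<Oplus>w\<in>words B (length (e # es)). pure (e # es) w \<odot> gen_word w)"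
    by (simp only: list.size(4) add_Suc_right add_0_right, subst finsum_words_Suc) auto
  finally show ?case .
qed

lemma canonical_hom_eq:
  assumes "t \<in> E n"
  shows "canonical_hom A t = (\<Oplus>w\<in>words B n. t w \<odot> gen_word w)"
  unfolding canonical_hom_def gen_word_def[symmetric]
  by (rule add.finprod_mono_neutral_cong_left)
    (use assms in \<open>auto simp: finite_words finite_Basis tensor_power_def\<close>)

text \<open>Interchanging the two sums collects, for each word v of t, the expansion of the product
  of its twisted factors. Membership in the relations can thus be tested by twisting words instead
  of tensors.\<close>

lemma canonical_hom_multi_map:
  assumes "t \<in> E n"
  shows "canonical_hom A (multi_map g t) = (\<Oplus>v\<in>words B n. t v \<odot> gen_word (twist_word g v))"
proof -
  have fin: "finite (words B n)" by (intro finite_words finite_Basis)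
  have "canonical_hom A (multi_map g t) = (\<Oplus>w\<in>words B n. multi_map g t w \<odot> gen_word w)"
    by (rule canonical_hom_eq[OF multi_map_tensor_power[OF assms]])
  also have "\<dots> = (\<Oplus>w\<in>words B n. \<Oplus>v\<in>words B n. (t v * pure (twist_word g v) w) \<odot> gen_word w)"
  proof (rule finsum_cong')
    fix w
    have "multi_map g t w = (\<Sum>v\<in>words B n. t v * pure (twist_word g v) w)"
      by (rule multi_map_eq[OF fin]) (use assms in \<open>auto simp: tensor_power_def\<close>)
    then show "multi_map g t w \<odot> gen_word w =
      (\<Oplus>v\<in>words B n. (t v * pure (twist_word g v) w) \<odot> gen_word w)"
      using fin by (simp add: sum_smult)
  qed (auto intro!: finsum_closed)
  also have "\<dots> = (\<Oplus>v\<in>words B n. \<Oplus>w\<in>words B n. (t v * pure (twist_word g v) w) \<odot> gen_word w)"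
    by (rule finsum_swap) (use fin in auto)
  also have "\<dots> = (\<Oplus>v\<in>words B n. t v \<odot> gen_word (twist_word g v))"
  proof (rule finsum_cong')
    fix v assume v: "v \<in> words B n"
    have "(\<Oplus>w\<in>words B n. (t v * pure (twist_word g v) w) \<odot> gen_word w) =
      (\<Oplus>w\<in>words B n. t v \<odot> (pure (twist_word g v) w \<odot> gen_word w))"
      by (simp add: smult_smult)
    also have "\<dots> = t v \<odot> (\<Oplus>w\<in>words B n. pure (twist_word g v) w \<odot> gen_word w)"
      using fin by (intro smult_finsum[symmetric]) auto
    also have "(\<Oplus>w\<in>words B n. pure (twist_word g v) w \<odot> gen_word w) = gen_word (twist_word g v)"
      using gen_word_expand[of "twist_word g v"] words_length[OF v] by simp
    finally show "(\<Oplus>w\<in>words B n. (t v * pure (twist_word g v) w) \<odot> gen_word w) =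
      t v \<odot> gen_word (twist_word g v)" .
  qed auto
  finally show ?thesis .
qed

lemma koszul_d_apply:
  "w \<in> words B i \<Longrightarrow> koszul_d B A i F w = (\<Oplus>x\<in>B. F (x # w) \<otimes> gen A x)"
  "w \<notin> words B i \<Longrightarrow> koszul_d B A i F w = undefined"
  by (simp_all add: koszul_d_def)

text \<open>Expanding e in the basis shows that the coordinate formula for d is the basis-free map
  that absorbs the first tensor factor into the coefficient.\<close>

lemma koszul_d_pure:
  assumes x: "x \<in> carrier A"
  shows "koszul_d B A i (elem (Suc i) x (pure (e # es))) = elem i (x \<otimes> gen A e) (pure es)"
proof (rule words_ext[of i])
  fix w assume w: "w \<in> words B i"
  have "koszul_d B A i (elem (Suc i) x (pure (e # es))) w =
    (\<Oplus>y\<in>B. elem (Suc i) x (pure (e # es)) (y # w) \<otimes> gen A y)"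
    using w by (simp add: koszul_d_apply)
  also have "\<dots> = (\<Oplus>y\<in>B. (pure es w \<odot> x) \<otimes> (coord e y \<odot> gen A y))"
    using w x by (intro finsum_cong')
      (auto simp: pure_Cons_Cons smult_mult_left smult_mult_right smult_smult mult.commute)
  also have "\<dots> = (pure es w \<odot> x) \<otimes> (\<Oplus>y\<in>B. coord e y \<odot> gen A y)"
    using x by (intro additive_finsum[OF abelian abelian mult_left_additive, symmetric]) (auto simp: finite_Basis)
  also have "\<dots> = elem i (x \<otimes> gen A e) (pure es) w"
    using w x by (simp add: gen_expand[symmetric] smult_mult_left)
  finally show "koszul_d B A i (elem (Suc i) x (pure (e # es))) w = elem i (x \<otimes> gen A e) (pure es) w" .
qed (simp add: koszul_d_apply)

lemma koszul_d_plus: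
  assumes "F \<in> tens (Suc i) W" "G \<in> tens (Suc i) W"
  shows "koszul_d B A i (chain_plus (Suc i) F G) = chain_plus i (koszul_d B A i F) (koszul_d B A i G)"
proof (rule words_ext[of i])
  fix w assume w: "w \<in> words B i"
  have FG: "F (x # w) \<in> carrier A" "G (x # w) \<in> carrier A" if "x \<in> B" for x
    using that w assms by (auto intro!: free_tensor_apply)
  have "koszul_d B A i (chain_plus (Suc i) F G) w =
    (\<Oplus>x\<in>B. chain_plus (Suc i) F G (x # w) \<otimes> gen A x)"
    using w by (simp add: koszul_d_apply)
  also have "\<dots> = (\<Oplus>x\<in>B. F (x # w) \<otimes> gen A x \<oplus> G (x # w) \<otimes> gen A x)"
    using FG w by (intro finsum_cong') (auto simp: mult_add_left)
  also have "\<dots> = (\<Oplus>x\<in>B. F (x # w) \<otimes> gen A x) \<oplus> (\<Oplus>x\<in>B. G (x # w) \<otimes> gen A x)"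
    using FG by (intro finsum_addf) auto
  finally show "koszul_d B A i (chain_plus (Suc i) F G) w =
    chain_plus i (koszul_d B A i F) (koszul_d B A i G) w"
    using w by (simp add: koszul_d_apply)
qed (simp add: koszul_d_apply)

abbreviation full :: "nat \<Rightarrow> ('e list \<Rightarrow> 'a) ring" where
  "full i \<equiv> chain_group i (E i)"

lemma koszul_d_additive: "additive_map (full (Suc i)) (full i) (koszul_d B A i)"
proof (rule additiveI)
  fix F assume "F \<in> carrier (full (Suc i))"
  then have "F \<in> tens (Suc i) (E (Suc i))" by simp
  then have "koszul_d B A i F \<in> tens i (E i)"
  proof (induction rule: chain_pure_induct)
    case (pure p x es)
    then obtain e es' where es: "es = e # es'" "length es' = i" by (auto simp: length_Suc_conv)
    have "x \<in> carrier A" using pure hom_part_closed by blast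
    then show ?case
      using es koszul_d_pure[of x i e es'] by (auto intro!: elem_free_tensor pure_tensor_power)
  next
    case (add F G)
    then show ?case using koszul_d_plus[OF add(1,2)] free_tensor_add by simp
  qed
  then show "koszul_d B A i F \<in> carrier (full i)" by simp
qed (simp add: add_chain_group koszul_d_plus)

lemma koszul_d_power_additive: "additive_map (full (i + m)) (full i) (koszul_d_power B A m i)"
proof (induction m arbitrary: i)
  case 0
  have "koszul_d_power B A 0 i = (\<lambda>F. F)" by (rule ext) simp
  then show ?case by (simp add: additive_id)
next
  case (Suc m)
  have "koszul_d_power B A (Suc m) i = (\<lambda>F. koszul_d B A i (koszul_d_power B A m (Suc i) F))"
    by (rule ext) simp
  then show ?case
    using additive_comp[OF Suc[of "Suc i"] koszul_d_additive] by simp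
qed

lemma chain_hom_part_iff:
  "F \<in> hom_part (chain_group i W) (chain_proj i) p \<longleftrightarrow>
     F \<in> tens i W \<and> (\<forall>w\<in>words B i. F w \<in> homog p)"
proof -
  have "chain_proj i p F = F \<longleftrightarrow> (\<forall>w\<in>words B i. \<pi> p (F w) = F w)" if F: "F \<in> tens i W"
  proof
    assume "chain_proj i p F = F"
    then have "chain_proj i p F w = F w" for w by simp
    then show "\<forall>w\<in>words B i. \<pi> p (F w) = F w" unfolding chain_proj_def by (metis restrict_apply)
  next
    assume "\<forall>w\<in>words B i. \<pi> p (F w) = F w"
    then show "chain_proj i p F = F"
      using free_tensor_undefined[OF F] by (intro words_ext[of i]) (auto simp: chain_proj_def)
  qed
  then show ?thesis using free_tensor_apply[of F i W] by (auto simp: hom_part_def)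
qed

lemma koszul_d_hom_part:
  assumes "F \<in> hom_part (full (Suc i)) (chain_proj (Suc i)) p"
  shows "koszul_d B A i F \<in> hom_part (full i) (chain_proj i) (Suc p)"
proof -
  have F: "F \<in> tens (Suc i) (E (Suc i))"
    "\<And>w. w \<in> words B (Suc i) \<Longrightarrow> F w \<in> homog p"
    using assms by (auto simp: chain_hom_part_iff)
  have "F (x # w) \<otimes> gen A x \<in> homog (Suc p)" if "x \<in> B" "w \<in> words B i" for x w
    using hom_part_mult[OF F(2)[of "x # w"] gen_hom_part[of x]] that by simp
  then have "koszul_d B A i F w \<in> homog (Suc p)" if "w \<in> words B i" for w
    using that finite_Basis by (auto simp: koszul_d_apply intro!: hom_part_finsum)
  moreover have "koszul_d B A i F \<in> tens i (E i)"
    using additive_closed[OF koszul_d_additive] F(1) by auto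
  ultimately show ?thesis by (simp add: chain_hom_part_iff)
qed

text \<open>Each application of d absorbs one tensor factor, so the degree of the coefficient rises
  by m while m factors disappear. Total degree is preserved, and with it the exponent used for
  twisting cochains.\<close>

lemma koszul_d_power_hom_part:
  "F \<in> hom_part (full (i + m)) (chain_proj (i + m)) p \<Longrightarrow>
    koszul_d_power B A m i F \<in> hom_part (full i) (chain_proj i) (p + m)"
  by (induction m arbitrary: i) (use koszul_d_hom_part in auto)

end

section \<open>The dual spaces under twisting\<close>

context tensor_basis
begin

lemma relations_tensor_power: "t \<in> relations B N A \<Longrightarrow> t \<in> E N"
  by (simp add: relations_def)

lemma span_subset_tensor_power:
  fixes S :: "('e list \<Rightarrow> 'k) set"
  shows "S \<subseteq> E i \<Longrightarrow> tensor.span S \<subseteq> E i"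
  by (rule tensor.span_minimal[OF _ tensor_power_subspace])

lemma koszul_dual_tensor_power:
  fixes A :: "('k, 'e, 'a) graded_algebra"
  assumes "t \<in> koszul_dual B N A i"
  shows "t \<in> E i"
proof (cases "i < N")
  case False
  \<comment> \<open>A single member of the intersection, the one with r = 0, already lies inside
    \<open>E i\<close>.\<close>
  have "t \<in> tensor.span {tensor_mult (tensor_mult u \<rho>) v | u \<rho> v.
      u \<in> E 0 \<and> \<rho> \<in> relations B N A \<and> v \<in> E (i - N)}"
    using assms False by (auto simp: koszul_dual_def)
  moreover have "{tensor_mult (tensor_mult u \<rho>) v | u \<rho> v.
      u \<in> E 0 \<and> \<rho> \<in> relations B N A \<and> v \<in> E (i - N)} \<subseteq>
      (E i :: ('e list \<Rightarrow> 'k) set)"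
    using False tensor_mult_tensor_power[OF tensor_mult_tensor_power[OF _ relations_tensor_power], of _ 0 _ N A _ "i - N"]
    by auto
  ultimately show ?thesis using span_subset_tensor_power by blast
qed (use assms in \<open>auto simp: koszul_dual_def\<close>)

lemma multi_map_span:
  fixes S S' :: "('e list \<Rightarrow> 'k) set"
  assumes "S \<subseteq> E i" "\<And>t. t \<in> S \<Longrightarrow> multi_map g t \<in> S'" "t \<in> tensor.span S"
  shows "multi_map g t \<in> tensor.span S'"
proof -
  \<comment> \<open>Membership in \<open>E i\<close> is carried along the induction because
    additivity of \<open>multi_map\<close> asks for finite supports.\<close>
  have "t \<in> E i \<and> multi_map g t \<in> tensor.span S'"
    using assms(3)
  proof (induction rule: tensor.span_induct_alt)
    case base
    show "(0 :: 'e list \<Rightarrow> 'k) \<in> E i \<and> multi_map g 0 \<in> tensor.span S'"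
      using tensor.subspace_0[OF tensor_power_subspace] tensor.span_zero[of S'] by simp
  next
    case (step c s t)
    have s: "s \<in> E i" using step assms(1) by blast
    then have cs: "tensor_scale c s \<in> E i"
      by (rule tensor.subspace_scale[OF tensor_power_subspace])
    have "multi_map g (tensor_scale c s + t) = tensor_scale c (multi_map g s) + multi_map g t"
      using step cs
      by (simp add: multi_map_add[OF tensor_power_finite[of _ i] tensor_power_finite[of _ i]] multi_map_scale)
    moreover have "tensor_scale c (multi_map g s) + multi_map g t \<in> tensor.span S'"
      using step assms(2)[of s] by (blast intro: tensor.span_add tensor.span_scale tensor.span_base)
    ultimately show "tensor_scale c s + t \<in> E i \<and>
      multi_map g (tensor_scale c s + t) \<in> tensor.span S'"
      using tensor.subspace_add[OF tensor_power_subspace cs] step by simp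
  qed
  then show ?thesis by simp
qed

text \<open>Each space E^r \<otimes> R \<otimes> E^s of the intersection is treated separately: its
  left factor meets the family from index 0, the relation from offset r, the right factor from
  offset r + N. The hypothesis on relations is limited to r + N \<le> i, which keeps exponents of
  the form i - j from being truncated.\<close>

lemma multi_map_koszul_dual:
  fixes A A' :: "('k, 'e, 'a) graded_algebra"
  assumes g: "\<And>j. lin (g j)"
    and rel: "\<And>r t. r + N \<le> i \<Longrightarrow> t \<in> relations B N A' \<Longrightarrow> multi_map (\<lambda>j. g (r + j)) t \<in> relations B N A"
    and t: "t \<in> koszul_dual B N A' i"
  shows "multi_map g t \<in> koszul_dual B N A i"
proof (cases "i < N")
  case True
  then show ?thesis using t multi_map_tensor_power by (simp add: koszul_dual_def)
next
  case False
  let ?S = "\<lambda>A r s. {tensor_mult (tensor_mult u \<rho>) v | u \<rho> v.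
      u \<in> E r \<and> \<rho> \<in> relations B N A \<and> v \<in> E s}"
  have "multi_map g t \<in> tensor.span (?S A r s)" if rs: "r + s = i - N" for r s
  proof (rule multi_map_span)
    show "t \<in> tensor.span (?S A' r s)" using t False rs by (auto simp: koszul_dual_def)
    have i: "r + N + s = i" using rs False by simp
    show "?S A' r s \<subseteq> E i"
      using tensor_mult_tensor_power[OF tensor_mult_tensor_power[OF _ relations_tensor_power], of _ r _ N A' _ s]
      by (auto simp: i)
    fix x assume "x \<in> ?S A' r s"
    then obtain u \<rho> v where x: "x = tensor_mult (tensor_mult u \<rho>) v" "u \<in> E r"
      "\<rho> \<in> relations B N A'" "v \<in> E s" by auto
    note \<rho> = relations_tensor_power[OF x(3)]
    have "multi_map g x = tensor_mult (tensor_mult (multi_map g u) (multi_map (\<lambda>j. g (r + j)) \<rho>))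
      (multi_map (\<lambda>j. g (r + N + j)) v)"
      unfolding x(1) using g
      by (simp add: multi_map_mult[OF _ tensor_mult_tensor_power[OF x(2) \<rho>] x(4)] multi_map_mult[OF _ x(2) \<rho>])
    moreover have "multi_map (\<lambda>j. g (r + j)) \<rho> \<in> relations B N A"
      using rel[of r \<rho>] x(3) i by simp
    ultimately show "multi_map g x \<in> ?S A r s"
      using multi_map_tensor_power[OF x(2)] multi_map_tensor_power[OF x(4)] by blast
  qed
  then show ?thesis using False by (auto simp: koszul_dual_def)
qed

end

section \<open>Two algebras differing by a twist\<close>

text \<open>The twisted product is described only by its values on homogeneous left factors, not by
  the construction of the semi-cross product; so the relation between A and A' can be read in either
  direction. The mutually inverse maps a, b act on the algebra and \<alpha>, \<beta> on E.\<close>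

locale twisted_pair = A: graded_kalgebra scale B A \<pi> + A': graded_kalgebra scale B A' \<pi>
  for scale :: "'k::field \<Rightarrow> 'e::ab_group_add \<Rightarrow> 'e" and B :: "'e set"
    and A :: "('k, 'e, 'a) graded_algebra" (structure) and A' :: "('k, 'e, 'a) graded_algebra" and \<pi> :: "nat \<Rightarrow> 'a \<Rightarrow> 'a" +
  fixes a b :: "'a \<Rightarrow> 'a" and \<alpha> \<beta> :: "'e \<Rightarrow> 'e"
  assumes A'_eq: "A' = A\<lparr>monoid.mult := monoid.mult A'\<rparr>"
    and a_linear: "A.k_linear a" and b_linear: "A.k_linear b"
    and a_b: "x \<in> carrier A \<Longrightarrow> a (b x) = x" and b_a: "x \<in> carrier A \<Longrightarrow> b (a x) = x"
    and a_mult: "x \<in> carrier A \<Longrightarrow> y \<in> carrier A \<Longrightarrow> a (x \<otimes> y) = a x \<otimes> a y"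
    and a_one: "a \<one> = \<one>"
    and a_gen: "a (gen A e) = gen A (\<alpha> e)"
    and \<alpha>_linear: "A.lin \<alpha>" and \<beta>_linear: "A.lin \<beta>"
    and \<alpha>_\<beta>: "\<alpha> (\<beta> e) = e" and \<beta>_\<alpha>: "\<beta> (\<alpha> e) = e"
    and twist: "x \<in> A.homog p \<Longrightarrow> y \<in> carrier A \<Longrightarrow> x \<otimes>\<^bsub>A'\<^esub> y = x \<otimes> (a ^^ p) y"
begin

lemma same [simp]:
  "carrier A' = carrier A" "\<one>\<^bsub>A'\<^esub> = \<one>" "\<zero>\<^bsub>A'\<^esub> = \<zero>" "x \<oplus>\<^bsub>A'\<^esub> y = x \<oplus> y"
  "c \<odot>\<^bsub>A'\<^esub> x = c \<odot> x" "gen A' e = gen A e" "comp A' n = comp A n"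
  by (subst A'_eq, simp)+

lemma same_add_monoid: "add_monoid A' = add_monoid A"
proof -
  have "ring.add A' = ring.add A" by (subst A'_eq) simp
  then show ?thesis by simp
qed

lemma same_finsum [simp]: "finsum A' f S = finsum A f S"
  unfolding finsum_def same_add_monoid ..

lemma same_hom_part [simp]: "hom_part A' \<pi> p = A.homog p"
  by (simp add: hom_part_def)

lemma same_free_tensor [simp]: "free_tensor B i A' W = A.tens i W"
  by (simp add: free_tensor_def)

lemma same_elem [simp]: "A'.elem i x t = A.elem i x t"
  by (simp add: A.elem_def A'.elem_def)

lemma same_chain_plus [simp]: "A'.chain_plus i F G = A.chain_plus i F G"
  by (simp add: A.chain_plus_def A'.chain_plus_def)

lemma same_chain_group [simp]: "A'.chain_group i W = A.chain_group i W"
proof -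
  have "A'.chain_plus i = A.chain_plus i" by (intro ext) simp
  moreover have "A'.chain_null i = A.chain_null i" by (simp add: A.chain_null_def A'.chain_null_def)
  ultimately show ?thesis by (simp add: A.chain_group_def A'.chain_group_def)
qed

lemma same_additive: "additive_map A' A' f \<longleftrightarrow> additive_map A A f"
  by (simp add: additive_map_def)

lemma same_k_linear: "A'.k_linear f \<longleftrightarrow> A.k_linear f"
  by (simp add: A.k_linear_def A'.k_linear_def same_additive)

lemma same_chain_map [simp]: "A'.chain_map i c g F = A.chain_map i c g F"
  by (simp add: A.chain_map_def A'.chain_map_def)

lemma b_mult:
  assumes "x \<in> carrier A" "y \<in> carrier A"
  shows "b (x \<otimes> y) = b x \<otimes> b y"
proof -
  have "b x \<in> carrier A" "b y \<in> carrier A"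
    using assms A.k_linear_closed[OF b_linear] by auto
  then show ?thesis
    using assms b_a[of "b x \<otimes> b y"] by (simp add: a_mult a_b)
qed

lemma b_one: "b \<one> = \<one>"
  using b_a[of "\<one>"] by (simp add: a_one)

lemma b_gen: "b (gen A e) = gen A (\<beta> e)"
  using b_a[of "gen A (\<beta> e)"] by (simp add: a_gen \<alpha>_\<beta>)

lemma lin_funpow: "A.lin f \<Longrightarrow> A.lin (f ^^ n)"
proof (induction n)
  case 0
  then show ?case by (simp add: A.linear_ident id_def)
next
  case (Suc n)
  then have "A.lin (f ^^ n)" by simp
  then show ?case unfolding funpow.simps(2) by (rule Vector_Spaces.linear_compose) (rule Suc.prems)
qed

lemma funpow_a_closed [simp]: "x \<in> carrier A \<Longrightarrow> (a ^^ n) x \<in> carrier A"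
  by (rule A.k_linear_closed[OF A.k_linear_funpow[OF a_linear]])

lemma funpow_b_closed [simp]: "x \<in> carrier A \<Longrightarrow> (b ^^ n) x \<in> carrier A"
  by (rule A.k_linear_closed[OF A.k_linear_funpow[OF b_linear]])

lemma funpow_a_b: "x \<in> carrier A \<Longrightarrow> (a ^^ n) ((b ^^ n) x) = x"
proof (induction n)
  case (Suc n)
  have "(a ^^ Suc n) ((b ^^ Suc n) x) = (a ^^ n) (a (b ((b ^^ n) x)))"
    by (simp add: funpow_Suc_right[of n a] del: funpow.simps(2)) simp
  then show ?case using Suc by (simp add: a_b)
qed simp

lemma funpow_b_a: "x \<in> carrier A \<Longrightarrow> (b ^^ n) ((a ^^ n) x) = x"
proof (induction n)
  case (Suc n)
  have "(b ^^ Suc n) ((a ^^ Suc n) x) = (b ^^ n) (b (a ((a ^^ n) x)))"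
    by (simp add: funpow_Suc_right[of n b] del: funpow.simps(2)) simp
  then show ?case using Suc by (simp add: b_a)
qed simp

lemma funpow_b_a_add: "x \<in> carrier A \<Longrightarrow> (b ^^ (m + n)) ((a ^^ n) x) = (b ^^ m) x"
  by (simp add: funpow_add funpow_b_a)

lemma funpow_\<beta>_\<alpha>: "(\<beta> ^^ n) ((\<alpha> ^^ n) e) = e"
proof (induction n)
  case (Suc n)
  have "(\<beta> ^^ Suc n) ((\<alpha> ^^ Suc n) e) = (\<beta> ^^ n) (\<beta> (\<alpha> ((\<alpha> ^^ n) e)))"
    by (simp add: funpow_Suc_right[of n "\<beta>"] del: funpow.simps(2)) simp
  then show ?case using Suc by (simp add: \<beta>_\<alpha>)
qed simp

lemma funpow_a_mult:
  "x \<in> carrier A \<Longrightarrow> y \<in> carrier A \<Longrightarrow> (a ^^ n) (x \<otimes> y) = (a ^^ n) x \<otimes> (a ^^ n) y"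
  by (induction n) (auto simp: a_mult)

lemma funpow_b_mult:
  "x \<in> carrier A \<Longrightarrow> y \<in> carrier A \<Longrightarrow> (b ^^ n) (x \<otimes> y) = (b ^^ n) x \<otimes> (b ^^ n) y"
  by (induction n) (auto simp: b_mult)

lemma funpow_a_gen: "(a ^^ n) (gen A e) = gen A ((\<alpha> ^^ n) e)"
  by (induction n) (auto simp: a_gen)

lemma funpow_b_gen: "(b ^^ n) (gen A e) = gen A ((\<beta> ^^ n) e)"
  by (induction n) (auto simp: b_gen)

text \<open>The inverse automorphism respects the new product because it preserves degrees and
  commutes with the powers of \<open>a\<close>; this is checked on homogeneous left factors and
  extended additively. The old product is recovered by cancelling \<open>a ^^ p\<close> with
  \<open>b ^^ p\<close>.\<close>

lemma swap: "twisted_pair scale B A' A \<pi> b a \<beta> \<alpha>"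
proof -
  interpret \<alpha>: Vector_Spaces.linear scale scale \<alpha> by (rule \<alpha>_linear)
  interpret \<beta>: Vector_Spaces.linear scale scale \<beta> by (rule \<beta>_linear)
  show ?thesis
  proof unfold_locales
    show "A = A'\<lparr>monoid.mult := monoid.mult A\<rparr>"
      by (subst A'_eq) simp
    show "b (x \<otimes>\<^bsub>A'\<^esub> y) = b x \<otimes>\<^bsub>A'\<^esub> b y" if "x \<in> carrier A'" "y \<in> carrier A'" for x y
      using that(1) unfolding same
    proof (induction rule: A.hom_part_induct)
      case (hom p x)
      have "x \<in> carrier A" "y \<in> carrier A" using hom A.hom_part_closed that by auto
      then have "b (x \<otimes>\<^bsub>A'\<^esub> y) = b x \<otimes> b ((a ^^ p) y)"
        using twist[OF hom] by (simp add: b_mult)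
      also have "b ((a ^^ p) y) = (a ^^ p) (b y)"
        using \<open>y \<in> carrier A\<close>
        by (induction p) (simp_all add: a_b b_a A.k_linear_closed[OF b_linear], metis a_b funpow_a_closed)
      also have "b x \<otimes> (a ^^ p) (b y) = b x \<otimes>\<^bsub>A'\<^esub> b y"
        using twist[OF A.k_linear_hom_part[OF b_linear hom]] A.k_linear_closed[OF b_linear] \<open>y \<in> carrier A\<close> by simp
      finally show ?case .
    next
      case (add x z)
      have y: "y \<in> carrier A" using that by simp
      note cl = A.k_linear_closed[OF b_linear] A'.mult_closed[unfolded same]
      show ?case
        using add y A'.mult_add_left[of x z y] A'.mult_add_left[of "b x" "b z" "b y"]
          additive_add[OF A.k_linear_additive[OF b_linear], of "x \<otimes>\<^bsub>A'\<^esub> y" "z \<otimes>\<^bsub>A'\<^esub> y"]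
          additive_add[OF A.k_linear_additive[OF b_linear], of x z]
        by (simp add: cl)
    qed
    show "x \<otimes> y = x \<otimes>\<^bsub>A'\<^esub> (b ^^ p) y" if "x \<in> hom_part A' \<pi> p" "y \<in> carrier A'" for x y p
      using that twist[of x p "(b ^^ p) y"] by (simp add: funpow_a_b)
  qed (auto simp: same_k_linear a_linear b_linear a_b b_a b_one b_gen \<alpha>_\<beta> \<beta>_\<alpha>
      \<alpha>.add \<alpha>.scale \<beta>.add \<beta>.scale)
qed

subsection \<open>Comparison of the dual spaces\<close>

lemma a_gen_word: "(a ^^ n) (A.gen_word v) = A.gen_word (map (\<alpha> ^^ n) v)"
proof (induction v)
  case Nil
  show ?case by (induction n) (auto simp: a_one)
qed (simp add: funpow_a_mult funpow_a_gen)

lemma b_gen_word: "(b ^^ n) (A.gen_word v) = A.gen_word (map (\<beta> ^^ n) v)"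
proof (induction v)
  case Nil
  show ?case by (induction n) (auto simp: b_one)
qed (simp add: funpow_b_mult funpow_b_gen)

text \<open>Origin of \<theta>: in the nested product e_0 (e_1 (e_2 ...)) of A' each generator has
  degree 1 and applies \<alpha> once to the whole product on its right, so the j-th factor collects
  j copies of \<alpha>.\<close>

lemma gen_word_twist: "A'.gen_word v = A.gen_word (twist_word (\<lambda>j. \<alpha> ^^ j) v)"
proof (induction v)
  case (Cons e v)
  have "A'.gen_word (e # v) = gen A e \<otimes> (a ^^ 1) (A.gen_word (twist_word (\<lambda>j. \<alpha> ^^ j) v))"
    using Cons twist[OF A.gen_hom_part] by simp
  also have "\<dots> = gen A e \<otimes> A.gen_word (map \<alpha> (twist_word (\<lambda>j. \<alpha> ^^ j) v))"
    using a_gen_word[of 1] by simp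
  also have "map \<alpha> (twist_word (\<lambda>j. \<alpha> ^^ j) v) = twist_word (\<lambda>j. \<alpha> ^^ Suc j) v"
    unfolding twist_word_const[symmetric] twist_word_twist_word by simp
  finally show ?case by simp
qed simp

text \<open>The image of the twisted tensor in A is f applied to the image of t in A', which is
  zero. With \<phi> the identity this says that \<theta>_N carries relations of A' to relations of
  A; a general \<phi> covers the additional power of \<alpha> or \<beta> that a relation receives
  from its offset.\<close>

lemma relations_twist:
  assumes t: "t \<in> relations B N A'"
    and f: "A.k_linear f" "\<And>v. f (A.gen_word v) = A.gen_word (map \<phi> v)"
    and g: "\<And>j. j < N \<Longrightarrow> g j = \<phi> \<circ> \<alpha> ^^ j"
  shows "A.multi_map g t \<in> relations B N A"
proof -
  have t': "t \<in> A.E N" and t0: "canonical_hom A' t = \<zero>"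
    using t by (auto simp: relations_def)
  have fin: "finite (words B N)" by (intro finite_words A.finite_Basis)
  have "canonical_hom A (A.multi_map g t) = (\<Oplus>v\<in>words B N. t v \<odot> A.gen_word (twist_word g v))"
    by (rule A.canonical_hom_multi_map[OF t'])
  also have "\<dots> = (\<Oplus>v\<in>words B N. f (t v \<odot> A'.gen_word v))"
  proof (rule A.finsum_cong')
    fix v assume v: "v \<in> words B N"
    have "twist_word g v = map \<phi> (twist_word (\<lambda>j. \<alpha> ^^ j) v)"
      unfolding twist_word_const[symmetric] twist_word_twist_word
      by (rule twist_word_cong) (use g words_length[OF v] in auto)
    then show "t v \<odot> A.gen_word (twist_word g v) = f (t v \<odot> A'.gen_word v)"
      by (simp add: A.k_linear_smult[OF f(1)] f(2) gen_word_twist)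
  qed (use A.k_linear_closed[OF f(1)] gen_word_twist in auto)
  also have "\<dots> = f (\<Oplus>v\<in>words B N. t v \<odot> A'.gen_word v)"
    by (rule additive_finsum[OF A.abelian A.abelian A.k_linear_additive[OF f(1)] fin, symmetric])
      (simp add: gen_word_twist)
  also have "(\<Oplus>v\<in>words B N. t v \<odot> A'.gen_word v) = \<zero>"
    using A'.canonical_hom_eq[OF t'] t0 by simp
  also have "f \<zero> = \<zero>"
    by (rule additive_zero[OF A.abelian A.abelian A.k_linear_additive[OF f(1)]])
  finally show ?thesis
    using A.multi_map_tensor_power[OF t'] by (simp add: relations_def)
qed

text \<open>A relation at offset r meets the exponents p + r + j, that is \<theta>_N followed by
  \<alpha>^(p+r), which is induced by an automorphism of A.\<close>

lemma koszul_dual_up: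
  assumes "t \<in> koszul_dual B N A' i"
  shows "A.multi_map (\<lambda>j. \<alpha> ^^ (p + j)) t \<in> koszul_dual B N A i"
  using assms
proof (rule A.multi_map_koszul_dual[rotated -1])
  fix r t assume "t \<in> relations B N A'"
  then show "A.multi_map (\<lambda>j. \<alpha> ^^ (p + (r + j))) t \<in> relations B N A"
    by (rule relations_twist[where \<phi> = "\<alpha> ^^ (p + r)" and f = "a ^^ (p + r)"])
      (auto simp: a_gen_word A.k_linear_funpow a_linear funpow_add[symmetric] add.assoc)
qed (intro lin_funpow \<alpha>_linear)

text \<open>A relation at offset r meets \<beta>^(i-r-j), which is \<theta>_N followed by
  \<beta>^(i-r): decreasing powers of the inverse grow with j just as powers of \<alpha> do.\<close>

lemma koszul_dual_down:
  assumes "t \<in> koszul_dual B N A' i"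
  shows "A.multi_map (\<lambda>j. \<beta> ^^ (i - j)) t \<in> koszul_dual B N A i"
  using assms
proof (rule A.multi_map_koszul_dual[rotated -1])
  fix r t assume r: "r + N \<le> i" and "t \<in> relations B N A'"
  then show "A.multi_map (\<lambda>j. \<beta> ^^ (i - (r + j))) t \<in> relations B N A"
  proof (rule_tac relations_twist[where \<phi> = "\<beta> ^^ (i - r)" and f = "b ^^ (i - r)"])
    fix j assume "j < N"
    \<comment> \<open>The bounds r + N \<le> i and j < N make the subtraction exact.\<close>
    then have "i - r = (i - (r + j)) + j" using r by simp
    then show "\<beta> ^^ (i - (r + j)) = \<beta> ^^ (i - r) \<circ> \<alpha> ^^ j"
      using funpow_\<beta>_\<alpha>[of j] by (simp add: funpow_add fun_eq_iff)
  qed (auto simp: b_gen_word A.k_linear_funpow b_linear)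
qed (intro lin_funpow \<beta>_linear)

lemma same_graded_chain_map [simp]: "A'.graded_chain_map i c g F = A.graded_chain_map i c g F"
proof -
  have "A'.chain_map i (c p) (g p) = A.chain_map i (c p) (g p)" for p by (rule ext) simp
  then show ?thesis
    unfolding A.graded_chain_map_def A'.graded_chain_map_def same_chain_group by (simp only:)
qed

subsection \<open>Comparison of the Koszul complexes\<close>

text \<open>\<open>up\<close> is the isomorphism of complexes from the overview, p being the degree
  of the coefficient; \<open>up'\<close> is the same map for the exchanged pair and turns out to be
  its inverse.\<close>

abbreviation "up i \<equiv> A.graded_chain_map i (\<lambda>_ x. x) (\<lambda>p j. \<alpha> ^^ (p + j))"
abbreviation "up' i \<equiv> A.graded_chain_map i (\<lambda>_ x. x) (\<lambda>p j. \<beta> ^^ (p + j))"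

text \<open>
  On the part of total degree \<open>n = p + i\<close> this is \<open>\<alpha>\<^sup>-\<^sup>n\<close> applied to \<open>up\<close>: the exponent of \<open>\<beta> = \<alpha>\<^sup>-\<^sup>1\<close> on the
  \<open>j\<close>-th factor, \<open>n - (p + j)\<close>, does not depend on \<open>p\<close>.
\<close>

abbreviation "down i \<equiv> A.graded_chain_map i (\<lambda>p. b ^^ (p + i)) (\<lambda>p j. \<beta> ^^ (i - j))"
abbreviation "full_chains i \<equiv> A.tens i (A.E i)"
abbreviation "dual_chains N i \<equiv> A.tens i (koszul_dual B N A i)"
abbreviation "dual_chains' N i \<equiv> A.tens i (koszul_dual B N A' i)"

lemma koszul_dual_subset: "koszul_dual B N A i \<subseteq> A.E i"
  and koszul_dual_subset': "koszul_dual B N A' i \<subseteq> A.E i"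
  using A.koszul_dual_tensor_power by auto

lemma dual_chains_full: "F \<in> dual_chains N i \<Longrightarrow> F \<in> full_chains i"
  using A.free_tensor_mono[OF koszul_dual_subset] by blast

lemma dual_chains_full': "F \<in> dual_chains' N i \<Longrightarrow> F \<in> full_chains i"
  using A.free_tensor_mono[OF koszul_dual_subset'] by blast

lemma up_closed: "F \<in> dual_chains' N i \<Longrightarrow> up i F \<in> dual_chains N i"
  by (rule A.graded_chain_map_closed[OF A.k_linear_id koszul_dual_subset' koszul_dual_up])

lemma up'_closed: "F \<in> dual_chains N i \<Longrightarrow> up' i F \<in> dual_chains' N i"
  using twisted_pair.up_closed[OF swap, of F i N] by simp

lemma k_linear_funpow_b: "A.k_linear (b ^^ n)"
  by (rule A.k_linear_funpow[OF b_linear])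

lemma k_linear_funpow_a: "A.k_linear (a ^^ n)"
  by (rule A.k_linear_funpow[OF a_linear])

lemma down_closed: "F \<in> dual_chains' N i \<Longrightarrow> down i F \<in> dual_chains N i"
  by (rule A.graded_chain_map_closed[OF k_linear_funpow_b koszul_dual_subset' koszul_dual_down])

lemma up_additive: "additive_map (A.full i) (A.full i) (up i)"
  by (rule A.graded_chain_map_additive_full[OF A.k_linear_id])

lemma up'_additive: "additive_map (A.full i) (A.full i) (up' i)"
  by (rule A.graded_chain_map_additive_full[OF A.k_linear_id])

lemma up'_up: "F \<in> full_chains i \<Longrightarrow> up' i (up i F) = F"
proof (rule A.chain_pure_eq[where f = "\<lambda>F. up' i (up i F)" and g = "\<lambda>F. F"])
  show "additive_map (A.full i) (A.full i) (\<lambda>F. up' i (up i F))"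
    by (rule additive_comp[OF up_additive up'_additive])
  show "additive_map (A.full i) (A.full i) (\<lambda>F. F)"
    by (rule additive_id)
next
  fix p x and es :: "'e list" assume x: "x \<in> A.homog p" "length es = i"
  have "twist_word (\<lambda>j. \<beta> ^^ (p + j)) (twist_word (\<lambda>j. \<alpha> ^^ (p + j)) es) = es"
    unfolding twist_word_twist_word by (rule twist_word_id) (simp add: funpow_\<beta>_\<alpha>)
  then show "up' i (up i (A.elem i x (A.pure es))) = A.elem i x (A.pure es)"
    using x by (simp add: A.graded_chain_map_pure A.k_linear_id lin_funpow \<alpha>_linear \<beta>_linear)
qed

lemma up_up': "F \<in> full_chains i \<Longrightarrow> up i (up' i F) = F"
  using twisted_pair.up'_up[OF swap, of F i] by simp

lemma twist_gen: "x \<in> A.homog p \<Longrightarrow> x \<otimes>\<^bsub>A'\<^esub> gen A e = x \<otimes> gen A ((\<alpha> ^^ p) e)"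
  by (simp add: twist funpow_a_gen)

lemma twist_gen_hom_part: "x \<in> A.homog p \<Longrightarrow> x \<otimes> gen A e \<in> A.homog (Suc p)"
  using A.hom_part_mult[OF _ A.gen_hom_part] by fastforce

lemma koszul_d'_pure:
  assumes "x \<in> A.homog p"
  shows "koszul_d B A' i (A.elem (Suc i) x (A.pure (e # es))) =
    A.elem i (x \<otimes> gen A ((\<alpha> ^^ p) e)) (A.pure es)"
  using A'.koszul_d_pure[of x i e es] A.hom_part_closed[OF assms] twist_gen[OF assms] by simp

lemma koszul_d'_additive: "additive_map (A.full (Suc i)) (A.full i) (koszul_d B A' i)"
  using A'.koszul_d_additive[of i] by simp

lemma koszul_d_power'_additive: "additive_map (A.full (i + m)) (A.full i) (koszul_d_power B A' m i)"
  using A'.koszul_d_power_additive[of i m] by simp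

text \<open>One argument for both twists. \<open>shift\<close> says that moving a factor one place
  forward compensates the gain of one degree in the coefficient; \<open>c_gen\<close> says that the
  first factor may be absorbed before or after twisting. Commutation is checked for a single d on
  pure tensors and then iterated.\<close>

lemma koszul_d_power_intertwine:
  fixes c :: "nat \<Rightarrow> nat \<Rightarrow> 'a \<Rightarrow> 'a" and g :: "nat \<Rightarrow> nat \<Rightarrow> nat \<Rightarrow> 'e \<Rightarrow> 'e"
  assumes c: "\<And>i p. A.k_linear (c i p)" and g: "\<And>i p j. A.lin (g i p j)"
    and shift: "\<And>i p j. g (Suc i) p (Suc j) = g i (Suc p) j"
    and c_gen: "\<And>i p x e. x \<in> A.homog p \<Longrightarrow>
      c (Suc i) p x \<otimes> gen A (g (Suc i) p 0 e) = c i (Suc p) (x \<otimes> gen A ((\<alpha> ^^ p) e))"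
    and F: "F \<in> full_chains (i + m)"
  shows "koszul_d_power B A m i (A.graded_chain_map (i + m) (c (i + m)) (g (i + m)) F) =
    A.graded_chain_map i (c i) (g i) (koszul_d_power B A' m i F)"
proof -
  let ?\<Theta> = "\<lambda>i. A.graded_chain_map i (c i) (g i)"
  have additive: "additive_map (A.full i) (A.full i) (?\<Theta> i)" for i
    by (rule A.graded_chain_map_additive_full[OF c])
  have step: "koszul_d B A i (?\<Theta> (Suc i) F) = ?\<Theta> i (koszul_d B A' i F)" if "F \<in> full_chains (Suc i)" for i F
  proof (rule A.chain_pure_eq[where f = "\<lambda>F. koszul_d B A i (?\<Theta> (Suc i) F)" and g = "\<lambda>F. ?\<Theta> i (koszul_d B A' i F)"])
    show "additive_map (A.full (Suc i)) (A.full i) (\<lambda>F. koszul_d B A i (?\<Theta> (Suc i) F))"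
      by (rule additive_comp[OF additive A.koszul_d_additive])
    show "additive_map (A.full (Suc i)) (A.full i) (\<lambda>F. ?\<Theta> i (koszul_d B A' i F))"
      by (rule additive_comp[OF koszul_d'_additive additive])
  next
    fix p x and es :: "'e list" assume x: "x \<in> A.homog p" and "length es = Suc i"
    then obtain e v where es: "es = e # v" "length v = i" by (auto simp: length_Suc_conv)
    have "koszul_d B A i (?\<Theta> (Suc i) (A.elem (Suc i) x (A.pure es))) =
      A.elem i (c (Suc i) p x \<otimes> gen A (g (Suc i) p 0 e)) (A.pure (twist_word (\<lambda>j. g (Suc i) p (Suc j)) v))"
      using es A.k_linear_closed[OF c A.hom_part_closed[OF x]]
      by (simp add: A.graded_chain_map_pure[OF c g x] A.koszul_d_pure)
    then show "koszul_d B A i (?\<Theta> (Suc i) (A.elem (Suc i) x (A.pure es))) =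
      ?\<Theta> i (koszul_d B A' i (A.elem (Suc i) x (A.pure es)))"
      using es c_gen[OF x] A.graded_chain_map_pure[OF c g twist_gen_hom_part[OF x] es(2)]
      by (simp add: koszul_d'_pure[OF x] shift)
  qed (rule that)
  show ?thesis
    using F
  proof (induction m arbitrary: i)
    case (Suc m)
    then have "koszul_d_power B A m (Suc i) (?\<Theta> (i + Suc m) F) = ?\<Theta> (Suc i) (koszul_d_power B A' m (Suc i) F)"
      using Suc.IH[of "Suc i"] by simp
    moreover have "koszul_d_power B A' m (Suc i) F \<in> full_chains (Suc i)"
      using additive_closed[OF koszul_d_power'_additive[of "Suc i" m]] Suc.prems by simp
    ultimately show ?case by (simp add: step)
  qed simp
qed

lemma koszul_d_power_up:
  "F \<in> full_chains (i + m) \<Longrightarrow>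
    koszul_d_power B A m i (up (i + m) F) = up i (koszul_d_power B A' m i F)"
  by (rule koszul_d_power_intertwine) (auto intro: A.k_linear_id lin_funpow \<alpha>_linear)

lemma koszul_d_power_down:
  "F \<in> full_chains (i + m) \<Longrightarrow>
    koszul_d_power B A m i (down (i + m) F) = down i (koszul_d_power B A' m i F)"
proof (rule koszul_d_power_intertwine)
  fix i p x e assume "x \<in> A.homog p"
  then have x: "x \<in> carrier A" by (rule A.hom_part_closed)
  \<comment> \<open>Of the p + 1 + i inverse powers, p cancel the power of \<alpha> coming from the
    product of A'; the remaining i + 1 are the exponent that \<open>down\<close> puts on the first
    of i + 1 factors.\<close>
  have "(b ^^ (Suc p + i)) (gen A ((\<alpha> ^^ p) e)) = gen A ((\<beta> ^^ Suc i) e)"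
    using funpow_b_a_add[of "gen A e" "Suc i" p] by (simp add: funpow_a_gen funpow_b_gen add.commute del: funpow.simps)
  then have "(b ^^ (Suc p + i)) (x \<otimes> gen A ((\<alpha> ^^ p) e)) = (b ^^ (Suc p + i)) x \<otimes> gen A ((\<beta> ^^ Suc i) e)"
    using x by (simp only: funpow_b_mult A.gen_closed)
  then show "(b ^^ (p + Suc i)) x \<otimes> gen A ((\<beta> ^^ (Suc i - 0)) e) = (b ^^ (Suc p + i)) (x \<otimes> gen A ((\<alpha> ^^ p) e))"
    by (simp del: funpow.simps)
qed (auto intro: k_linear_funpow_b lin_funpow \<beta>_linear)

lemma koszul_chains_eq: "koszul_chains B N A n = dual_chains N (koszul_degree N n)"
  and koszul_chains_eq': "koszul_chains B N A' n = dual_chains' N (koszul_degree N n)"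
  by (simp_all add: koszul_chains_def)

lemma chain_zero_eq: "chain_zero B N A n = \<zero>\<^bsub>A.chain_group (koszul_degree N n) W\<^esub>"
  and chain_zero_eq': "chain_zero B N A' n = \<zero>\<^bsub>A.chain_group (koszul_degree N n) W\<^esub>"
  by (simp_all add: chain_zero_def A.zero_chain_group A.chain_null_def)

text \<open>Counts the tensor factors absorbed by the differential from degree n + 1 to degree
  n.\<close>

definition step :: "nat \<Rightarrow> nat \<Rightarrow> nat" where
  "step N n = (if even n then 1 else N - 1)"

text \<open>For odd n the jump leads from pN + 1 to (p + 1)N; N \<ge> 1 keeps N - 1 from being
  truncated.\<close>

lemma koszul_degree_Suc:
  assumes "N \<ge> 1"
  shows "koszul_degree N (Suc n) = koszul_degree N n + step N n"
  using assms
  by (cases "even n") (auto simp: koszul_degree_def step_def odd_iff_mod_2_eq_one elim!: evenE oddE)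

lemma koszul_diff_eq: "koszul_diff B N X n = koszul_d_power B X (step N n) (koszul_degree N n)"
  by (simp add: koszul_diff_def step_def)

text \<open>Cochains are arbitrary linear forms, so the exponent is the total degree of the
  argument, which \<open>graded_sum\<close> splits by coefficient degree. The inner
  \<open>down\<close> supplies the inverse powers that make the result linear for the product of
  A'.\<close>

definition cochain_twist ::
  "nat \<Rightarrow> nat \<Rightarrow> (('e list \<Rightarrow> 'a) \<Rightarrow> 'a) \<Rightarrow> ('e list \<Rightarrow> 'a) \<Rightarrow> 'a" where
  "cochain_twist N n f = (\<lambda>F\<in>koszul_chains B N A' n.
     graded_sum (A.chain_group (koszul_degree N n) (koszul_dual B N A' (koszul_degree N n)))
       (A.chain_proj (koszul_degree N n)) A
       (\<lambda>p G. (a ^^ (p + koszul_degree N n)) (f (down (koszul_degree N n) G))) F)"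

context
  fixes N :: nat
  assumes N: "N \<ge> 2"
begin

abbreviation "deg n \<equiv> koszul_degree N n"
abbreviation chains where "chains \<equiv> koszul_chains B N A"
abbreviation "chains' \<equiv> koszul_chains B N A'"
abbreviation "diff \<equiv> koszul_diff B N A"
abbreviation "diff' \<equiv> koszul_diff B N A'"

lemma degree_Suc: "deg (Suc n) = deg n + step N n"
  using N by (intro koszul_degree_Suc) simp

lemma koszul_diff_up:
  assumes "F \<in> chains' (Suc n)"
  shows "diff n (up (deg (Suc n)) F) =
    up (deg n) (diff' n F)"
  using assms koszul_d_power_up[of F "deg n" "step N n"] dual_chains_full'
  by (simp add: koszul_diff_eq koszul_chains_eq' degree_Suc)

lemma koszul_diff_down:
  assumes "F \<in> chains' (Suc n)"
  shows "diff n (down (deg (Suc n)) F) =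
    down (deg n) (diff' n F)"
  using assms koszul_d_power_down[of F "deg n" "step N n"] dual_chains_full'
  by (simp add: koszul_diff_eq koszul_chains_eq' degree_Suc)

lemma koszul_diff_additive_full:
  "additive_map (A.full (deg (Suc n))) (A.full (deg n)) (diff n)"
  using A.koszul_d_power_additive by (simp add: koszul_diff_eq degree_Suc)

lemma koszul_diff_additive_full':
  "additive_map (A.full (deg (Suc n))) (A.full (deg n)) (diff' n)"
  using koszul_d_power'_additive by (simp add: koszul_diff_eq degree_Suc)

section \<open>Transfer of the Koszul property and of the global dimension\<close>

lemma koszul_chains_up: "F \<in> chains' n \<Longrightarrow> up (deg n) F \<in> chains n"
  by (simp add: koszul_chains_eq koszul_chains_eq' up_closed)

lemma koszul_chains_up': "F \<in> chains n \<Longrightarrow> up' (deg n) F \<in> chains' n"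
  by (simp add: koszul_chains_eq koszul_chains_eq' up'_closed)

lemma koszul_diff'_full:
  "F \<in> chains' (Suc n) \<Longrightarrow> diff' n F \<in> full_chains (deg n)"
  using additive_closed[OF koszul_diff_additive_full'[of n], of F] dual_chains_full'
  by (simp add: koszul_chains_eq')

lemma up_zero: "up (deg n) (chain_zero B N A' n) = chain_zero B N A n"
  unfolding chain_zero_eq[of N n "A.E (deg n)"] chain_zero_eq'[of N n "A.E (deg n)"]
  by (rule additive_zero[OF A.chain_group_abelian A.chain_group_abelian up_additive])

lemma up_inj:
  assumes "F \<in> full_chains i" "G \<in> full_chains i" "up i F = up i G"
  shows "F = G"
  using assms up'_up by metis

lemma chain_zero_full: "chain_zero B N A' n \<in> full_chains (deg n)"
  by (simp add: chain_zero_def A.chain_null_def[symmetric] A.zero_free_tensor)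

text \<open>Exactness is pulled back along \<open>up\<close>: a cycle over A' becomes a cycle over
  A, its primitive there is brought back by \<open>up'\<close>, and injectivity of \<open>up\<close>
  gives the required equation.\<close>

lemma koszul_algebra_transfer:
  assumes K: "koszul_algebra B N A"
  shows "koszul_algebra B N A'"
  unfolding koszul_algebra_def
proof (intro allI equalityI subsetI)
  fix n F
  assume "F \<in> {F \<in> chains' (Suc n). diff' n F = chain_zero B N A' n}"
  then have F: "F \<in> chains' (Suc n)" "diff' n F = chain_zero B N A' n" by auto
  have "diff n (up (deg (Suc n)) F) = chain_zero B N A n"
    using koszul_diff_up[OF F(1)] F(2) up_zero by simp
  then have "up (deg (Suc n)) F \<in> diff (Suc n) ` chains (Suc (Suc n))"
    using K[unfolded koszul_algebra_def, rule_format, of n] koszul_chains_up[OF F(1)] by auto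
  then obtain G where G: "G \<in> chains (Suc (Suc n))"
    "up (deg (Suc n)) F = diff (Suc n) G" by blast
  let ?G = "up' (deg (Suc (Suc n))) G"
  have G': "?G \<in> chains' (Suc (Suc n))" by (rule koszul_chains_up'[OF G(1)])
  have "up (deg (Suc (Suc n))) ?G = G"
    by (rule up_up') (use G(1) dual_chains_full in \<open>simp add: koszul_chains_eq\<close>)
  then have "up (deg (Suc n)) F = up (deg (Suc n)) (diff' (Suc n) ?G)"
    using koszul_diff_up[OF G'] G(2) by simp
  then have "F = diff' (Suc n) ?G"
    by (rule up_inj[rotated -1])
      (use F(1) dual_chains_full' koszul_diff'_full[OF G'] in \<open>auto simp: koszul_chains_eq'\<close>)
  then show "F \<in> diff' (Suc n) ` chains' (Suc (Suc n))"
    using G' by blast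
next
  fix n F
  assume "F \<in> diff' (Suc n) ` chains' (Suc (Suc n))"
  then obtain G where G: "G \<in> chains' (Suc (Suc n))" "F = diff' (Suc n) G"
    by blast
  \<comment> \<open>That a boundary over A' lies in the chains at all is also read off from A: its
    image is a boundary, hence by exactness a cycle among the chains, and \<open>up'\<close> returns
    it to \<open>chains'\<close>.\<close>
  have "up (deg (Suc n)) F \<in> diff (Suc n) ` chains (Suc (Suc n))"
    unfolding G(2) koszul_diff_up[OF G(1), symmetric] by (rule imageI[OF koszul_chains_up[OF G(1)]])
  then have H: "up (deg (Suc n)) F \<in> chains (Suc n)"
    "diff n (up (deg (Suc n)) F) = chain_zero B N A n"
    using K[unfolded koszul_algebra_def, rule_format, of n] by auto
  have F: "F \<in> full_chains (deg (Suc n))"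
    using koszul_diff'_full[OF G(1)] G(2) by simp
  then have F': "F \<in> chains' (Suc n)"
    using koszul_chains_up'[OF H(1)] up'_up by simp
  have "diff' n F = chain_zero B N A' n"
    by (rule up_inj[of _ "deg n"])
      (use koszul_diff'_full[OF F'] chain_zero_full H(2) koszul_diff_up[OF F'] up_zero in auto)
  with F' show "F \<in> {F \<in> chains' (Suc n). diff' n F = chain_zero B N A' n}"
    by simp
qed

lemma koszul_chains_trivial:
  assumes "chains n = {chain_zero B N A n}"
  shows "chains' n = {chain_zero B N A' n}"
proof -
  have "F = chain_zero B N A' n" if F: "F \<in> chains' n" for F
  proof (rule up_inj)
    show "F \<in> full_chains (deg n)"
      using F dual_chains_full' by (simp add: koszul_chains_eq')
    show "up (deg n) F = up (deg n) (chain_zero B N A' n)"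
      using koszul_chains_up[OF F] assms up_zero by simp
  qed (rule chain_zero_full)
  moreover have "chain_zero B N A' n \<in> chains' n"
    by (simp add: koszul_chains_eq' chain_zero_def A.chain_null_def[symmetric] A.zero_free_tensor)
  ultimately show ?thesis by blast
qed

lemma koszul_chains_trivial_iff:
  "chains' n = {chain_zero B N A' n} \<longleftrightarrow> chains n = {chain_zero B N A n}"
  using koszul_chains_trivial twisted_pair.koszul_chains_trivial[OF swap N] by blast

lemma has_global_dimension_transfer:
  "has_global_dimension B N A' D \<longleftrightarrow> has_global_dimension B N A D"
  by (simp add: has_global_dimension_def koszul_chains_trivial_iff)

subsection \<open>Comparison of the cochain complexes\<close>

abbreviation "dual n \<equiv> koszul_dual B N A (deg n)"
abbreviation "dual' n \<equiv> koszul_dual B N A' (deg n)"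
abbreviation "dual_group n \<equiv> A.chain_group (deg n) (dual n)"
abbreviation "dual_group' n \<equiv> A.chain_group (deg n) (dual' n)"
abbreviation "untwist \<equiv> twisted_pair.cochain_twist scale B A' A \<pi> b a \<alpha> N"
abbreviation "form n \<equiv> additive_map (dual_group n) A"
abbreviation "form' n \<equiv> additive_map (dual_group' n) A"
abbreviation "tw \<equiv> cochain_twist N"
abbreviation "cochains \<equiv> koszul_cochains B N A"
abbreviation "cochains' \<equiv> koszul_cochains B N A'"
abbreviation "cocycles \<equiv> koszul_cocycles B N A"
abbreviation "cocycles' \<equiv> koszul_cocycles B N A'"
abbreviation "coboundaries \<equiv> koszul_coboundaries B N A"
abbreviation "coboundaries' \<equiv> koszul_coboundaries B N A'"
abbreviation "codiff \<equiv> koszul_codiff B N A"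
abbreviation "null \<equiv> cochain_zero B N A"
abbreviation "codiff' \<equiv> koszul_codiff B N A'"
abbreviation "null' \<equiv> cochain_zero B N A'"

lemma down_dual_additive: "additive_map (dual_group' n) (dual_group n) (down (deg n))"
  by (rule A.graded_chain_map_additive[OF k_linear_funpow_b koszul_dual_subset' koszul_dual_down])

lemma cochain_iff:
  "f \<in> cochains n \<longleftrightarrow>
    f \<in> extensional (chains n) \<and> form n f \<and>
    (\<forall>x\<in>carrier A. \<forall>F\<in>chains n. f (chain_lmult B N A n x F) = x \<otimes> f F)"
proof -
  have "chain_add B N A n F G = A.chain_plus (deg n) F G" for F G
    by (simp add: chain_add_def A.chain_plus_def)
  then show ?thesis
    by (auto simp: koszul_cochains_def koszul_chains_eq additive_map_def A.add_chain_group PiE_iff)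
qed

lemma cochain_iff':
  "f \<in> cochains' n \<longleftrightarrow>
    f \<in> extensional (chains' n) \<and> form' n f \<and>
    (\<forall>x\<in>carrier A. \<forall>F\<in>chains' n. f (chain_lmult B N A' n x F) = x \<otimes>\<^bsub>A'\<^esub> f F)"
proof -
  have "additive_map (dual_group' n) A' f \<longleftrightarrow> form' n f"
    by (simp add: additive_map_def)
  then show ?thesis
    using twisted_pair.cochain_iff[OF swap N, of f n] by simp
qed

lemma twisted_summand_additive:
  assumes "form n f"
  shows "form' n (\<lambda>G. (a ^^ k) (f (down (deg n) G)))"
  by (rule additive_comp[OF additive_comp[OF down_dual_additive assms] A.k_linear_additive[OF k_linear_funpow_a]])

lemma cochain_twist_additive:
  assumes "form n f"
  shows "form' n (tw n f)"
proof -
  have "form' n (graded_sum (dual_group' n) (A.chain_proj (deg n)) A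
       (\<lambda>p G. (a ^^ (p + deg n)) (f (down (deg n) G))))"
    by (rule graded_group.graded_sum_additive[OF A.chain_graded A.abelian twisted_summand_additive[OF assms]])
  then show ?thesis
    using A.free_tensor_add
    by (auto simp: additive_map_def cochain_twist_def koszul_chains_eq' A.add_chain_group)
qed

lemma cochain_twist_hom_part:
  assumes "form n f" "G \<in> hom_part (dual_group' n) (A.chain_proj (deg n)) p"
  shows "tw n f G = (a ^^ (p + deg n)) (f (down (deg n) G))"
proof -
  have "G \<in> chains' n"
    using assms(2) by (simp add: hom_part_def koszul_chains_eq')
  then show ?thesis
    using graded_group.graded_sum_hom_part[OF A.chain_graded A.abelian twisted_summand_additive[OF assms(1)] assms(2)]
    by (simp add: cochain_twist_def)
qed

lemma down_elem:
  "x \<in> A.homog p \<Longrightarrow> t \<in> koszul_dual B N A' i \<Longrightarrow>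
    down i (A.elem i x t) = A.elem i ((b ^^ (p + i)) x) (A.multi_map (\<lambda>j. \<beta> ^^ (i - j)) t)"
  using koszul_dual_subset' by (intro A.graded_chain_map_elem k_linear_funpow_b) auto

lemma cochain_twist_elem:
  assumes "form n f" "x \<in> A.homog p" "t \<in> dual' n"
  shows "tw n f (A.elem (deg n) x t) = (a ^^ (p + deg n))
    (f (A.elem (deg n) ((b ^^ (p + deg n)) x) (A.multi_map (\<lambda>j. \<beta> ^^ (deg n - j)) t)))"
  using cochain_twist_hom_part[OF assms(1) A.elem_hom_part[OF assms(2,3)]] down_elem[OF assms(2,3)] by simp

lemma cochain_twist_extensional: "tw n f \<in> extensional (chains' n)"
  by (simp add: cochain_twist_def)

lemma cochain_eqI:
  assumes "f \<in> extensional (chains n)" "g \<in> extensional (chains n)"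
    and "form n f" "form n g"
    and "\<And>p x t. x \<in> A.homog p \<Longrightarrow> t \<in> dual n \<Longrightarrow>
      f (A.elem (deg n) x t) = g (A.elem (deg n) x t)"
  shows "f = g"
proof (rule extensionalityI[OF assms(1,2)])
  fix F assume "F \<in> chains n"
  then show "f F = g F"
    using A.additive_eqI[OF assms(3) assms(4) assms(5)] by (simp add: koszul_chains_eq)
qed

lemma cochain_eqI':
  assumes "f \<in> extensional (chains' n)" "g \<in> extensional (chains' n)"
    and "form' n f" "form' n g"
    and "\<And>p x t. x \<in> A.homog p \<Longrightarrow> t \<in> dual' n \<Longrightarrow>
      f (A.elem (deg n) x t) = g (A.elem (deg n) x t)"
  shows "f = g"
  by (rule twisted_pair.cochain_eqI[OF swap N])
    (use assms in \<open>auto simp: additive_map_def\<close>)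

lemma chain_lmult_elem:
  assumes "x \<in> carrier A" "y \<in> carrier A"
  shows "chain_lmult B N A n x (A.elem (deg n) y t) = A.elem (deg n) (x \<otimes> y) t"
  using assms by (intro A.words_ext[of "deg n"]) (auto simp: chain_lmult_def A.smult_mult_right)

lemma chain_lmult_elem':
  assumes "x \<in> carrier A" "y \<in> carrier A"
  shows "chain_lmult B N A' n x (A.elem (deg n) y t) = A.elem (deg n) (x \<otimes>\<^bsub>A'\<^esub> y) t"
  using twisted_pair.chain_lmult_elem[OF swap N, of x y n t] assms by simp

lemma chain_lmult_plus':
  assumes "x \<in> carrier A" "F \<in> chains' n" "G \<in> chains' n"
  shows "chain_lmult B N A' n x (A.chain_plus (deg n) F G) =
    A.chain_plus (deg n) (chain_lmult B N A' n x F) (chain_lmult B N A' n x G)"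
  using assms A.free_tensor_apply A'.mult_add_right
  by (intro A.words_ext[of "deg n"]) (auto simp: chain_lmult_def koszul_chains_eq')

lemma chain_lmult_closed':
  assumes x: "x \<in> carrier A" and F: "F \<in> chains' n"
  shows "chain_lmult B N A' n x F \<in> chains' n"
  using F unfolding koszul_chains_eq'
proof (induction rule: A.free_tensor_induct)
  case zero
  have "chain_lmult B N A' n x (A.chain_null (deg n)) = A.chain_null (deg n)"
    using additive_zero[OF A'.abelian A'.abelian A'.mult_left_additive, of x] x
    by (intro A.words_ext[of "deg n"]) (auto simp: chain_lmult_def)
  then show ?case using A.zero_free_tensor by simp
next
  case (add_elem F y t)
  have "chain_lmult B N A' n x (A.chain_plus (deg n) F (A.elem (deg n) y t)) =
    A.chain_plus (deg n) (chain_lmult B N A' n x F) (A.elem (deg n) (x \<otimes>\<^bsub>A'\<^esub> y) t)"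
    using add_elem chain_lmult_plus'[OF x, of F n "A.elem (deg n) y t"] A.elem_free_tensor chain_lmult_elem'[OF x]
    by (simp add: koszul_chains_eq')
  also have "\<dots> \<in> A.tens (deg n) (dual' n)"
    using add_elem A'.mult_closed[of x y] x by (intro A.free_tensor_add_elem) auto
  finally show ?case .
qed

text \<open>In \<open>down\<close> the maps on the tensor factors do not depend on the degree of the
  coefficient, so the same twisted tensor serves for y and for the product of x with y, and
  linearity of f extracts the coefficient that comes from x. Additivity reduces to homogeneous x and
  y.\<close>

lemma cochain_twist_lmult:
  assumes f: "f \<in> cochains n" and x: "x \<in> carrier A" and F: "F \<in> chains' n"
  shows "tw n f (chain_lmult B N A' n x F) = x \<otimes>\<^bsub>A'\<^esub> tw n f F"
proof (rule A.additive_eqI[where f = "\<lambda>F. tw n f (chain_lmult B N A' n x F)"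
      and g = "\<lambda>F. x \<otimes>\<^bsub>A'\<^esub> tw n f F"])
  have add: "form n f" using f by (simp add: cochain_iff)
  note ct_add = cochain_twist_additive[OF add]
  have lmult: "additive_map (dual_group' n) (dual_group' n) (chain_lmult B N A' n x)"
    using chain_lmult_closed'[OF x, of _ n] chain_lmult_plus'[OF x, of _ n]
    by (intro additiveI) (auto simp: koszul_chains_eq' A.add_chain_group)
  show "form' n (\<lambda>F. tw n f (chain_lmult B N A' n x F))"
    by (rule additive_comp[OF lmult ct_add])
  have mult: "additive_map A A (\<lambda>y. x \<otimes>\<^bsub>A'\<^esub> y)"
    using A'.mult_left_additive x same_additive by simp
  show "form' n (\<lambda>F. x \<otimes>\<^bsub>A'\<^esub> tw n f F)"
    by (rule additive_comp[OF ct_add mult])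
  fix p y t assume y: "y \<in> A.homog p" and t: "t \<in> dual' n"
  have cy: "y \<in> carrier A" by (rule A.hom_part_closed[OF y])
  let ?E = "\<lambda>z. A.elem (deg n) z t"
  let ?t = "A.multi_map (\<lambda>j. \<beta> ^^ (deg n - j)) t"
  have t': "?t \<in> dual n" by (rule koszul_dual_down[OF t])
  have ct_closed: "tw n f (?E z) \<in> carrier A" if "z \<in> carrier A" for z
    using additive_closed[OF ct_add] A.elem_free_tensor[OF that t] by simp
  have elem_add: "additive_map A (dual_group' n) ?E" by (rule A.elem_additive[OF t])
  have right: "additive_map A A (\<lambda>x. x \<otimes>\<^bsub>A'\<^esub> z)" if "z \<in> carrier A" for z
    using A'.mult_right_additive[of z] that same_additive by simp
  have "tw n f (?E (x \<otimes>\<^bsub>A'\<^esub> y)) = x \<otimes>\<^bsub>A'\<^esub> tw n f (?E y)"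
    using x
  proof (induction rule: A.hom_part_induct)
    case (hom q x)
    have cx: "x \<in> carrier A" by (rule A.hom_part_closed[OF hom])
    let ?k = "q + p + deg n"
    have xy: "x \<otimes>\<^bsub>A'\<^esub> y \<in> A.homog (q + p)"
      using A'.hom_part_mult[of x q y p] hom y by simp
    have k: "?k = q + (p + deg n)" by simp
    \<comment> \<open>The product of A' puts q powers of \<alpha> on y; they cancel q of the inverse
      powers, leaving y with the exponent of its own total degree.\<close>
    have bxy: "(b ^^ ?k) (x \<otimes>\<^bsub>A'\<^esub> y) = (b ^^ ?k) x \<otimes> (b ^^ (p + deg n)) y"
      using cx cy twist[OF hom cy] funpow_b_a_add[OF cy, of "p + deg n" q]
      by (simp add: funpow_b_mult ac_simps)
    have fE: "f (A.elem (deg n) ((b ^^ (p + deg n)) y) ?t) \<in> carrier A"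
      using additive_closed[OF add] A.elem_free_tensor[OF _ t'] cy by simp
    have "tw n f (?E (x \<otimes>\<^bsub>A'\<^esub> y)) =
      (a ^^ ?k) (f (A.elem (deg n) ((b ^^ ?k) x \<otimes> (b ^^ (p + deg n)) y) ?t))"
      unfolding cochain_twist_elem[OF add xy t] bxy ..
    also have "f (A.elem (deg n) ((b ^^ ?k) x \<otimes> (b ^^ (p + deg n)) y) ?t) =
      (b ^^ ?k) x \<otimes> f (A.elem (deg n) ((b ^^ (p + deg n)) y) ?t)"
      using f cx cy t' chain_lmult_elem[of "(b ^^ ?k) x" "(b ^^ (p + deg n)) y" n ?t]
        A.elem_free_tensor[of "(b ^^ (p + deg n)) y" ?t]
      by (simp add: cochain_iff koszul_chains_eq) (metis funpow_b_closed)
    \<comment> \<open>On x all powers cancel. On the value of f the exponent splits as q + (p + deg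
      n): the second part makes it a value of the twisted cochain, and the surplus q is the twist
      that A' applies to what x is multiplied with.\<close>
    also have "(a ^^ ?k) \<dots> = x \<otimes> (a ^^ q) ((a ^^ (p + deg n)) (f (A.elem (deg n) ((b ^^ (p + deg n)) y) ?t)))"
      using cx fE by (simp add: funpow_a_mult funpow_a_b) (simp add: k funpow_add)
    also have "\<dots> = x \<otimes>\<^bsub>A'\<^esub> tw n f (?E y)"
      using twist[OF hom] fE by (simp add: cochain_twist_elem[OF add y t])
    finally show "tw n f (?E (x \<otimes>\<^bsub>A'\<^esub> y)) = x \<otimes>\<^bsub>A'\<^esub> tw n f (?E y)" .
  next
    case (add x z)
    note R = additive_add[OF additive_comp[OF right[OF cy] additive_comp[OF elem_add ct_add]], of x z]
      additive_add[OF right[OF ct_closed[OF cy]], of x z]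
    show "tw n f (?E ((x \<oplus> z) \<otimes>\<^bsub>A'\<^esub> y)) = (x \<oplus> z) \<otimes>\<^bsub>A'\<^esub> tw n f (?E y)"
      using R add by simp
  qed
  then show "tw n f (chain_lmult B N A' n x (?E y)) = x \<otimes>\<^bsub>A'\<^esub> tw n f (?E y)"
    by (simp add: chain_lmult_elem'[OF x cy])
qed (use F in \<open>simp add: koszul_chains_eq'\<close>)

lemma cochain_twist_cochain:
  "f \<in> cochains n \<Longrightarrow> tw n f \<in> cochains' n"
  using cochain_twist_lmult cochain_twist_additive[of n f]
  by (simp add: cochain_iff' cochain_iff[of f] cochain_twist_extensional)

lemma untwist_cochain:
  "f \<in> cochains' n \<Longrightarrow> untwist n f \<in> cochains n"
  by (rule twisted_pair.cochain_twist_cochain[OF swap N])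

lemma untwist_elem:
  assumes "form' n f" "x \<in> A.homog p" "t \<in> dual n"
  shows "untwist n f (A.elem (deg n) x t) = (b ^^ (p + deg n))
    (f (A.elem (deg n) ((a ^^ (p + deg n)) x) (A.multi_map (\<lambda>j. \<alpha> ^^ (deg n - j)) t)))"
  using twisted_pair.cochain_twist_elem[OF swap N, of n f x p t] assms
  by (simp add: additive_map_def)

lemma koszul_dual_down': "t \<in> koszul_dual B N A i \<Longrightarrow> A.multi_map (\<lambda>j. \<alpha> ^^ (i - j)) t \<in> koszul_dual B N A' i"
  by (rule twisted_pair.koszul_dual_down[OF swap])

text \<open>All maps on the argument preserve the coefficient degree p, so both twists use the same
  exponent p + deg n and cancel on the value of f, on the coefficient and on each tensor
  factor.\<close>

lemma untwist_cochain_twist: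
  assumes f: "f \<in> cochains n"
  shows "untwist n (tw n f) = f"
proof (rule cochain_eqI)
  have add: "form n f" using f by (simp add: cochain_iff)
  note ct_add = cochain_twist_additive[OF add]
  have "untwist n (tw n f) \<in> cochains n"
    by (intro untwist_cochain cochain_twist_cochain f)
  then show "untwist n (tw n f) \<in> extensional (chains n)"
    "form n (untwist n (tw n f))"
    by (simp_all add: cochain_iff)
  show "f \<in> extensional (chains n)" "form n f"
    using f by (simp_all add: cochain_iff)
  fix p x t assume x: "x \<in> A.homog p" and t: "t \<in> dual n"
  have cx: "x \<in> carrier A" by (rule A.hom_part_closed[OF x])
  have ax: "(a ^^ (p + deg n)) x \<in> A.homog p"
    by (rule A.k_linear_hom_part[OF k_linear_funpow_a x])
  have tp: "t \<in> A.E (deg n)" using t koszul_dual_subset by blast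
  have "A.multi_map (\<lambda>j. \<beta> ^^ (deg n - j)) (A.multi_map (\<lambda>j. \<alpha> ^^ (deg n - j)) t) =
    A.multi_map (\<lambda>j. \<beta> ^^ (deg n - j) \<circ> \<alpha> ^^ (deg n - j)) t"
    by (rule A.multi_map_comp[OF tp]) (intro lin_funpow \<alpha>_linear \<beta>_linear)+
  also have "\<dots> = t"
    by (rule A.multi_map_id[OF tp]) (simp add: funpow_\<beta>_\<alpha>)
  finally have tt: "A.multi_map (\<lambda>j. \<beta> ^^ (deg n - j)) (A.multi_map (\<lambda>j. \<alpha> ^^ (deg n - j)) t) = t" .
  have "f (A.elem (deg n) x t) \<in> carrier A"
    using additive_closed[OF add] A.elem_free_tensor[OF cx t] by simp
  then show "untwist n (tw n f) (A.elem (deg n) x t) = f (A.elem (deg n) x t)"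
    using cx by (simp add: untwist_elem[OF ct_add x t] cochain_twist_elem[OF add ax koszul_dual_down'[OF t]]
        tt funpow_b_a)
qed

lemma cochain_twist_untwist:
  "f \<in> cochains' n \<Longrightarrow> tw n (untwist n f) = f"
  by (rule twisted_pair.untwist_cochain_twist[OF swap N])

lemma cochain_twist_zero: "tw n (null n) = null' n"
proof (rule cochain_eqI')
  have z: "form n (null n)"
    using A.free_tensor_add by (auto simp: additive_map_def cochain_zero_def koszul_chains_eq A.add_chain_group)
  show "form' n (tw n (null n))"
    by (rule cochain_twist_additive[OF z])
  show "form' n (null' n)"
    using A.free_tensor_add by (auto simp: additive_map_def cochain_zero_def koszul_chains_eq' A.add_chain_group)
  fix p x t assume x: "x \<in> A.homog p" and t: "t \<in> dual' n"
  have "(a ^^ k) \<zero> = \<zero>" for k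
    by (rule additive_zero[OF A.abelian A.abelian A.k_linear_additive[OF k_linear_funpow_a]])
  then show "tw n (null n) (A.elem (deg n) x t) =
    null' n (A.elem (deg n) x t)"
    unfolding cochain_twist_elem[OF z x t] using A.hom_part_closed[OF x] t koszul_dual_down[OF t]
    by (simp add: cochain_zero_def koszul_chains_eq koszul_chains_eq' A.elem_free_tensor)
qed (auto simp: cochain_twist_extensional cochain_zero_def)

text \<open>Read off from exactness: for n > 0 the image of the differential equals a set of cycles,
  which consists of chains by definition. In degree 0 the chains are all of A \<otimes> E^0.\<close>

lemma koszul_diff_closed:
  assumes K: "koszul_algebra B N A" and F: "F \<in> chains (Suc n)"
  shows "diff n F \<in> chains n"
proof (cases n)
  case 0
  have "chains 0 = full_chains 0"
    using N by (simp add: koszul_chains_eq koszul_degree_def koszul_dual_def)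
  then show ?thesis
    using additive_closed[OF koszul_diff_additive_full[of 0], of F] F dual_chains_full 0
    by (simp add: koszul_chains_eq koszul_degree_def)
next
  case (Suc k)
  then show ?thesis
    using K[unfolded koszul_algebra_def, rule_format, of k] F by auto
qed

lemma koszul_diff_additive:
  assumes K: "koszul_algebra B N A"
  shows "additive_map (dual_group (Suc n)) (dual_group n) (diff n)"
proof (rule additiveI)
  fix F G assume "F \<in> carrier (dual_group (Suc n))" "G \<in> carrier (dual_group (Suc n))"
  then show "diff n (F \<oplus>\<^bsub>dual_group (Suc n)\<^esub> G) =
    diff n F \<oplus>\<^bsub>dual_group n\<^esub> diff n G"
    using additive_add[OF koszul_diff_additive_full[of n], of F G] dual_chains_full
    by (simp add: A.add_chain_group)
qed (use koszul_diff_closed[OF K] in \<open>simp add: koszul_chains_eq\<close>)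

lemma codiff_additive:
  assumes K: "koszul_algebra B N A" and f: "form n f"
  shows "form (Suc n) (codiff n f)"
  using additive_comp[OF koszul_diff_additive[OF K] f] A.free_tensor_add
  by (auto simp: koszul_codiff_def additive_map_def koszul_chains_eq A.add_chain_group)

lemma codiff_additive':
  assumes K: "koszul_algebra B N A'" and f: "form' n f"
  shows "form' (Suc n) (codiff' n f)"
  using twisted_pair.codiff_additive[OF swap N K, of n f] f by (simp add: additive_map_def)

text \<open>Both sides evaluate f on the same twisted chain, since \<open>down\<close> commutes with
  the differentials. The outer powers of \<alpha> agree because the differential preserves total
  degree.\<close>

lemma cochain_twist_codiff:
  assumes K: "koszul_algebra B N A" and f: "form n f"
  shows "tw (Suc n) (codiff n f) = codiff' n (tw n f)"
proof (rule cochain_eqI')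
  have K': "koszul_algebra B N A'" by (rule koszul_algebra_transfer[OF K])
  note cf = codiff_additive[OF K f]
  show "form' (Suc n) (tw (Suc n) (codiff n f))"
    by (rule cochain_twist_additive[OF cf])
  show "form' (Suc n) (codiff' n (tw n f))"
    by (rule codiff_additive'[OF K' cochain_twist_additive[OF f]])
  fix p x t assume x: "x \<in> A.homog p" and t: "t \<in> dual' (Suc n)"
  let ?E = "A.elem (deg (Suc n)) x t"
  have E: "?E \<in> hom_part (dual_group' (Suc n)) (A.chain_proj (deg (Suc n))) p"
    by (rule A.elem_hom_part[OF x t])
  have EC: "?E \<in> chains' (Suc n)"
    using A.elem_free_tensor[OF A.hom_part_closed[OF x] t] by (simp add: koszul_chains_eq')
  have dE: "diff' n ?E \<in> chains' n"
    by (rule twisted_pair.koszul_diff_closed[OF swap N K' EC])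
  have "?E \<in> hom_part (A'.full (deg n + step N n)) (A.chain_proj (deg n + step N n)) p"
    using A.elem_hom_part[OF x, of t "A.E (deg (Suc n))" "deg (Suc n)"] t koszul_dual_subset'
    by (auto simp: degree_Suc)
  then have "diff' n ?E \<in> hom_part (A.full (deg n)) (A.chain_proj (deg n)) (p + step N n)"
    using A'.koszul_d_power_hom_part[of ?E "deg n" "step N n" p] by (simp add: koszul_diff_eq)
  \<comment> \<open>Homogeneity was obtained in the full tensor space; membership in the dual
    chains, where the twisted cochain is evaluated, comes from exactness over A'.\<close>
  then have dE': "diff' n ?E \<in> hom_part (dual_group' n) (A.chain_proj (deg n)) (p + step N n)"
    using dE by (simp add: hom_part_def koszul_chains_eq')
  have down: "down (deg (Suc n)) ?E \<in> chains (Suc n)"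
    using EC down_closed by (simp add: koszul_chains_eq koszul_chains_eq')
  have "tw (Suc n) (codiff n f) ?E =
    (a ^^ (p + deg (Suc n))) (f (diff n (down (deg (Suc n)) ?E)))"
    using cochain_twist_hom_part[OF cf E] down by (simp add: koszul_codiff_def)
  also have "\<dots> = (a ^^ (p + step N n + deg n)) (f (down (deg n) (diff' n ?E)))"
    unfolding koszul_diff_down[OF EC] by (simp add: degree_Suc ac_simps)
  also have "\<dots> = tw n f (diff' n ?E)"
    by (rule cochain_twist_hom_part[OF f dE', symmetric])
  finally show "tw (Suc n) (codiff n f) ?E =
    codiff' n (tw n f) ?E"
    using EC by (simp add: koszul_codiff_def)
qed (auto simp: cochain_twist_extensional koszul_codiff_def)

lemma cochain_twist_cocycle:
  assumes K: "koszul_algebra B N A" and f: "f \<in> cocycles n"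
  shows "tw n f \<in> cocycles' n"
proof -
  have "f \<in> cochains n" "codiff n f = null (Suc n)"
    using f by (auto simp: koszul_cocycles_def)
  moreover have "form n f" using calculation(1) by (simp add: cochain_iff)
  ultimately show ?thesis
    using cochain_twist_codiff[OF K, of n f] cochain_twist_zero[of "Suc n"]
    by (simp add: koszul_cocycles_def cochain_twist_cochain)
qed

lemma cochain_twist_coboundary:
  assumes K: "koszul_algebra B N A" and f: "f \<in> coboundaries n"
  shows "tw n f \<in> coboundaries' n"
proof (cases n)
  case 0
  then show ?thesis using f cochain_twist_zero[of 0] by (simp add: koszul_coboundaries_def)
next
  case (Suc m)
  then obtain g where g: "g \<in> cochains m" "f = codiff m g"
    using f by (auto simp: koszul_coboundaries_def)
  then have "tw n f = codiff' m (tw m g)"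
    using cochain_twist_codiff[OF K, of m g] Suc by (simp add: cochain_iff)
  then show ?thesis
    using cochain_twist_cochain[OF g(1)] Suc by (auto simp: koszul_coboundaries_def)
qed

section \<open>Transfer of the cohomology of the dual complex\<close>

context
  assumes K: "koszul_algebra B N A"
begin

lemma K': "koszul_algebra B N A'"
  by (rule koszul_algebra_transfer[OF K])

lemma untwist_cocycle: "f \<in> cocycles' n \<Longrightarrow> untwist n f \<in> cocycles n"
  by (rule twisted_pair.cochain_twist_cocycle[OF swap N K'])

lemma untwist_coboundary: "f \<in> coboundaries' n \<Longrightarrow> untwist n f \<in> coboundaries n"
  by (rule twisted_pair.cochain_twist_coboundary[OF swap N K'])

lemma cocycle_cochain: "f \<in> koszul_cocycles B N X n \<Longrightarrow> f \<in> koszul_cochains B N X n"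
  by (simp add: koszul_cocycles_def)

text \<open>The inverse law for the twists is available for cochains; for a coboundary in positive
  degree it is applied to a primitive g, and both twists commute with the codifferential.\<close>

lemma coboundary_cochain_twist_untwist:
  assumes "f \<in> coboundaries' n"
  shows "tw n (untwist n f) = f"
proof (cases n)
  case 0
  then have "f = null' 0" using assms by (simp add: koszul_coboundaries_def)
  then show ?thesis
    using twisted_pair.cochain_twist_zero[OF swap N, of 0] cochain_twist_zero[of 0] 0 by simp
next
  case (Suc m)
  then obtain g where g: "g \<in> cochains' m" "f = codiff' m g"
    using assms by (auto simp: koszul_coboundaries_def)
  have ga: "additive_map (dual_group' m) A g" using g(1) by (simp add: cochain_iff')
  have "untwist n f = codiff m (untwist m g)"
    using twisted_pair.cochain_twist_codiff[OF swap N K', of m g] ga Suc g(2)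
    by (simp add: additive_map_def)
  moreover have "additive_map (dual_group m) A (untwist m g)"
    using untwist_cochain[OF g(1)] by (simp add: cochain_iff)
  ultimately show ?thesis
    using cochain_twist_codiff[OF K, of m "untwist m g"] cochain_twist_untwist[OF g(1)] Suc g(2) by simp
qed

lemma cohomology_vanishes_transfer:
  assumes "cohomology_vanishes B N A n"
  shows "cohomology_vanishes B N A' n"
  unfolding cohomology_vanishes_def
proof (intro equalityI subsetI)
  have eq: "cocycles n = coboundaries n"
    using assms by (simp add: cohomology_vanishes_def)
  show "f \<in> coboundaries' n" if f: "f \<in> cocycles' n" for f
    using cochain_twist_coboundary[OF K, of "untwist n f" n] untwist_cocycle[OF f] eq
      cochain_twist_untwist[OF cocycle_cochain[OF f]] by simp
  show "f \<in> cocycles' n" if f: "f \<in> coboundaries' n" for f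
    using cochain_twist_cocycle[OF K, of "untwist n f" n] untwist_coboundary[OF f] eq
      coboundary_cochain_twist_untwist[OF f] by simp
qed

lemma additive_pointwise:
  assumes "form' n f" "form' n g"
  shows "form' n (\<lambda>F\<in>chains' n. f F \<oplus> g F)"
  using assms A.free_tensor_add
  by (auto simp: additive_map_def koszul_chains_eq' A.add_chain_group A.a_ac)

lemma smult_pointwise:
  assumes "form' n f"
  shows "form' n (\<lambda>F\<in>chains' n. c \<odot> f F)"
  using assms A.free_tensor_add
  by (auto simp: additive_map_def koszul_chains_eq' A.add_chain_group A.smult_add_right)

lemma untwist_additive_map:
  "form' n f \<Longrightarrow> form n (untwist n f)"
  using twisted_pair.cochain_twist_additive[OF swap N, of n f] by (simp add: additive_map_def)

lemma untwist_extensional: "untwist n f \<in> extensional (chains n)"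
  by (rule twisted_pair.cochain_twist_extensional[OF swap N])

lemma untwist_arg:
  assumes "x \<in> A.homog p" "t \<in> dual n"
  shows "A.elem (deg n) ((a ^^ (p + deg n)) x) (A.multi_map (\<lambda>j. \<alpha> ^^ (deg n - j)) t) \<in> chains' n"
  using A.elem_free_tensor[OF _ koszul_dual_down'[OF assms(2)]] A.hom_part_closed[OF assms(1)]
  by (simp add: koszul_chains_eq')

text \<open>Serves to pull a linear form on cocycles back along \<open>untwist\<close>: the outer
  powers of the inverse automorphism are additive on values, and the twist of the argument does not
  involve the cochain.\<close>

lemma untwist_plus:
  assumes f: "form' n f" and g: "form' n g"
  shows "untwist n (\<lambda>F\<in>chains' n. f F \<oplus> g F) =
    (\<lambda>F\<in>chains n. untwist n f F \<oplus> untwist n g F)"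
proof (rule cochain_eqI)
  note fg = additive_pointwise[OF f g]
  show "form n (untwist n (\<lambda>F\<in>chains' n. f F \<oplus> g F))"
    by (rule untwist_additive_map[OF fg])
  show "form n (\<lambda>F\<in>chains n. untwist n f F \<oplus> untwist n g F)"
    using untwist_additive_map[OF f] untwist_additive_map[OF g] A.free_tensor_add
    by (auto simp: additive_map_def koszul_chains_eq A.add_chain_group A.a_ac)
  fix p x t assume x: "x \<in> A.homog p" and t: "t \<in> dual n"
  have E: "A.elem (deg n) x t \<in> chains n"
    using A.elem_free_tensor[OF A.hom_part_closed[OF x] t] by (simp add: koszul_chains_eq)
  note G = untwist_arg[OF x t]
  show "untwist n (\<lambda>F\<in>chains' n. f F \<oplus> g F) (A.elem (deg n) x t) =
    (\<lambda>F\<in>chains n. untwist n f F \<oplus> untwist n g F) (A.elem (deg n) x t)"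
    unfolding untwist_elem[OF fg x t] using E G additive_closed[OF f] additive_closed[OF g]
      additive_add[OF A.k_linear_additive[OF k_linear_funpow_b]]
    by (simp add: untwist_elem[OF f x t] untwist_elem[OF g x t])
      (simp add: koszul_chains_eq')
qed (auto simp: untwist_extensional)

lemma untwist_smult:
  assumes f: "form' n f"
  shows "untwist n (\<lambda>F\<in>chains' n. c \<odot> f F) = (\<lambda>F\<in>chains n. c \<odot> untwist n f F)"
proof (rule cochain_eqI)
  note cf = smult_pointwise[OF f]
  show "form n (untwist n (\<lambda>F\<in>chains' n. c \<odot> f F))"
    by (rule untwist_additive_map[OF cf])
  show "form n (\<lambda>F\<in>chains n. c \<odot> untwist n f F)"
    using untwist_additive_map[OF f] A.free_tensor_add
    by (auto simp: additive_map_def koszul_chains_eq A.add_chain_group A.smult_add_right)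
  fix p x t assume x: "x \<in> A.homog p" and t: "t \<in> dual n"
  have E: "A.elem (deg n) x t \<in> chains n"
    using A.elem_free_tensor[OF A.hom_part_closed[OF x] t] by (simp add: koszul_chains_eq)
  note G = untwist_arg[OF x t]
  show "untwist n (\<lambda>F\<in>chains' n. c \<odot> f F) (A.elem (deg n) x t) =
    (\<lambda>F\<in>chains n. c \<odot> untwist n f F) (A.elem (deg n) x t)"
    unfolding untwist_elem[OF cf x t] using E G additive_closed[OF f] A.k_linear_smult[OF k_linear_funpow_b]
    by (simp add: untwist_elem[OF f x t]) (simp add: koszul_chains_eq')
qed (auto simp: untwist_extensional)

text \<open>The linear form for A' is the one for A composed with \<open>untwist\<close>, which maps
  cocycles bijectively to cocycles and coboundaries to coboundaries.\<close>

lemma cohomology_one_dimensional_transfer: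
  assumes "cohomology_one_dimensional B N A n"
  shows "cohomology_one_dimensional B N A' n"
proof -
  obtain \<phi> :: "(('e list \<Rightarrow> 'a) \<Rightarrow> 'a) \<Rightarrow> 'k" where
    add: "\<And>f g. f \<in> cocycles n \<Longrightarrow> g \<in> cocycles n \<Longrightarrow>
      \<phi> (\<lambda>F\<in>chains n. f F \<oplus> g F) = \<phi> f + \<phi> g"
    and smult: "\<And>c f. f \<in> cocycles n \<Longrightarrow>
      \<phi> (\<lambda>F\<in>chains n. c \<odot> f F) = c * \<phi> f"
    and surj: "\<phi> ` cocycles n = UNIV"
    and ker: "{f \<in> cocycles n. \<phi> f = 0} = coboundaries n"
    using assms unfolding cohomology_one_dimensional_def by blast
  let ?\<phi> = "\<lambda>f. \<phi> (untwist n f)"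
  have cocycle_additive: "form' n f" if "f \<in> cocycles' n" for f
    using cocycle_cochain[OF that] by (simp add: cochain_iff')
  show ?thesis
    unfolding cohomology_one_dimensional_def
  proof (intro exI[of _ ?\<phi>] conjI ballI allI)
    fix f g assume fg: "f \<in> cocycles' n" "g \<in> cocycles' n"
    show "?\<phi> (\<lambda>F\<in>chains' n. f F \<oplus>\<^bsub>A'\<^esub> g F) = ?\<phi> f + ?\<phi> g"
      using untwist_plus[OF cocycle_additive[OF fg(1)] cocycle_additive[OF fg(2)]]
        add[OF untwist_cocycle[OF fg(1)] untwist_cocycle[OF fg(2)]] by simp
  next
    fix c f assume f: "f \<in> cocycles' n"
    show "?\<phi> (\<lambda>F\<in>chains' n. c \<odot>\<^bsub>A'\<^esub> f F) = c * ?\<phi> f"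
      using untwist_smult[OF cocycle_additive[OF f]] smult[OF untwist_cocycle[OF f]] by simp
  next
    show "?\<phi> ` cocycles' n = UNIV"
    proof -
      have "c \<in> ?\<phi> ` cocycles' n" for c
      proof -
        obtain f where f: "f \<in> cocycles n" "\<phi> f = c" using surj by (metis UNIV_I imageE)
        then show ?thesis
          using untwist_cochain_twist[OF cocycle_cochain[OF f(1)]] cochain_twist_cocycle[OF K f(1)]
          by (intro image_eqI[of _ _ "tw n f"]) auto
      qed
      then show ?thesis by blast
    qed
  next
    show "{f \<in> cocycles' n. ?\<phi> f = 0} = coboundaries' n"
    proof (intro equalityI subsetI)
      fix f assume "f \<in> {f \<in> cocycles' n. ?\<phi> f = 0}"
      then have f: "f \<in> cocycles' n" "?\<phi> f = 0" by auto
      then have "untwist n f \<in> coboundaries n"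
        using ker untwist_cocycle[OF f(1)] by blast
      then show "f \<in> coboundaries' n"
        using cochain_twist_coboundary[OF K] cochain_twist_untwist[OF cocycle_cochain[OF f(1)]] by metis
    next
      fix f assume f: "f \<in> coboundaries' n"
      have bf: "untwist n f \<in> cocycles n" "\<phi> (untwist n f) = 0"
        using ker untwist_coboundary[OF f] by blast+
      then show "f \<in> {f \<in> cocycles' n. ?\<phi> f = 0}"
        using cochain_twist_cocycle[OF K bf(1)] coboundary_cochain_twist_untwist[OF f] by simp
    qed
  qed
qed

end

lemma gorenstein_algebra_transfer:
  assumes "gorenstein_algebra B N A"
  shows "gorenstein_algebra B N A'"
proof -
  have K: "koszul_algebra B N A" using assms by (simp add: gorenstein_algebra_def)
  then show ?thesis
    using assms cohomology_vanishes_transfer[OF K] cohomology_one_dimensional_transfer[OF K]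
    by (auto simp: gorenstein_algebra_def koszul_algebra_transfer has_global_dimension_transfer)
qed

theorem gorenstein_algebra_twist: "gorenstein_algebra B N A \<longleftrightarrow> gorenstein_algebra B N A'"
  using gorenstein_algebra_transfer twisted_pair.gorenstein_algebra_transfer[OF swap N] by blast

end

end

section \<open>The semi-cross product as a twist\<close>

lemma abelian_group_cong:
  fixes A A' :: "('a, 'm) ring_scheme"
  assumes "add_monoid A' = add_monoid A" "abelian_group A"
  shows "abelian_group A'"
  using assms by (simp add: abelian_group_def abelian_monoid_def abelian_group_axioms_def)

context graded_kalgebra
begin

text \<open>Justifies the definite description: projecting any finite decomposition into homogeneous
  elements to degree m leaves only its m-th term.\<close>

lemma hparts_eq:
  assumes comp: "\<And>n. comp A n = homog n" and x: "x \<in> carrier A"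
  shows "hparts A x = (\<lambda>n. \<pi> n x)"
proof -
  obtain M where M: "\<forall>n\<ge>M. \<pi> n x = \<zero>" "x = (\<Oplus>n\<in>{..<M}. \<pi> n x)"
    using proj_bound[OF x] by auto
  have sub: "{n. \<pi> n x \<noteq> \<zero>} \<subseteq> {..<M}" using M(1) by (auto simp: not_less[symmetric])
  have "x = (\<Oplus>n\<in>{n. \<pi> n x \<noteq> \<zero>}. \<pi> n x)"
    using M(2) sub x by (subst add.finprod_mono_neutral_cong_left[of "{..<M}"]) auto
  moreover have "p = (\<lambda>n. \<pi> n x)"
    if p: "\<forall>n. p n \<in> comp A n" "finite {n. p n \<noteq> \<zero>}" "x = (\<Oplus>n\<in>{n. p n \<noteq> \<zero>}. p n)" for p
  proof
    fix m
    have c: "p n \<in> carrier A" for n using p(1) comp hom_part_closed by blast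
    have pj: "\<pi> m (p n) = (if m = n then p n else \<zero>)" for n
      using p(1) comp hom_part_proj[of "p n" n m] by simp
    have "\<pi> m x = (\<Oplus>n\<in>{n. p n \<noteq> \<zero>}. \<pi> m (p n))"
      by (subst p(3), rule additive_finsum[OF abelian abelian proj_additive p(2)]) (rule c)
    also have "\<dots> = (\<Oplus>n\<in>{n. p n \<noteq> \<zero>}. if n = m then p m else \<zero>)"
      using c by (intro finsum_cong') (auto simp: pj)
    also have "\<dots> = p m"
    proof (cases "p m = \<zero>")
      case True
      then show ?thesis by (auto intro!: add.finprod_one_eqI)
    next
      case False
      then show ?thesis using p(2) c by (intro finsum_unique_term[where p = m]) auto
    qed
    finally show "p m = \<pi> m x" by simp
  qed
  ultimately show ?thesis
    unfolding hparts_def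
    using x comp proj_hom_part finite_subset[OF sub] by (intro the_equality) auto
qed

text \<open>As a graded sum in its left argument, the product inherits additivity and its formula
  for homogeneous left factors from the general theory.\<close>

lemma semi_cross_mult:
  assumes comp: "\<And>n. comp A n = homog n" and x: "x \<in> carrier A"
  shows "x \<otimes>\<^bsub>semi_cross A a\<^esub> y = graded_sum A \<pi> A (\<lambda>n z. z \<otimes> (a ^^ n) y) x"
  using hparts_eq[OF comp x] by (simp add: semi_cross_def graded_sum_def)

text \<open>The laws for the new product are reduced to homogeneous left factors, where it is x
  \<otimes> a^p(y) with a^p linear and degree-preserving, and are extended by additivity on the
  left.\<close>

theorem semi_cross_twisted_pair:
  assumes comp: "\<And>n. comp A n = homog n"
    and a: "k_linear a" and b: "k_linear b"
    and ab: "\<And>x. x \<in> carrier A \<Longrightarrow> a (b x) = x" "\<And>x. x \<in> carrier A \<Longrightarrow> b (a x) = x"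
    and a_mult: "\<And>x y. x \<in> carrier A \<Longrightarrow> y \<in> carrier A \<Longrightarrow> a (x \<otimes> y) = a x \<otimes> a y"
    and a_one: "a \<one> = \<one>" and a_gen: "\<And>e. a (gen A e) = gen A (\<alpha> e)"
    and \<alpha>: "lin \<alpha>" and \<beta>: "lin \<beta>" and \<alpha>_\<beta>: "\<And>e. \<alpha> (\<beta> e) = e" "\<And>e. \<beta> (\<alpha> e) = e"
  shows "twisted_pair scale B A (semi_cross A a) \<pi> a b \<alpha> \<beta>"
proof -
  let ?A = "semi_cross A a"
  have eq: "?A = A\<lparr>monoid.mult := monoid.mult ?A\<rparr>" by (simp add: semi_cross_def)
  have same: "carrier ?A = carrier A" "\<one>\<^bsub>?A\<^esub> = \<one>" "\<zero>\<^bsub>?A\<^esub> = \<zero>" "x \<oplus>\<^bsub>?A\<^esub> y = x \<oplus> y"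
    "c \<odot>\<^bsub>?A\<^esub> x = c \<odot> x" "gen ?A e = gen A e" for x y c e
    by (subst eq, simp)+
  have "ring.add ?A = ring.add A" by (subst eq) simp
  then have addm: "add_monoid ?A = add_monoid A" by (simp add: same)
  then have sum: "finsum ?A f S = finsum A f S" for f and S :: "nat set"
    unfolding finsum_def by simp
  have hom: "hom_part ?A \<pi> p = homog p" for p by (simp add: hom_part_def same)
  have addmap: "additive_map ?A ?A f \<longleftrightarrow> additive_map A A f" for f by (simp add: additive_map_def same)
  have an: "k_linear (a ^^ n)" for n by (rule k_linear_funpow[OF a])
  have an_closed: "(a ^^ n) y \<in> carrier A" if "y \<in> carrier A" for n y by (rule k_linear_closed[OF an that])
  have right: "additive_map A A (\<lambda>z. z \<otimes> (a ^^ n) y)" if "y \<in> carrier A" for n y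
    by (rule mult_right_additive[OF an_closed[OF that]])
  let ?m = "\<lambda>x y. x \<otimes>\<^bsub>?A\<^esub> y"
  have m_additive: "additive_map A A (\<lambda>x. ?m x y)" if y: "y \<in> carrier A" for y
    using graded_sum_additive[OF abelian right[OF y]] semi_cross_mult[OF comp, of _ a y]
    by (simp add: additive_map_def)
  have m_hom: "?m x y = x \<otimes> (a ^^ p) y" if "x \<in> homog p" "y \<in> carrier A" for x y p
    using semi_cross_mult[OF comp hom_part_closed[OF that(1)]] graded_sum_hom_part[OF abelian right[OF that(2)] that(1)]
    by simp
  have m_closed: "?m x y \<in> carrier A" if "x \<in> carrier A" "y \<in> carrier A" for x y
    by (rule additive_closed[OF m_additive[OF that(2)] that(1)])
  have m_add_left: "?m (x \<oplus> y) z = ?m x z \<oplus> ?m y z"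
    if "x \<in> carrier A" "y \<in> carrier A" "z \<in> carrier A" for x y z
    by (rule additive_add[OF m_additive[OF that(3)] that(1,2)])
  have m_add_right: "?m x (y \<oplus> z) = ?m x y \<oplus> ?m x z"
    if "x \<in> carrier A" "y \<in> carrier A" "z \<in> carrier A" for x y z
    using that(1)
  proof (induction rule: hom_part_induct)
    case (hom p x)
    then show ?case
      using that hom_part_closed an_closed
      by (simp add: m_hom additive_add[OF k_linear_additive[OF an]] mult_add_right)
  next
    case (add u v)
    then show ?case using that by (simp add: m_add_left m_closed a_ac)
  qed
  have m_smult_left: "?m (c \<odot> x) y = c \<odot> ?m x y" if "x \<in> carrier A" "y \<in> carrier A" for c x y
    using that(1)
  proof (induction rule: hom_part_induct)
    case (hom p x)
    then show ?case
      using that hom_part_closed an_closed m_hom[OF smult_hom_part[OF hom]]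
      by (simp add: m_hom smult_mult_left)
  next
    case (add u v)
    then show ?case using that by (simp add: m_add_left m_closed smult_add_right)
  qed
  have m_smult_right: "?m x (c \<odot> y) = c \<odot> ?m x y" if "x \<in> carrier A" "y \<in> carrier A" for c x y
    using that(1)
  proof (induction rule: hom_part_induct)
    case (hom p x)
    then show ?case
      using that hom_part_closed an_closed by (simp add: m_hom k_linear_smult[OF an] smult_mult_right)
  next
    case (add u v)
    then show ?case using that by (simp add: m_add_left m_closed smult_add_right)
  qed
  have m_hom_part: "?m x y \<in> homog (p + q)" if "x \<in> homog p" "y \<in> homog q" for x y p q
    using m_hom[OF that(1) hom_part_closed[OF that(2)]] hom_part_mult[OF that(1) k_linear_hom_part[OF an that(2)]]
    by simp
  have ab_group: "abelian_group ?A" by (rule abelian_group_cong[OF addm abelian])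
  have "graded_kalgebra scale B ?A \<pi>"
    by (intro graded_kalgebra.intro graded_vector_space.intro graded_group.intro ab_group
        tensor_basis_axioms graded_group_axioms.intro graded_vector_space_axioms.intro
        graded_kalgebra_axioms.intro)
      (use proj_additive proj_proj proj_bound smult_add_right smult_add_left smult_smult proj_smult
        m_closed m_add_left m_add_right m_smult_left m_smult_right m_hom_part gen_hom_part gen_add gen_scale
        one_hom_part in \<open>simp_all add: same sum hom addmap\<close>)
  then show ?thesis
    by (intro twisted_pair.intro twisted_pair_axioms.intro graded_kalgebra_axioms)
      (use eq a b ab a_mult a_one a_gen \<alpha> \<beta> \<alpha>_\<beta> m_hom in auto)
qed

end

section \<open>The algebra \<open>A(E,R)\<close>\<close>

context tensor_basis
begin

abbreviation T :: "('k, 'e, 'e list \<Rightarrow> 'k) graded_algebra" where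
  "T \<equiv> tensor_algebra scale B"

lemma T_simps [simp]:
  "monoid.mult T s t = tensor_mult s t" "ring.add T s t = s + t" "\<zero>\<^bsub>T\<^esub> = 0"
  "smult T c t = tensor_scale c t" "comp T n = E n" "gen T e = pure [e]"
  by (simp_all add: tensor_algebra_def)

lemma T_one: "\<one>\<^bsub>T\<^esub> = pure []"
  by (auto simp: tensor_algebra_def pure_Nil)

lemma T_add: "s \<in> carrier T \<Longrightarrow> t \<in> carrier T \<Longrightarrow> s + t \<in> carrier T"
  unfolding carrier_tensor_algebra by (rule tensor.subspace_add[OF tensors_on_subspace])

lemma T_scale: "t \<in> carrier T \<Longrightarrow> tensor_scale c t \<in> carrier T"
  unfolding carrier_tensor_algebra by (rule tensor.subspace_scale[OF tensors_on_subspace])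

lemma T_zero: "0 \<in> carrier T"
  unfolding carrier_tensor_algebra by (rule tensor.subspace_0[OF tensors_on_subspace])

lemma T_uminus: "t \<in> carrier T \<Longrightarrow> - t \<in> carrier T"
  unfolding carrier_tensor_algebra by (rule tensor.subspace_neg[OF tensors_on_subspace])

lemma T_mult: "s \<in> carrier T \<Longrightarrow> t \<in> carrier T \<Longrightarrow> tensor_mult s t \<in> carrier T"
  unfolding carrier_tensor_algebra by (rule tensor_mult_closed)

lemma T_tensor_power: "t \<in> E n \<Longrightarrow> t \<in> carrier T"
  unfolding carrier_tensor_algebra using tensor_power_subset by blast

lemma T_pure: "pure v \<in> carrier T"
  by (rule T_tensor_power[OF pure_tensor_power[OF refl]])

lemma T_finite: "t \<in> carrier T \<Longrightarrow> finite {w. t w \<noteq> 0}"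
  unfolding carrier_tensor_algebra by (rule tensors_on_finite)

lemma one_mult: "tensor_mult (pure []) t = t"
  by (rule ext, subst tensor_mult_homogeneous[where p = 0]) (auto simp: pure_Nil split: if_splits)

lemma mult_one: "tensor_mult t (pure []) = t"
proof
  show "tensor_mult t (pure []) w = t w" for w
  proof -
    have "tensor_mult t (pure []) w = (\<Sum>i\<le>length w. if i = length w then t w else 0)"
      unfolding tensor_mult_def by (rule sum.cong) (auto simp: pure_Nil)
    then show ?thesis by simp
  qed
qed

lemma T_abelian_group: "abelian_group T"
proof (rule abelian_groupI)
  show "\<exists>s\<in>carrier T. s \<oplus>\<^bsub>T\<^esub> t = \<zero>\<^bsub>T\<^esub>" if "t \<in> carrier T" for t
    using T_uminus[OF that] by (intro bexI[of _ "- t"]) auto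
qed (auto simp: T_add T_zero add.assoc add.commute)

lemma T_ring: "ring T"
proof (rule ringI[OF T_abelian_group])
  show "Group.monoid T"
    by (rule Group.monoidI) (auto simp: T_mult T_one T_pure tensor_mult_assoc one_mult mult_one)
qed (auto simp: tensor_mult_add_left tensor_mult_add_right)

lemma T_minus:
  assumes "t \<in> carrier T"
  shows "\<ominus>\<^bsub>T\<^esub> t = - t"
proof -
  interpret T: abelian_group T by (rule T_abelian_group)
  show ?thesis
    using T.minus_equality[of "- t" t] assms T_uminus by simp
qed

text \<open>Replaces the library notion by closure conditions on tensors. Negatives are obtained by
  multiplying with -1 times the unit.\<close>

lemma T_ideal_iff:
  "ideal I T \<longleftrightarrow> I \<subseteq> carrier T \<and> 0 \<in> I \<and> (\<forall>s\<in>I. \<forall>t\<in>I. s + t \<in> I) \<and>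
     (\<forall>t\<in>I. \<forall>s\<in>carrier T. tensor_mult s t \<in> I \<and> tensor_mult t s \<in> I)"
proof
  assume "ideal I T"
  then interpret ideal I T .
  show "I \<subseteq> carrier T \<and> 0 \<in> I \<and> (\<forall>s\<in>I. \<forall>t\<in>I. s + t \<in> I) \<and>
     (\<forall>t\<in>I. \<forall>s\<in>carrier T. tensor_mult s t \<in> I \<and> tensor_mult t s \<in> I)"
    using a_subset additive_subgroup.zero_closed[OF is_additive_subgroup]
      additive_subgroup.a_closed[OF is_additive_subgroup] I_l_closed I_r_closed by auto
next
  assume I: "I \<subseteq> carrier T \<and> 0 \<in> I \<and> (\<forall>s\<in>I. \<forall>t\<in>I. s + t \<in> I) \<and>
     (\<forall>t\<in>I. \<forall>s\<in>carrier T. tensor_mult s t \<in> I \<and> tensor_mult t s \<in> I)"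
  show "ideal I T"
  proof (rule idealI[OF T_ring])
    show "subgroup I (add_monoid T)"
    proof (rule subgroup.intro)
      fix t assume t: "t \<in> I"
      have "tensor_mult (tensor_scale (- 1) (pure [])) t \<in> I"
        using I t T_scale[OF T_pure] by blast
      also have "tensor_mult (tensor_scale (- 1) (pure [])) t = - t"
        by (simp only: tensor_mult_scale_left one_mult) (simp add: tensor_scale_def fun_eq_iff)
      also have "- t = inv\<^bsub>add_monoid T\<^esub> t"
        using T_minus[of t] t I unfolding a_inv_def by (metis subsetD)
      finally show "inv\<^bsub>add_monoid T\<^esub> t \<in> I" .
    qed (use I in auto)
  qed (use I in auto)
qed

lemma T_ideal_scale: "ideal I T \<Longrightarrow> t \<in> I \<Longrightarrow> tensor_scale c t \<in> I"
proof -
  assume I: "ideal I T" and t: "t \<in> I"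
  have "tensor_mult (tensor_scale c (pure [])) t \<in> I"
    using I t T_scale[OF T_pure] unfolding T_ideal_iff by blast
  then show ?thesis by (simp add: tensor_mult_scale_left one_mult)
qed

section \<open>Homogeneous components in T(E) and in the ideal of relations\<close>

definition tensor_part :: "nat \<Rightarrow> ('e list \<Rightarrow> 'k) \<Rightarrow> 'e list \<Rightarrow> 'k" where
  "tensor_part n t = (\<lambda>w. if length w = n then t w else 0)"

lemma tensor_part_add: "tensor_part n (s + t) = tensor_part n s + tensor_part n t"
  by (auto simp: tensor_part_def)

lemma tensor_part_scale: "tensor_part n (tensor_scale c t) = tensor_scale c (tensor_part n t)"
  by (auto simp: tensor_part_def tensor_scale_def)

lemma tensor_part_tensor_power:
  assumes "t \<in> carrier T"
  shows "tensor_part n t \<in> E n"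
  using assms unfolding carrier_tensor_algebra
  by (auto simp: tensor_power_def tensor_part_def words_def tensors_on_def split: if_splits)

lemma tensor_power_part: "t \<in> E p \<Longrightarrow> tensor_part n t = (if n = p then t else 0)"
  by (fastforce simp: tensor_part_def tensor_power_def words_def fun_eq_iff)

text \<open>The part of degree n of a product involves only components whose degrees add up to n;
  written as a finite sum it can be tested for membership in an ideal term by term.\<close>

lemma tensor_part_mult:
  "tensor_part n (tensor_mult s t) w = (\<Sum>i\<le>n. tensor_mult (tensor_part i s) (tensor_part (n - i) t) w)"
proof -
  have "tensor_mult (tensor_part i s) (tensor_part (n - i) t) w =
    (if length w = n then s (take i w) * t (drop i w) else 0)" if "i \<le> n" for i
    using that by (subst tensor_mult_homogeneous[where p = i]) (auto simp: tensor_part_def split: if_splits)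
  then show ?thesis by (auto simp: tensor_part_def tensor_mult_def)
qed

lemma T_ideal_sum:
  assumes "ideal I T" "\<And>i. i \<le> n \<Longrightarrow> f i \<in> I"
  shows "(\<lambda>w. \<Sum>i\<le>(n::nat). f i w) \<in> I"
  using assms(2)
proof (induction n)
  case (Suc n)
  then have "(\<lambda>w. \<Sum>i\<le>n. f i w) + f (Suc n) \<in> I"
    using assms(1) unfolding T_ideal_iff by simp
  then show ?case by (simp add: plus_fun_def)
qed simp

end

locale relation_space = tensor_basis scale B
  for scale :: "'k::field \<Rightarrow> 'e::ab_group_add \<Rightarrow> 'e" and B :: "'e set" +
  fixes N :: nat and R :: "('e list \<Rightarrow> 'k) set"
  assumes R: "R \<subseteq> E N"
begin

definition I :: "('e list \<Rightarrow> 'k) set" where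
  "I = genideal T R"

lemma R_carrier: "R \<subseteq> carrier T"
  using R T_tensor_power by blast

lemma I_ideal: "ideal I T"
  unfolding I_def by (rule ring.genideal_ideal[OF T_ring R_carrier])

lemma I_carrier: "t \<in> I \<Longrightarrow> t \<in> carrier T"
  using I_ideal unfolding T_ideal_iff by blast

lemma I_zero: "0 \<in> I"
  and I_add: "s \<in> I \<Longrightarrow> t \<in> I \<Longrightarrow> s + t \<in> I"
  and I_mult: "s \<in> carrier T \<Longrightarrow> t \<in> I \<Longrightarrow> tensor_mult s t \<in> I" "s \<in> carrier T \<Longrightarrow> t \<in> I \<Longrightarrow> tensor_mult t s \<in> I"
  using I_ideal unfolding T_ideal_iff by blast+

lemma R_I: "R \<subseteq> I"
  unfolding I_def by (rule ring.genideal_self[OF T_ring R_carrier])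

lemma I_minimal: "ideal J T \<Longrightarrow> R \<subseteq> J \<Longrightarrow> I \<subseteq> J"
  unfolding I_def by (rule ring.genideal_minimal[OF T_ring])

text \<open>The ideal is graded because its generators are homogeneous: the elements of I all of
  whose components lie in I form an ideal containing R, hence all of I by minimality.\<close>

lemma tensor_part_I:
  assumes "t \<in> I"
  shows "tensor_part n t \<in> I"
proof -
  let ?J = "{t \<in> I. \<forall>n. tensor_part n t \<in> I}"
  have "ideal ?J T"
    unfolding T_ideal_iff
  proof (intro conjI ballI)
    show "?J \<subseteq> carrier T" using I_carrier by blast
    have "tensor_part n 0 = 0" for n by (auto simp: tensor_part_def)
    then show "0 \<in> ?J" using I_zero by simp
    show "s + t \<in> ?J" if "s \<in> ?J" "t \<in> ?J" for s t
      using that by (auto simp: tensor_part_add intro: I_add)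
  next
    fix t s assume t: "t \<in> ?J" and s: "s \<in> carrier T"
    have part: "tensor_part i s \<in> carrier T" for i
      using tensor_part_tensor_power[OF s] by (rule T_tensor_power)
    have "tensor_part n (tensor_mult s t) \<in> I" for n
    proof -
      have "tensor_part n (tensor_mult s t) = (\<lambda>w. \<Sum>i\<le>n. tensor_mult (tensor_part i s) (tensor_part (n - i) t) w)"
        by (rule ext) (rule tensor_part_mult)
      also have "\<dots> \<in> I" by (rule T_ideal_sum[OF I_ideal]) (use t part I_mult in auto)
      finally show ?thesis .
    qed
    then show "tensor_mult s t \<in> ?J" using I_mult s t by auto
    have "tensor_part n (tensor_mult t s) \<in> I" for n
    proof -
      have "tensor_part n (tensor_mult t s) = (\<lambda>w. \<Sum>i\<le>n. tensor_mult (tensor_part i t) (tensor_part (n - i) s) w)"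
        by (rule ext) (rule tensor_part_mult)
      also have "\<dots> \<in> I" by (rule T_ideal_sum[OF I_ideal]) (use t part I_mult in auto)
      finally show ?thesis .
    qed
    then show "tensor_mult t s \<in> ?J" using I_mult s t by auto
  qed
  moreover have "R \<subseteq> ?J"
  proof
    fix t assume t: "t \<in> R"
    then have "t \<in> E N" using R by blast
    then have "tensor_part n t \<in> I" for n
      using tensor_power_part[of t N n] t R_I I_zero by (cases "n = N") auto
    then show "t \<in> ?J" using t R_I by blast
  qed
  ultimately show ?thesis using I_minimal assms by blast
qed

section \<open>The quotient by the ideal of relations as a graded algebra\<close>

definition cls :: "('e list \<Rightarrow> 'k) \<Rightarrow> ('e list \<Rightarrow> 'k) set" where
  "cls t = I +>\<^bsub>T\<^esub> t"

abbreviation Q :: "('k, 'e, ('e list \<Rightarrow> 'k) set) graded_algebra" where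
  "Q \<equiv> homogeneous_algebra scale B R"

lemma cls_eq: "cls t = (\<lambda>i. i + t) ` I"
  by (auto simp: cls_def a_r_coset_def')

lemma cls_self: "t \<in> cls t"
  unfolding cls_eq using I_zero by force

lemma cls_absorb: 
  assumes "i \<in> I"
  shows "cls (i + t) = cls t"
proof -
  have neg: "- i \<in> I" using T_ideal_scale[OF I_ideal assms, of "- 1"]
    by (simp add: tensor_scale_def fun_Compl_def)
  show ?thesis
  proof (intro equalityI subsetI)
    fix s assume "s \<in> cls (i + t)"
    then obtain j where j: "j \<in> I" "s = j + (i + t)" by (auto simp: cls_eq)
    then have "s = (j + i) + t" by (simp add: add.assoc)
    then show "s \<in> cls t" using I_add[OF j(1) assms] by (auto simp: cls_eq)
  next
    fix s assume "s \<in> cls t"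
    then obtain j where j: "j \<in> I" "s = j + t" by (auto simp: cls_eq)
    then have "s = (j + - i) + (i + t)" by (simp add: add.assoc)
    then show "s \<in> cls (i + t)" using I_add[OF j(1) neg] unfolding cls_eq by (rule image_eqI)
  qed
qed

lemma cls_zero: "cls 0 = I"
  by (auto simp: cls_eq)

text \<open>Scalar multiplication and projections on the quotient are written as unions over all
  representatives. For an additive h preserving I every representative gives the same class, so the
  union collapses.\<close>

lemma cls_lift:
  assumes "t \<in> carrier T" "\<And>s. s \<in> I \<Longrightarrow> h s \<in> I"
    and "\<And>s t. s \<in> carrier T \<Longrightarrow> t \<in> carrier T \<Longrightarrow> h (s + t) = h s + h t"
  shows "(\<Union>x\<in>cls t. cls (h x)) = cls (h t)"
proof -
  have "cls (h x) = cls (h t)" if x: "x \<in> cls t" for x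
  proof -
    obtain i where i: "i \<in> I" "x = i + t" using x by (auto simp: cls_eq)
    then show ?thesis using assms I_carrier by (simp add: cls_absorb)
  qed
  then show ?thesis using cls_self[of t] by blast
qed

lemma Q_def': "Q = quotient_algebra T I"
  by (simp add: homogeneous_algebra_def I_def)

lemma Q_carrier: "carrier Q = cls ` carrier T"
  by (auto simp: Q_def' quotient_algebra_def FactRing_def A_RCOSETS_def' cls_def)

lemma Q_cls: "t \<in> carrier T \<Longrightarrow> cls t \<in> carrier Q"
  by (simp add: Q_carrier)

lemma Q_zero: "\<zero>\<^bsub>Q\<^esub> = cls 0"
  by (simp add: Q_def' quotient_algebra_def FactRing_def cls_zero)

lemma Q_one: "\<one>\<^bsub>Q\<^esub> = cls (pure [])"
  by (simp add: Q_def' quotient_algebra_def FactRing_def cls_def T_one)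

lemma Q_add: "s \<in> carrier T \<Longrightarrow> t \<in> carrier T \<Longrightarrow> cls s \<oplus>\<^bsub>Q\<^esub> cls t = cls (s + t)"
  using abelian_subgroup.a_rcos_sum[OF abelian_subgroupI3[OF ideal.axioms(1)[OF I_ideal] T_abelian_group], of s t]
  by (simp add: Q_def' quotient_algebra_def FactRing_def cls_def)

lemma Q_mult: "s \<in> carrier T \<Longrightarrow> t \<in> carrier T \<Longrightarrow> cls s \<otimes>\<^bsub>Q\<^esub> cls t = cls (tensor_mult s t)"
  using ideal.rcoset_mult_add[OF I_ideal, of s t]
  by (simp add: Q_def' quotient_algebra_def FactRing_def cls_def)

lemma Q_smult: "t \<in> carrier T \<Longrightarrow> c \<odot>\<^bsub>Q\<^esub> cls t = cls (tensor_scale c t)"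
proof -
  assume t: "t \<in> carrier T"
  have "c \<odot>\<^bsub>Q\<^esub> cls t = (\<Union>x\<in>cls t. cls (tensor_scale c x))"
    by (simp add: Q_def' quotient_algebra_def cls_def)
  also have "\<dots> = cls (tensor_scale c t)"
    by (rule cls_lift[OF t T_ideal_scale[OF I_ideal] tensor.scale_right_distrib])
  finally show ?thesis .
qed

lemma Q_comp: "comp Q n = cls ` E n"
  by (simp add: Q_def' quotient_algebra_def cls_def)

lemma Q_gen: "gen Q e = cls (pure [e])"
  by (simp add: Q_def' quotient_algebra_def cls_def)

definition Q_part :: "nat \<Rightarrow> ('e list \<Rightarrow> 'k) set \<Rightarrow> ('e list \<Rightarrow> 'k) set" where
  "Q_part n X = (\<Union>x\<in>X. cls (tensor_part n x))"

lemma Q_part_cls: "t \<in> carrier T \<Longrightarrow> Q_part n (cls t) = cls (tensor_part n t)"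
  unfolding Q_part_def by (rule cls_lift[OF _ tensor_part_I tensor_part_add])

lemma part_carrier: "t \<in> carrier T \<Longrightarrow> tensor_part n t \<in> carrier T"
  by (rule T_tensor_power[OF tensor_part_tensor_power])

lemma Q_abelian_group: "abelian_group Q"
proof (rule abelian_groupI)
  show "\<exists>Y\<in>carrier Q. Y \<oplus>\<^bsub>Q\<^esub> X = \<zero>\<^bsub>Q\<^esub>" if X: "X \<in> carrier Q" for X
  proof -
    obtain t where t: "t \<in> carrier T" "X = cls t" using X by (auto simp: Q_carrier)
    then show ?thesis
      using T_uminus[OF t(1)] by (intro bexI[of _ "cls (- t)"]) (auto simp: Q_add Q_cls Q_zero)
  qed
qed (auto simp: Q_carrier Q_add Q_zero T_add T_zero ac_simps)

lemma Q_hom_part: "hom_part Q Q_part n = cls ` E n"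
proof (intro equalityI subsetI)
  fix X assume "X \<in> hom_part Q Q_part n"
  then obtain t where t: "t \<in> carrier T" "X = cls t" "Q_part n X = X"
    by (auto simp: hom_part_def Q_carrier)
  then have "X = cls (tensor_part n t)" by (simp add: Q_part_cls)
  then show "X \<in> cls ` E n" using tensor_part_tensor_power[OF t(1)] by blast
next
  fix X assume "X \<in> cls ` E n"
  then obtain t where t: "t \<in> E n" "X = cls t" by auto
  then show "X \<in> hom_part Q Q_part n"
    using Q_part_cls[OF T_tensor_power[OF t(1)], of n] tensor_power_part[OF t(1), of n] Q_cls[OF T_tensor_power[OF t(1)]]
    by (simp add: hom_part_def)
qed

lemma Q_graded: "graded_group Q Q_part"
proof (intro graded_group.intro graded_group_axioms.intro Q_abelian_group)
  show "additive_map Q Q (Q_part n)" for n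
    by (rule additiveI)
      (auto simp: Q_carrier Q_add Q_part_cls T_add part_carrier tensor_part_add)
next
  fix X m n assume "X \<in> carrier Q"
  then obtain t where t: "t \<in> carrier T" "X = cls t" by (auto simp: Q_carrier)
  then show "Q_part m (Q_part n X) = (if m = n then Q_part n X else \<zero>\<^bsub>Q\<^esub>)"
    using tensor_power_part[OF tensor_part_tensor_power[OF t(1)], of m n]
    by (auto simp: Q_part_cls part_carrier Q_zero)
next
  fix X assume "X \<in> carrier Q"
  then obtain t where t: "t \<in> carrier T" "X = cls t" by (auto simp: Q_carrier)
  interpret Q: abelian_group Q by (rule Q_abelian_group)
  \<comment> \<open>Truncating t to words of length below m represents the partial sums of the
    projections of its class, which reduces the decomposition to one in T(E).\<close>
  have trunc: "(\<lambda>w. if length w < m then t w else 0) \<in> carrier T" for m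
    using t(1) unfolding carrier_tensor_algebra
    by (intro tensors_onI finite_subset[OF _ tensors_on_finite[OF t(1)[unfolded carrier_tensor_algebra]]])
      (auto dest: tensors_onD split: if_splits)
  have sum: "(\<Oplus>\<^bsub>Q\<^esub>n\<in>{..<m}. Q_part n X) = cls (\<lambda>w. if length w < m then t w else 0)" for m
  proof (induction m)
    case 0
    show ?case using Q_zero by (simp add: zero_fun_def)
  next
    case (Suc m)
    have "(\<Oplus>\<^bsub>Q\<^esub>n\<in>{..<Suc m}. Q_part n X) =
      cls (\<lambda>w. if length w < m then t w else 0) \<oplus>\<^bsub>Q\<^esub> cls (tensor_part m t)"
    proof -
      have "(\<Oplus>\<^bsub>Q\<^esub>n\<in>{..<Suc m}. Q_part n X) = (\<Oplus>\<^bsub>Q\<^esub>n\<in>{..<m}. Q_part n X) \<oplus>\<^bsub>Q\<^esub> Q_part m X"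
        by (rule Q.finsum_lessThan_Suc) (use t in \<open>simp add: Q_part_cls Q_cls part_carrier\<close>)
      then show ?thesis unfolding Suc using t by (simp add: Q_part_cls)
    qed
    also have "\<dots> = cls ((\<lambda>w. if length w < m then t w else 0) + tensor_part m t)"
      using trunc part_carrier[OF t(1)] by (simp add: Q_add)
    also have "(\<lambda>w. if length w < m then t w else 0) + tensor_part m t =
      (\<lambda>w. if length w < Suc m then t w else 0)"
      by (auto simp: tensor_part_def less_Suc_eq)
    finally show ?case .
  qed
  \<comment> \<open>One more than the longest word in the support; inserting 0 covers t = 0.\<close>
  define M where "M = Suc (Max (insert 0 (length ` {w. t w \<noteq> 0})))"
  have M: "length w < M" if "t w \<noteq> 0" for w
    using that T_finite[OF t(1)] by (auto simp: M_def less_Suc_eq_le intro!: Max_ge)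
  have "(\<lambda>w. if length w < M then t w else 0) = t"
    by (rule ext) (use M in auto)
  then have "X = (\<Oplus>\<^bsub>Q\<^esub>n\<in>{..<M}. Q_part n X)" using sum[of M] t(2) by simp
  moreover have "Q_part n X = \<zero>\<^bsub>Q\<^esub>" if "n \<ge> M" for n
  proof -
    have "tensor_part n t = 0" using M that by (fastforce simp: tensor_part_def fun_eq_iff)
    then show ?thesis using t by (simp add: Q_part_cls Q_zero)
  qed
  ultimately show "\<exists>M. (\<forall>n\<ge>M. Q_part n X = \<zero>\<^bsub>Q\<^esub>) \<and> X = (\<Oplus>\<^bsub>Q\<^esub>n\<in>{..<M}. Q_part n X)"
    by blast
qed

lemma pure_singleton: "pure [e] w = (if length w = 1 then representation B e (w ! 0) else 0)"
  by (simp add: pure_tensor_def)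

lemma Q_kalgebra: "graded_kalgebra scale B Q Q_part"
proof (intro graded_kalgebra.intro graded_vector_space.intro tensor_basis_axioms Q_graded
    graded_vector_space_axioms.intro graded_kalgebra_axioms.intro)
  show "X \<otimes>\<^bsub>Q\<^esub> Y \<in> hom_part Q Q_part (p + q)"
    if XY: "X \<in> hom_part Q Q_part p" "Y \<in> hom_part Q Q_part q" for X Y p q
  proof -
    obtain s t where "s \<in> E p" "t \<in> E q" "X = cls s" "Y = cls t"
      using XY unfolding Q_hom_part by blast
    then show ?thesis
      using tensor_mult_tensor_power[of s p t q] by (simp add: Q_hom_part Q_mult T_tensor_power)
  qed
  show "gen Q e \<in> hom_part Q Q_part 1" for e
    by (auto simp: Q_hom_part Q_gen pure_tensor_power)
  show "\<one>\<^bsub>Q\<^esub> \<in> hom_part Q Q_part 0"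
    by (auto simp: Q_hom_part Q_one pure_tensor_power)
  show "gen Q (e + e') = gen Q e \<oplus>\<^bsub>Q\<^esub> gen Q e'" for e e'
  proof -
    have "pure [e + e'] = pure [e] + pure [e']"
      by (auto simp: pure_singleton representation_add independent_Basis span_Basis)
    then show ?thesis by (simp add: Q_gen Q_add T_pure)
  qed
  show "gen Q (scale c e) = c \<odot>\<^bsub>Q\<^esub> gen Q e" for c e
  proof -
    have "pure [scale c e] = tensor_scale c (pure [e])"
      by (auto simp: pure_singleton tensor_scale_def representation_scale independent_Basis span_Basis)
    then show ?thesis by (simp add: Q_gen Q_smult T_pure)
  qed
qed (auto simp: Q_carrier Q_add Q_mult Q_smult T_add T_mult T_scale Q_part_cls part_carrier
    tensor.scale_right_distrib tensor.scale_left_distrib tensor_part_scale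
    tensor_mult_add_left tensor_mult_add_right tensor_mult_scale_left tensor_mult_scale_right)

subsection \<open>The automorphism induced by a linear map preserving the relations\<close>

lemma induced_map_eq: "induced_map scale B f X = tmap f ` X"
  by (simp add: induced_map_def tensor_map_eq)

lemma multi_map_T: "t \<in> carrier T \<Longrightarrow> multi_map g t \<in> carrier T"
  unfolding carrier_tensor_algebra by (rule multi_map_closed)

lemma multi_map_T_add:
  "s \<in> carrier T \<Longrightarrow> t \<in> carrier T \<Longrightarrow> multi_map g (s + t) = multi_map g s + multi_map g t"
  by (rule multi_map_add[OF T_finite T_finite])

text \<open>The tensors sent into I form an ideal, because the extension of f to T(E) is
  multiplicative, and this ideal contains R.\<close>

lemma multi_map_I:
  assumes f: "lin f" and R': "\<And>t. t \<in> R \<Longrightarrow> tmap f t \<in> R" and t: "t \<in> I"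
  shows "tmap f t \<in> I"
proof -
  let ?J = "{t \<in> carrier T. tmap f t \<in> I}"
  have "ideal ?J T"
    unfolding T_ideal_iff
  proof (intro conjI ballI)
    show "s + t \<in> ?J" if "s \<in> ?J" "t \<in> ?J" for s t
      using that by (auto simp: multi_map_T_add T_add intro: I_add)
    show "tensor_mult s t \<in> ?J" "tensor_mult t s \<in> ?J" if "t \<in> ?J" "s \<in> carrier T" for s t
      using that tensor_map_mult[OF f] I_mult multi_map_T
      by (auto simp: T_mult carrier_tensor_algebra[symmetric])
  qed (auto simp: T_zero I_zero)
  moreover have "R \<subseteq> ?J" using R' R_I R_carrier by blast
  ultimately show ?thesis using I_minimal t by blast
qed

lemma multi_map_inverse:
  assumes "lin f" "lin g" "\<And>e. g (f e) = e" "t \<in> carrier T"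
  shows "tmap g (tmap f t) = t"
  using assms(4) unfolding carrier_tensor_algebra
proof (induction rule: tensors_on_induct)
  case (add s t)
  have "tmap g (tmap f s) = s" "tmap g (tmap f t) = t"
    by (fact add)+
  with add(1,2) show "tmap g (tmap f (s + t)) = s + t"
    by (simp add: carrier_tensor_algebra[symmetric] multi_map_T_add multi_map_T)
next
  case (basis c v)
  let ?u = "\<lambda>w. if w = v then c else 0"
  have u: "?u \<in> E (length v)"
    using basis by (auto simp: tensor_power_def words_def)
  have "tmap g (tmap f ?u) = multi_map (\<lambda>_. g \<circ> f) ?u"
    by (rule multi_map_comp[OF u]) (use assms in auto)
  also have "\<dots> = ?u" by (rule multi_map_id[OF u]) (use assms in auto)
  finally show ?case .
qed (auto intro: exI[of _ "[]"])

lemma tensor_part_multi_map: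
  assumes "t \<in> carrier T"
  shows "tensor_part n (multi_map g t) = multi_map g (tensor_part n t)"
proof
  fix w
  let ?S = "{v. t v \<noteq> 0}"
  have fin: "finite ?S" by (rule T_finite[OF assms])
  have "multi_map g (tensor_part n t) w = (\<Sum>v\<in>?S. tensor_part n t v * pure (twist_word g v) w)"
    by (rule multi_map_eq[OF fin]) (auto simp: tensor_part_def)
  also have "\<dots> = (\<Sum>v\<in>?S. if length w = n then t v * pure (twist_word g v) w else 0)"
  proof (rule sum.cong)
    fix v
    show "tensor_part n t v * pure (twist_word g v) w = (if length w = n then t v * pure (twist_word g v) w else 0)"
      using pure_nonzero[of "twist_word g v" w] words_length[of w B "length v"]
      by (cases "pure (twist_word g v) w = 0") (auto simp: tensor_part_def)
  qed simp
  also have "\<dots> = tensor_part n (multi_map g t) w"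
    by (auto simp: tensor_part_def multi_map_def)
  finally show "tensor_part n (multi_map g t) w = multi_map g (tensor_part n t) w" by simp
qed

context
  fixes \<alpha> \<beta> :: "'e \<Rightarrow> 'e"
  assumes \<alpha>: "lin \<alpha>" and \<beta>: "lin \<beta>"
    and \<alpha>_\<beta>: "\<And>e. \<alpha> (\<beta> e) = e" and \<beta>_\<alpha>: "\<And>e. \<beta> (\<alpha> e) = e"
    and R_\<alpha>: "\<And>t. t \<in> R \<Longrightarrow> tmap \<alpha> t \<in> R"
    and R_\<beta>: "\<And>t. t \<in> R \<Longrightarrow> tmap \<beta> t \<in> R"
begin

text \<open>The induced map takes images of cosets as sets, so its value is a full coset only
  because \<alpha> maps I onto I; the inverse \<beta> supplies the preimages.\<close>

lemma induced_map_cls: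
  assumes t: "t \<in> carrier T"
  shows "induced_map scale B \<alpha> (cls t) = cls (tmap \<alpha> t)"
proof (intro equalityI subsetI)
  fix s assume "s \<in> induced_map scale B \<alpha> (cls t)"
  then obtain i where i: "i \<in> I" "s = tmap \<alpha> (i + t)"
    by (auto simp: induced_map_eq cls_eq)
  then have "s = tmap \<alpha> i + tmap \<alpha> t"
    using t I_carrier by (simp add: multi_map_T_add)
  then show "s \<in> cls (tmap \<alpha> t)"
    using multi_map_I[OF \<alpha> R_\<alpha> i(1)] by (auto simp: cls_eq)
next
  fix s assume "s \<in> cls (tmap \<alpha> t)"
  then obtain j where j: "j \<in> I" "s = j + tmap \<alpha> t" by (auto simp: cls_eq)
  let ?i = "tmap \<beta> j"
  have i: "?i \<in> I" by (rule multi_map_I[OF \<beta> R_\<beta> j(1)])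
  have "tmap \<alpha> ?i = j"
    by (rule multi_map_inverse[OF \<beta> \<alpha> \<alpha>_\<beta> I_carrier[OF j(1)]])
  then have "s = tmap \<alpha> (?i + t)"
    using j(2) t I_carrier[OF i] by (simp add: multi_map_T_add)
  then show "s \<in> induced_map scale B \<alpha> (cls t)"
    using i by (auto simp: induced_map_eq cls_eq)
qed

lemma induced_map_k_linear: "graded_vector_space.k_linear Q Q_part (induced_map scale B \<alpha>)"
proof -
  interpret Q: graded_kalgebra scale B Q Q_part by (rule Q_kalgebra)
  show ?thesis
    unfolding Q.k_linear_def
    by (auto simp: additive_map_def Q_carrier induced_map_cls Q_add Q_smult Q_part_cls T_add T_scale
        multi_map_T part_carrier multi_map_T_add multi_map_scale tensor_part_multi_map)
qed

lemma induced_map_mult: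
  assumes "X \<in> carrier Q" "Y \<in> carrier Q"
  shows "induced_map scale B \<alpha> (X \<otimes>\<^bsub>Q\<^esub> Y) = induced_map scale B \<alpha> X \<otimes>\<^bsub>Q\<^esub> induced_map scale B \<alpha> Y"
  using assms tensor_map_mult[OF \<alpha>]
  by (auto simp: Q_carrier induced_map_cls Q_mult T_mult multi_map_T carrier_tensor_algebra[symmetric])

lemma induced_map_one: "induced_map scale B \<alpha> \<one>\<^bsub>Q\<^esub> = \<one>\<^bsub>Q\<^esub>"
  by (simp add: Q_one induced_map_cls T_pure multi_map_pure \<alpha>)

lemma induced_map_gen: "induced_map scale B \<alpha> (gen Q e) = gen Q (\<alpha> e)"
  by (simp add: Q_gen induced_map_cls T_pure multi_map_pure \<alpha>)

end

lemma quotient_twisted_pair: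
  assumes "lin \<alpha>" "lin \<beta>" "\<And>e. \<alpha> (\<beta> e) = e" "\<And>e. \<beta> (\<alpha> e) = e"
    and "\<And>t. t \<in> R \<Longrightarrow> tmap \<alpha> t \<in> R" "\<And>t. t \<in> R \<Longrightarrow> tmap \<beta> t \<in> R"
  shows "twisted_pair scale B Q (semi_cross Q (induced_map scale B \<alpha>)) Q_part
    (induced_map scale B \<alpha>) (induced_map scale B \<beta>) \<alpha> \<beta>"
proof (rule graded_kalgebra.semi_cross_twisted_pair[OF Q_kalgebra])
  \<comment> \<open>The hypotheses are symmetric in \<alpha> and \<beta>; \<open>b\<close> lists
    them with the two exchanged.\<close>
  note a = assms(1-6) and b = assms(2) assms(1) assms(4) assms(3) assms(6) assms(5)
  show "comp Q n = hom_part Q Q_part n" for n by (simp add: Q_comp Q_hom_part)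
  show "graded_vector_space.k_linear Q Q_part (induced_map scale B \<alpha>)"
    by (rule induced_map_k_linear[OF a])
  show "graded_vector_space.k_linear Q Q_part (induced_map scale B \<beta>)"
    by (rule induced_map_k_linear[OF b])
  show "induced_map scale B \<alpha> (induced_map scale B \<beta> X) = X" if "X \<in> carrier Q" for X
    using that by (auto simp: Q_carrier induced_map_cls[OF a] induced_map_cls[OF b] multi_map_T
        multi_map_inverse[OF assms(2,1,3)])
  show "induced_map scale B \<beta> (induced_map scale B \<alpha> X) = X" if "X \<in> carrier Q" for X
    using that by (auto simp: Q_carrier induced_map_cls[OF a] induced_map_cls[OF b] multi_map_T
        multi_map_inverse[OF assms(1,2,4)])
  show "induced_map scale B \<alpha> (X \<otimes>\<^bsub>Q\<^esub> Y) = induced_map scale B \<alpha> X \<otimes>\<^bsub>Q\<^esub> induced_map scale B \<alpha> Y"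
    if "X \<in> carrier Q" "Y \<in> carrier Q" for X Y
    by (rule induced_map_mult[OF a that])
  show "induced_map scale B \<alpha> \<one>\<^bsub>Q\<^esub> = \<one>\<^bsub>Q\<^esub>" by (rule induced_map_one[OF a])
  show "induced_map scale B \<alpha> (gen Q e) = gen Q (\<alpha> e)" for e by (rule induced_map_gen[OF a])
qed (use assms in auto)

end

theorem mainTheorem4:
  fixes scale :: "'k::field \<Rightarrow> 'e::ab_group_add \<Rightarrow> 'e"
    and B :: "'e set"
    and R :: "('e list \<Rightarrow> 'k) set"
    and \<alpha> :: "'e \<Rightarrow> 'e"
    and N D :: nat
  assumes "finite_dimensional_vector_space scale B"
    and "N \<ge> 2"
    and "R \<subseteq> tensor_power B N"
    and "module.subspace tensor_scale R"
    and "homogeneous_automorphism scale B R \<alpha>"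
    and "koszul_algebra B N (homogeneous_algebra scale B R)"
    and "has_global_dimension B N (homogeneous_algebra scale B R) D"
  shows "gorenstein_algebra B N (homogeneous_algebra scale B R) \<longleftrightarrow>
         gorenstein_algebra B N
           (semi_cross (homogeneous_algebra scale B R) (induced_map scale B \<alpha>))"
proof -
  interpret relation_space scale B N R
    using assms(1,3) by (simp add: relation_space_def relation_space_axioms_def tensor_basis_def)
  have \<alpha>: "lin \<alpha>" "bij \<alpha>" "tmap \<alpha> ` R = R"
    using assms(5) by (auto simp: homogeneous_automorphism_def tensor_map_eq)
  define \<beta> where "\<beta> = inv_into UNIV \<alpha>"
  have inv: "\<alpha> (\<beta> e) = e" "\<beta> (\<alpha> e) = e" for e
    using \<alpha>(2) by (simp_all add: \<beta>_def bij_is_surj surj_f_inv_f bij_is_inj inv_f_f)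
  interpret \<alpha>: Vector_Spaces.linear scale scale \<alpha> by (rule \<alpha>(1))
  have \<beta>: "lin \<beta>"
  proof unfold_locales
    show "\<beta> (x + y) = \<beta> x + \<beta> y" for x y
      using \<alpha>.add[of "\<beta> x" "\<beta> y"] inv(2)[of "\<beta> x + \<beta> y"] by (simp add: inv(1))
    show "\<beta> (scale c x) = scale c (\<beta> x)" for c x
      using \<alpha>.scale[of c "\<beta> x"] inv(2)[of "scale c (\<beta> x)"] by (simp add: inv(1))
  qed
  have R\<alpha>: "tmap \<alpha> t \<in> R" if "t \<in> R" for t using \<alpha>(3) that by blast
  have R\<beta>: "tmap \<beta> t \<in> R" if "t \<in> R" for t
  proof -
    \<comment> \<open>Equality in \<alpha>(R) = R enters here: t has a preimage in R, and \<beta>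
      sends t to that preimage.\<close>
    have "t \<in> tmap \<alpha> ` R" using that \<alpha>(3) by simp
    then obtain s where s: "t = tmap \<alpha> s" "s \<in> R" by (rule imageE)
    have "s \<in> carrier T" using s(2) R_carrier by blast
    then have "tmap \<beta> t = s"
      unfolding s(1) by (rule multi_map_inverse[OF \<alpha>(1) \<beta> inv(2)])
    then show ?thesis using s(2) by simp
  qed
  show ?thesis
    by (rule twisted_pair.gorenstein_algebra_twist[OF quotient_twisted_pair[OF \<alpha>(1) \<beta> inv R\<alpha> R\<beta>] assms(2)])
qed

end
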